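(* Suppose that $\mathbb{P}(W\in\mathbb{C}^b\setminus\mathbb{R}_+^b)>0$ and $\sum_{i=0}^{b-1}\mathbb{E}(|W_i|^p)<\infty$ for all $p\in\mathbb{R}$. Suppose also that one of the following holds: (i) $\mathbb{P}(\sum_{i=0}^{b-1}W_i\ne1)>0$, and there exists $p>1$ with $\varphi_W(p)>0$ and such that either $p\in(1,2]$ or $\varphi_W(2)>0$; (ii) $\mathbb{P}(\sum_{i=0}^{b-1}W_i=1)=1$, and there exists $p>1$ with $\varphi_W(p)>0$. Let $\beta$ be the smallest solution of $\varphi_W(p)=0$, and suppose that $\varphi_W(p)>0$ for all $p>\beta$. Then $\beta>1$, $\varphi_{W^{(\beta)}}(1)=0$ and $\varphi_{W^{(\beta)}}(p)>0$ for all $p>1$. Let $B_{1/\beta}=F_W\circ F_{W^{(\beta)}}^{-1}$ (defined on $[0,F_{W^{(\beta)}}(1)]$). With probability 1, the function $B_{1/\beta}$ is a monofractal function in the strong sense, with constant pointwise Hölder exponent $1/\beta$; that is, at every point $t$ of its domain $$\lim_{r\to0^+}\frac{\log \mathrm{Osc}_{B_{1/\beta}}([t-r,t+r])}{\log r}=\frac1\beta .$$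
   Context: Fix an integer $b\ge 2$, let $\mathscr{A}=\{0,\dots,b-1\}$ and let $\mathscr{A}^*=\bigcup_{n\ge 0}\mathscr{A}^n$ be the set of finite words ($\mathscr{A}^0=\{\varnothing\}$). Let $W=(W_0,\dots,W_{b-1})$ be a $\mathbb{C}^b$-valued random vector with integrable components satisfying $\mathbb{E}\big(\sum_{i=0}^{b-1}W_i\big)=1$, and let $(W(w))_{w\in\mathscr{A}^*}$ be a family of independent copies of $W$. For $n\ge1$ and $t\in[0,1]$ define $$F_{W,n}(t)=\int_0^t b^n\prod_{k=1}^n W_{u_k}(u|k-1)\,\mathrm{d}u,$$ where a non $b$-adic point $u=\sum_{k\ge1}u_kb^{-k}$ is identified with the infinite word $u_1u_2\cdots$ of its $b$-adic digits, $u|k=u_1\cdots u_k$ and $u|0=\varnothing$. For $p\in\mathbb{R}_+$ let $\varphi_W(p)=-\log_b\mathbb{E}\big(\sum_{i=0}^{b-1}|W_i|^p\big)$. Under (i) or (ii), $F_{W,n}$ converges almost surely uniformly on $[0,1]$ as $n\to\infty$; the limit is denoted $F_W$. If $\beta>0$ and $\varphi_W(\beta)>-\infty$, let $W^{(\beta)}(w)=b^{\varphi_W(\beta)}(|W_0(w)|^\beta,\dots,|W_{b-1}(w)|^\beta)$ for $w\in\mathscr{A}^*$, and $W^{(\beta)}=W^{(\beta)}(\varnothing)$; $\varphi_{W^{(\beta)}}$ is defined as $\varphi_W$ with $W^{(\beta)}$ in place of $W$, so $\varphi_{W^{(\beta)}}(p)=\varphi_W(\beta p)-p\varphi_W(\beta)$.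 If $\varphi_{W^{(\beta)}}(p)>0$ for some $p\in(1,2)$, $F_{W^{(\beta)}}$ denotes the nondecreasing function which is the almost sure uniform limit of $F_{W^{(\beta)},n}(t)=\int_0^t b^{n}\prod_{k=1}^{n}W^{(\beta)}_{u_{k}}(u|k-1)\,\mathrm{d}u$. For a function $f$ and a set $J$, $\mathrm{Osc}_f(J)=\sup_{s,t}|f(t)-f(s)|$, the supremum being over $s,t$ in $J$ intersected with the domain of $f$. A function is monofractal in the strong sense if $\lim_{r\to0^+}\log\mathrm{Osc}_f([t-r,t+r])/\log r$ exists at every $t$ and does not depend on $t$. *)

theory Defs
  imports "HOL-Probability.Probability"
begin

definition words :: "nat \<Rightarrow> nat list set" where
  "words b = {w. set w \<subseteq> {..<b}}"

text \<open>The space of \<open>b\<close>-vectors, indexed by \<open>0, \<dots>, b - 1\<close>, with entries in a given topological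
  space. Its points are the functions that are \<open>undefined\<close> outside \<open>{..<b}\<close>.\<close>

definition vec_space :: "nat \<Rightarrow> (nat \<Rightarrow> 'v::topological_space) measure" where
  "vec_space b = PiM {..<b} (\<lambda>_. borel)"

text \<open>The power \<open>x\<^sup>p\<close> of \<open>x \<ge> 0\<close> with values in \<open>[0, \<infinity>]\<close>. Since \<open>0 powr p = 0\<close> for every \<open>p\<close>, the
  value \<open>\<infinity>\<close> at \<open>x = 0\<close>, \<open>p < 0\<close> has to be set explicitly: a vector with finite moments of negative
  order has almost surely nonzero components.\<close>

definition epowr :: "real \<Rightarrow> real \<Rightarrow> ennreal" where
  "epowr x p = (if x = 0 \<and> p < 0 then \<infinity> else ennreal (x powr p))"

definition moment_sum ::
  "'a measure \<Rightarrow> nat \<Rightarrow> ('a \<Rightarrow> nat \<Rightarrow> 'v::real_normed_vector) \<Rightarrow> real \<Rightarrow> ennreal" where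
  "moment_sum M b W p = (\<integral>\<^sup>+\<omega>. (\<Sum>i<b. epowr (norm (W \<omega> i)) p) \<partial>M)"

text \<open>The function \<open>\<phi>\<^sub>W(p) = - log\<^sub>b E(\<Sum>\<^sub>i |W\<^sub>i|\<^sup>p)\<close>, with \<open>- log\<^sub>b \<infinity> = -\<infinity>\<close> and \<open>- log\<^sub>b 0 = \<infinity>\<close>.\<close>

definition phi ::
  "'a measure \<Rightarrow> nat \<Rightarrow> ('a \<Rightarrow> nat \<Rightarrow> 'v::real_normed_vector) \<Rightarrow> real \<Rightarrow> ereal" where
  "phi M b W p =
    (if moment_sum M b W p = \<infinity> then -\<infinity>
     else if moment_sum M b W p = 0 then \<infinity>
     else ereal (- log (real b) (enn2real (moment_sum M b W p))))"

text \<open>The \<open>k\<close>-th \<open>b\<close>-adic digit, \<open>k \<ge> 1\<close>, of \<open>u \<in> [0, 1)\<close>, and the word of the first \<open>k\<close> digits.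
  At \<open>b\<close>-adic points the terminating expansion is used.\<close>

definition digit :: "nat \<Rightarrow> real \<Rightarrow> nat \<Rightarrow> nat" where
  "digit b u k = nat (\<lfloor>u * real b ^ k\<rfloor> mod int b)"

definition digit_prefix :: "nat \<Rightarrow> real \<Rightarrow> nat \<Rightarrow> nat list" where
  "digit_prefix b u k = map (digit b u) [1..<Suc k]"

definition cascade ::
  "nat \<Rightarrow> (nat list \<Rightarrow> 'a \<Rightarrow> nat \<Rightarrow> 'v::{real_normed_field, banach, second_countable_topology})
    \<Rightarrow> nat \<Rightarrow> 'a \<Rightarrow> real \<Rightarrow> 'v" where
  "cascade b W n \<omega> t =
    (LINT u:{0..t}|lborel.
       of_nat b ^ n * (\<Prod>k=1..n. W (digit_prefix b u (k - 1)) \<omega> (digit b u k)))"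

text \<open>The limit is taken pointwise; it is the uniform limit on \<open>[0, 1]\<close> whenever the functions
  converge uniformly there.\<close>

definition cascade_limit ::
  "nat \<Rightarrow> (nat list \<Rightarrow> 'a \<Rightarrow> nat \<Rightarrow> 'v::{real_normed_field, banach, second_countable_topology})
    \<Rightarrow> 'a \<Rightarrow> real \<Rightarrow> 'v" where
  "cascade_limit b W \<omega> t = lim (\<lambda>n. cascade b W n \<omega> t)"

text \<open>The family \<open>W\<^sup>(\<^sup>\<beta>\<^sup>)(w) = b powr \<phi>\<^sub>W(\<beta>) \<cdot> (|W\<^sub>i(w)| powr \<beta>)\<^sub>i\<close>, meant for \<open>\<beta> > 0\<close> and
  \<open>\<phi>\<^sub>W(\<beta>) > -\<infinity>\<close>. The vector \<open>V\<close> only enters through the normalising constant \<open>b powr \<phi>\<^sub>V(\<beta>)\<close>; it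
  is the vector of which the \<open>W(w)\<close> are copies.\<close>

definition power_family ::
  "'a measure \<Rightarrow> nat \<Rightarrow> ('a \<Rightarrow> nat \<Rightarrow> 'v::real_normed_vector) \<Rightarrow> real
    \<Rightarrow> (nat list \<Rightarrow> 'a \<Rightarrow> nat \<Rightarrow> 'v) \<Rightarrow> nat list \<Rightarrow> 'a \<Rightarrow> nat \<Rightarrow> real" where
  "power_family M b V \<beta> W w \<omega> =
    (\<lambda>i\<in>{..<b}. real b powr real_of_ereal (phi M b V \<beta>) * norm (W w \<omega> i) powr \<beta>)"

definition Osc :: "real set \<Rightarrow> (real \<Rightarrow> 'v::real_normed_vector) \<Rightarrow> real set \<Rightarrow> real" where
  "Osc D f J = (SUP (s, t) \<in> (J \<inter> D) \<times> (J \<inter> D). norm (f t - f s))"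

text \<open>\<open>D\<close> is the domain of \<open>f\<close>. The convention \<open>ln 0 = 0\<close> is harmless for \<open>h \<noteq> 0\<close>: if \<open>f\<close> is constant
  near \<open>t\<close>, the quotient below is eventually \<open>0\<close>, so the limit \<open>h\<close> is not attained.\<close>

definition has_local_exponent ::
  "real set \<Rightarrow> (real \<Rightarrow> 'v::real_normed_vector) \<Rightarrow> real \<Rightarrow> real \<Rightarrow> bool" where
  "has_local_exponent D f h t \<longleftrightarrow>
    ((\<lambda>r. ln (Osc D f {t - r..t + r}) / ln r) \<longlongrightarrow> h) (at_right 0)"

definition strongly_monofractal :: "real set \<Rightarrow> (real \<Rightarrow> 'v::real_normed_vector) \<Rightarrow> bool" where
  "strongly_monofractal D f \<longleftrightarrow> (\<exists>h. \<forall>t\<in>D. has_local_exponent D f h t)"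

end

theory Submission
  imports Defs
begin

text \<open>Write \<open>Q(w)\<close> for the product of the weights along the word \<open>w\<close>, \<open>Y(w)\<close> for the total mass of
  the limit cascade in the subtree of \<open>w\<close>, and \<open>P(w)\<close>, \<open>Z(w)\<close> for the same quantities of the family
  \<open>W\<^sup>(\<^sup>\<beta>\<^sup>)\<close>. Then \<open>F\<^sub>W\<close> has the increment \<open>Q(w) Y(w)\<close> over the \<open>b\<close>-adic cell of \<open>w\<close>, the measure with
  distribution function \<open>F\<close> of \<open>W\<^sup>(\<^sup>\<beta>\<^sup>)\<close> gives the cell the mass \<open>P(w) Z(w)\<close>, and \<open>P(w) = |Q(w)|\<^sup>\<beta>\<close> because
  \<open>\<phi>\<^sub>W(\<beta>) = 0\<close>. So the increment of \<open>F\<^sub>W\<close> over a cell is the mass of the cell to the power \<open>1/\<beta>\<close>, up to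
  factors \<open>Y(w)\<close> and \<open>Z(w)\<close> whose laws do not depend on \<open>w\<close>. Almost surely \<open>|Y(w)|\<close>, \<open>Z(w)\<close>, \<open>1/Z(w)\<close>, the
  inverse of the oscillation of the limit in the subtree of \<open>w\<close>, and \<open>1/|W\<^sub>i(w)|\<close> grow subexponentially in
  the length of \<open>w\<close>, uniformly in \<open>w\<close>, while masses decay exponentially. After the time change by the mass
  the exponent is therefore \<open>1/\<beta>\<close> everywhere.

  The deterministic half derives the exponent from the almost sure bounds, which are collected in
  \<open>regular_family\<close>. An interval of small mass is a union of cells with at most \<open>2b\<close> of each
  generation; summing the estimates of the cells gives the upper bound for the oscillation
  (\<open>modulus_of_continuity\<close>). For the lower bound, a point has a smallest generation at which its cell has
  mass at most \<open>r\<close>; the parent has larger mass, and passing from the parent to the child, and from the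
  mass to the oscillation, costs subexponential factors only (\<open>oscillation_lower_bound\<close>).

  The probabilistic half proves these bounds (\<open>AE_regular_family\<close>). The number of words of
  length \<open>m\<close> is \<open>b\<^sup>m\<close>, so bounds that hold for all words at once need moments of every order.
  All components satisfy \<open>|W\<^sub>i| \<le> 1\<close>, as \<open>E(\<Sum> |W\<^sub>i|\<^sup>p) < 1\<close> for every \<open>p > \<beta>\<close>. The increments
  \<open>Y\<^sub>n\<^sub>+\<^sub>1 - Y\<^sub>n\<close> of the total masses then have geometrically decaying moments of all orders: for the second
  moment this is orthogonality, and for higher moments the mixed terms of
  \<open>|\<Sum> W\<^sub>i (Y\<^sub>n\<^sub>+\<^sub>1 - Y\<^sub>n)(i)|\<^sup>k\<close> contain lower moments only (\<open>step_moment_decay\<close>). This needs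
  \<open>E(\<Sum> |W\<^sub>i|\<^sup>k) < 1\<close> for all \<open>k \<ge> 2\<close>, which holds for \<open>W\<^sup>(\<^sup>\<beta>\<^sup>)\<close> and, in the first case of the theorem, for
  \<open>W\<close>, because there \<open>\<beta> < 2\<close>; in the second case all increments vanish. The lower tail of the
  oscillation decays faster than every power: the oscillation is small only if it is small in two
  independent subtrees, up to the factors \<open>|W\<^sub>i|\<close>, which have all negative moments, and this recursion can
  be iterated (\<open>prob_increments_le_power\<close>). Moment bounds, summed over all words, give all almost sure
  statements (\<open>AE_bounded_family\<close>).\<close>

section \<open>Subtrees, weights and total masses\<close>

definition subtree :: "nat list \<Rightarrow> (nat list \<Rightarrow> 'c) \<Rightarrow> nat list \<Rightarrow> 'c" where
  "subtree w x = (\<lambda>v. x (w @ v))"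

fun path_weight :: "(nat list \<Rightarrow> nat \<Rightarrow> 'v::comm_monoid_mult) \<Rightarrow> nat list \<Rightarrow> 'v" where
  "path_weight x [] = 1"
| "path_weight x (i # w) = x [] i * path_weight (subtree [i] x) w"

text \<open>For a family \<open>x\<close> of weight vectors this is \<open>F\<^sub>n(1)\<close>, in the form of its self-similarity.\<close>

fun total_mass :: "nat \<Rightarrow> nat \<Rightarrow> (nat list \<Rightarrow> nat \<Rightarrow> 'v::comm_semiring_1) \<Rightarrow> 'v" where
  "total_mass b 0 x = 1"
| "total_mass b (Suc n) x = (\<Sum>i<b. x [] i * total_mass b n (subtree [i] x))"

definition mass_step :: "nat \<Rightarrow> nat \<Rightarrow> (nat list \<Rightarrow> nat \<Rightarrow> 'v::comm_ring_1) \<Rightarrow> 'v" where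
  "mass_step b n x = total_mass b (Suc n) x - total_mass b n x"

text \<open>The coordinate that \<open>t\<close> has inside the \<open>i\<close>-th of the \<open>b\<close> cells of \<open>[0, 1]\<close>; points left or
  right of the cell are sent to its end points.\<close>

definition cell_coord :: "nat \<Rightarrow> nat \<Rightarrow> real \<Rightarrow> real" where
  "cell_coord b i t = max 0 (min 1 (real b * t - real i))"

text \<open>The function \<open>F\<^sub>n\<close>, defined by its self-similarity rather than by the integral over the digits;
  the two agree on \<open>[0, 1]\<close> by \<open>cascade_eq_cell_cascade\<close>.\<close>

fun cell_cascade ::
  "nat \<Rightarrow> nat \<Rightarrow> (nat list \<Rightarrow> nat \<Rightarrow> 'v::real_normed_field) \<Rightarrow> real \<Rightarrow> 'v" where
  "cell_cascade b 0 x t = of_real t"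
| "cell_cascade b (Suc n) x t = (\<Sum>i<b. x [] i * cell_cascade b n (subtree [i] x) (cell_coord b i t))"

definition cell_cascade_lim ::
  "nat \<Rightarrow> (nat list \<Rightarrow> nat \<Rightarrow> 'v::{real_normed_field, banach, second_countable_topology})
    \<Rightarrow> real \<Rightarrow> 'v" where
  "cell_cascade_lim b x t = lim (\<lambda>n. cell_cascade b n x t)"

definition total_lim ::
  "nat \<Rightarrow> (nat list \<Rightarrow> nat \<Rightarrow> 'v::{real_normed_field, banach, second_countable_topology})
    \<Rightarrow> 'v" where
  "total_lim b x = lim (\<lambda>n. total_mass b n x)"

lemma subtree_Nil [simp]: "subtree [] x = x"
  by (simp add: subtree_def)

lemma subtree_subtree [simp]: "subtree u (subtree w x) = subtree (w @ u) x"
  by (simp add: subtree_def)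

lemma subtree_at_root [simp]: "subtree w x [] = x w"
  by (simp add: subtree_def)

lemma subtree_apply: "subtree w x v = x (w @ v)"
  by (simp add: subtree_def)

lemma Nil_in_words [simp]: "[] \<in> words b"
  by (simp add: words_def)

lemma Cons_in_words [simp]: "i # w \<in> words b \<longleftrightarrow> i < b \<and> w \<in> words b"
  by (auto simp: words_def)

lemma append_in_words [simp]: "u @ w \<in> words b \<longleftrightarrow> u \<in> words b \<and> w \<in> words b"
  by (auto simp: words_def)

lemma path_weight_append:
  "path_weight x (u @ v) = path_weight x u * path_weight (subtree u x) v"
  by (induction u arbitrary: x) (auto simp: mult.assoc)

lemma path_weight_snoc: "path_weight x (u @ [i]) = path_weight x u * x u i"
  by (simp add: path_weight_append)

lemma cell_coord_0 [simp]: "cell_coord b i 0 = 0"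
  by (simp add: cell_coord_def)

lemma cell_coord_1: "i < b \<Longrightarrow> cell_coord b i 1 = 1"
  by (auto simp: cell_coord_def)

lemma cell_coord_in: "cell_coord b i t \<in> {0..1}"
  by (simp add: cell_coord_def)

lemma cell_coord_nonneg [simp]: "0 \<le> cell_coord b i t"
  and cell_coord_le1 [simp]: "cell_coord b i t \<le> 1"
  by (simp_all add: cell_coord_def)

lemma cell_coord_mono: "s \<le> t \<Longrightarrow> cell_coord b i s \<le> cell_coord b i t"
  unfolding cell_coord_def
  by (intro max.mono min.mono diff_mono mult_left_mono) auto

lemma cell_cascade_0 [simp]: "cell_cascade b n x 0 = 0"
  by (induction n arbitrary: x) auto

lemma cell_cascade_1: "cell_cascade b n x 1 = total_mass b n x"
  by (induction n arbitrary: x) (auto simp: cell_coord_1)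

section \<open>The digit integrals as a recursion over the cells\<close>

lemma digit_Suc_cell:
  assumes "0 \<le> v" "v < 1" "i < b"
  shows "digit b ((v + real i) / real b) (Suc k) = (if k = 0 then i else digit b v k)"
proof -
  have b: "real b > 0" using assms by simp
  have "(v + real i) / real b * real b ^ Suc k = v * real b ^ k + real_of_int (int i * int b ^ k)"
    using b by (simp add: field_simps)
  then have fl: "\<lfloor>(v + real i) / real b * real b ^ Suc k\<rfloor> = \<lfloor>v * real b ^ k\<rfloor> + int i * int b ^ k"
    by (metis floor_add_int)
  show ?thesis
  proof (cases k)
    case 0
    then have "\<lfloor>v * real b ^ k\<rfloor> = 0" using assms by (simp add: floor_eq_iff)
    then show ?thesis using 0 assms fl unfolding digit_def by simp
  next
    case (Suc m)
    have "(\<lfloor>v * real b ^ k\<rfloor> + int i * int b ^ k) mod int b = \<lfloor>v * real b ^ k\<rfloor> mod int b"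
      unfolding Suc by (simp add: mult.left_commute[of "int i"] mod_add_right_eq flip: mod_add_right_eq)
    then show ?thesis using Suc fl unfolding digit_def by simp
  qed
qed

lemma digit_prefix_cell:
  assumes "0 \<le> v" "v < 1" "i < b"
  shows "digit_prefix b ((v + real i) / real b) (Suc k) = i # digit_prefix b v k"
proof -
  have 1: "[1..<Suc (Suc k)] = Suc 0 # map Suc [1..<Suc k]"
    by (simp add: map_Suc_upt upt_conv_Cons del: upt_Suc)
  show ?thesis
    unfolding digit_prefix_def 1
    by (auto simp: digit_Suc_cell[OF assms] simp del: upt_Suc)
qed

text \<open>The integrand of \<^term>\<open>cascade\<close>.\<close>

definition digit_density ::
  "nat \<Rightarrow> (nat list \<Rightarrow> nat \<Rightarrow> 'v::{real_normed_field, banach, second_countable_topology})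
    \<Rightarrow> nat \<Rightarrow> real \<Rightarrow> 'v" where
  "digit_density b x n u = of_nat b ^ n * (\<Prod>k=1..n. x (digit_prefix b u (k - 1)) (digit b u k))"

lemma digit_density_cell:
  assumes "0 \<le> v" "v < 1" "i < b"
  shows "digit_density b x (Suc n) ((v + real i) / real b)
    = of_nat b * (x [] i * digit_density b (subtree [i] x) n v)"
proof -
  let ?u = "(v + real i) / real b"
  have "(\<Prod>k=1..Suc n. x (digit_prefix b ?u (k - 1)) (digit b ?u k))
      = (\<Prod>k=0..n. x (digit_prefix b ?u k) (digit b ?u (Suc k)))"
    using prod.shift_bounds_cl_Suc_ivl[of "\<lambda>k. x (digit_prefix b ?u (k - 1)) (digit b ?u k)" 0 n]
    by simp
  also have "\<dots> = x [] i * (\<Prod>k=1..n. x (digit_prefix b ?u k) (digit b ?u (Suc k)))"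
    by (subst prod.atLeast_Suc_atMost) (simp_all add: digit_prefix_def digit_Suc_cell[OF assms])
  also have "(\<Prod>k=1..n. x (digit_prefix b ?u k) (digit b ?u (Suc k)))
      = (\<Prod>k=1..n. subtree [i] x (digit_prefix b v (k - 1)) (digit b v k))"
  proof (rule prod.cong, simp)
    fix k assume "k \<in> {1..n}"
    then obtain m where "k = Suc m" by (cases k) auto
    then show "x (digit_prefix b ?u k) (digit b ?u (Suc k))
        = subtree [i] x (digit_prefix b v (k - 1)) (digit b v k)"
      by (simp add: digit_prefix_cell[OF assms] digit_Suc_cell[OF assms] subtree_apply)
  qed
  finally show ?thesis unfolding digit_density_def by (simp add: algebra_simps)
qed

text \<open>Half-open intervals make the decomposition into cells exact at every point, so that no
  exceptional null sets, and hence no measurability of the density, have to be treated.\<close>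

lemma has_bochner_integral_digit_density:
  fixes x :: "nat list \<Rightarrow> nat \<Rightarrow> 'v::{real_normed_field, banach, second_countable_topology}"
  assumes b: "b \<ge> 1" and t: "t \<in> {0..1}"
  shows "has_bochner_integral lborel
    (\<lambda>u. indicator {0..<t} u *\<^sub>R digit_density b x n u) (cell_cascade b n x t)"
  using t
proof (induction n arbitrary: x t)
  case 0
  have "has_bochner_integral lborel (\<lambda>u. indicator {0..<t} u *\<^sub>R (1::'v))
      (measure lborel {0..<t} *\<^sub>R 1)"
    using 0 by (intro has_bochner_integral_indicator) auto
  then show ?case using 0 by (simp add: digit_density_def scaleR_conv_of_real)
next
  case (Suc n)
  let ?g = "\<lambda>i v. indicator {0..<cell_coord b i t} v *\<^sub>R digit_density b (subtree [i] x) n v"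
  have bpos: "real b > 0" using b by simp
  have piece: "has_bochner_integral lborel (\<lambda>u. of_nat b * (x [] i * ?g i (real b * u - real i)))
      (x [] i * cell_cascade b n (subtree [i] x) (cell_coord b i t))" if "i < b" for i
  proof -
    have "has_bochner_integral lborel (?g i) (cell_cascade b n (subtree [i] x) (cell_coord b i t))"
      by (rule Suc.IH[OF cell_coord_in])
    then have "has_bochner_integral lborel (\<lambda>u. ?g i (- real i + real b * u))
        (cell_cascade b n (subtree [i] x) (cell_coord b i t) /\<^sub>R \<bar>real b\<bar>)"
      by (subst (asm) lborel_has_bochner_integral_real_affine_iff[where c = "real b" and t = "- real i"])
        (use bpos in auto)
    then have "has_bochner_integral lborel (\<lambda>u. of_nat b * (x [] i * ?g i (- real i + real b * u)))
        (of_nat b * (x [] i * (cell_cascade b n (subtree [i] x) (cell_coord b i t) /\<^sub>R \<bar>real b\<bar>)))"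
      by (intro has_bochner_integral_mult_right)
    moreover have "of_nat b * (x [] i * (cell_cascade b n (subtree [i] x) (cell_coord b i t) /\<^sub>R \<bar>real b\<bar>))
        = x [] i * cell_cascade b n (subtree [i] x) (cell_coord b i t)"
      using bpos by (simp add: scaleR_conv_of_real field_simps)
    moreover have "(\<lambda>u. - real i + real b * u) = (\<lambda>u. real b * u - real i)" by auto
    ultimately show ?thesis by (simp add: fun_eq_iff)
  qed
  have "has_bochner_integral lborel (\<lambda>u. \<Sum>i<b. of_nat b * (x [] i * ?g i (real b * u - real i)))
      (cell_cascade b (Suc n) x t)"
    unfolding cell_cascade.simps by (rule has_bochner_integral_sum) (use piece in auto)
  moreover have "(\<Sum>i<b. of_nat b * (x [] i * ?g i (real b * u - real i)))
      = indicator {0..<t} u *\<^sub>R digit_density b x (Suc n) u" for u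
  proof (cases "u \<in> {0..<t}")
    case False
    have "real b * u - real i \<notin> {0..<cell_coord b i t}" if "i < b" for i
    proof
      assume h: "real b * u - real i \<in> {0..<cell_coord b i t}"
      then have "real b * u - real i < real b * t - real i"
        by (auto simp: cell_coord_def max_def min_def split: if_splits)
      then have "u < t" using bpos by simp
      moreover have "0 \<le> real b * u" using h by (auto intro: order_trans[of 0 "real i"])
      then have "u \<ge> 0" using bpos by (simp add: zero_le_mult_iff)
      ultimately have "u < t" "u \<ge> 0" by simp_all
      with False show False by simp
    qed
    with False show ?thesis by (auto simp: indicator_def intro!: sum.neutral)
  next
    case True
    then have u: "0 \<le> u" "u < t" "u < 1" using Suc.prems by auto
    define j where "j = nat \<lfloor>real b * u\<rfloor>"
    have jb: "real j \<le> real b * u" "real b * u < real j + 1"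
      using u bpos by (auto simp: j_def)
    have "real b * u < real b" using u bpos by simp
    then have "j < b" using jb by linarith
    define v where "v = real b * u - real j"
    have v: "0 \<le> v" "v < 1" and uv: "u = (v + real j) / real b"
      using jb bpos by (auto simp: v_def)
    have vj: "v \<in> {0..<cell_coord b j t}"
    proof -
      have "real b * u < real b * t" using u bpos by simp
      then show ?thesis using v by (auto simp: cell_coord_def v_def)
    qed
    have "real b * u - real i \<notin> {0..<cell_coord b i t}" if "i \<noteq> j" for i
    proof
      assume "real b * u - real i \<in> {0..<cell_coord b i t}"
      then have "real i \<le> real b * u" "real b * u < real i + 1"
        by (auto intro: less_le_trans[OF _ cell_coord_le1[of b i t]])
          (use cell_coord_le1[of b i t] in linarith)
      with jb have "i = j" by linarith
      with that show False by simp
    qed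
    then have "(\<Sum>i<b. of_nat b * (x [] i * ?g i (real b * u - real i)))
        = (\<Sum>i<b. if i = j then of_nat b * (x [] i * ?g i (real b * u - real i)) else 0)"
      by (intro sum.cong) auto
    also have "\<dots> = of_nat b * (x [] j * digit_density b (subtree [j] x) n v)"
      using \<open>j < b\<close> vj by (simp add: v_def)
    also have "\<dots> = digit_density b x (Suc n) u"
      unfolding uv by (rule digit_density_cell[OF v \<open>j < b\<close>, symmetric])
    finally show ?thesis using True by simp
  qed
  ultimately show ?case by simp
qed

lemma digit_prefix_in_words: "b \<ge> 1 \<Longrightarrow> digit_prefix b u k \<in> words b"
  by (auto simp: digit_prefix_def words_def digit_def nat_less_iff)

lemma cascade_eq_cell_cascade:
  assumes b: "b \<ge> 1" and t: "t \<in> {0..1}"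
  shows "cascade b W n \<omega> t = cell_cascade b n (\<lambda>w\<in>words b. W w \<omega>) t"
proof -
  let ?x = "\<lambda>w\<in>words b. W w \<omega>"
  have eq: "of_nat b ^ n * (\<Prod>k=1..n. W (digit_prefix b u (k - 1)) \<omega> (digit b u k))
      = digit_density b ?x n u" for u
    unfolding digit_density_def by (simp add: digit_prefix_in_words[OF b])
  have "has_bochner_integral lborel
      (\<lambda>u. indicator {0..<t} u *\<^sub>R digit_density b ?x n u
         + indicator {t} u *\<^sub>R digit_density b ?x n t)
      (cell_cascade b n ?x t + measure lborel {t} *\<^sub>R digit_density b ?x n t)"
    by (intro has_bochner_integral_add has_bochner_integral_digit_density[OF b t]
        has_bochner_integral_indicator) auto
  moreover have "indicator {0..<t} u *\<^sub>R digit_density b ?x n u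
         + indicator {t} u *\<^sub>R digit_density b ?x n t
      = indicator {0..t} u *\<^sub>R digit_density b ?x n u" for u
    using t by (auto simp: indicator_def)
  ultimately have "has_bochner_integral lborel
      (\<lambda>u. indicator {0..t} u *\<^sub>R digit_density b ?x n u) (cell_cascade b n ?x t)"
    by simp
  then show ?thesis
    unfolding cascade_def set_lebesgue_integral_def eq
    by (rule has_bochner_integral_integral_eq)
qed

section \<open>Uniform convergence of contracting cascades\<close>

text \<open>Every point lies in some cell, and all other cells lie entirely to its left or to its right. In
  all recursions over the cells, therefore, only one child involves an unknown coordinate.\<close>

lemma obtain_cell:
  assumes "1 \<le> b" "t \<in> {0..1}"
  obtains j where "j < b" "t = (real j + cell_coord b j t) / real b"
    "\<And>i. i < b \<Longrightarrow> i \<noteq> j \<Longrightarrow> cell_coord b i t = 0 \<or> cell_coord b i t = 1"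
proof -
  have bpos: "real b > 0" using assms by simp
  define j where "j = min (b - 1) (nat \<lfloor>real b * t\<rfloor>)"
  have j: "j < b" using assms by (auto simp: j_def)
  have fl: "real (nat \<lfloor>real b * t\<rfloor>) \<le> real b * t" "real b * t < real (nat \<lfloor>real b * t\<rfloor>) + 1"
    using assms bpos by auto
  have le: "real j \<le> real b * t" using fl(1) by (simp add: j_def)
  have le2: "real b * t \<le> real j + 1"
  proof (cases "nat \<lfloor>real b * t\<rfloor> \<le> b - 1")
    case True then show ?thesis using fl by (simp add: j_def)
  next
    case False
    then have "real j + 1 = real b" using assms by (simp add: j_def of_nat_diff)
    then show ?thesis using assms(2) bpos by simp
  qed
  have c: "cell_coord b j t = real b * t - real j" using le le2 by (simp add: cell_coord_def)
  show thesis
  proof (rule that[OF j])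
    show "t = (real j + cell_coord b j t) / real b" using bpos by (simp add: c)
    fix i assume "i < b" "i \<noteq> j"
    then consider "real i + 1 \<le> real j" | "real j + 1 \<le> real i" by linarith
    then show "cell_coord b i t = 0 \<or> cell_coord b i t = 1"
      by cases (use le le2 in \<open>auto simp: cell_coord_def\<close>)
  qed
qed

lemma norm_sum_one_exception:
  fixes f :: "nat \<Rightarrow> 'v::real_normed_vector"
  assumes "j < b" "\<And>i. i < b \<Longrightarrow> i \<noteq> j \<Longrightarrow> norm (f i) \<le> A" "norm (f j) \<le> B" "0 \<le> A"
  shows "norm (\<Sum>i<b. f i) \<le> real b * A + B"
proof -
  have "norm (\<Sum>i<b. f i) \<le> (\<Sum>i<b. norm (f i))" by (rule norm_sum)
  also have "\<dots> = norm (f j) + (\<Sum>i\<in>{..<b} - {j}. norm (f i))"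
    using assms by (subst sum.remove[of _ j]) auto
  also have "(\<Sum>i\<in>{..<b} - {j}. norm (f i)) \<le> real (card ({..<b} - {j})) * A"
    by (rule sum_bounded_above) (use assms in auto)
  also have "\<dots> \<le> real b * A" using assms by (intro mult_right_mono) auto
  finally show ?thesis using assms by simp
qed

lemma continuous_on_cell_cascade: "continuous_on {0..1} (cell_cascade b n x)"
proof (induction n arbitrary: x)
  case 0
  then show ?case by (simp add: continuous_intros)
next
  case (Suc n)
  have "continuous_on {0..1} (\<lambda>t. x [] i * cell_cascade b n (subtree [i] x) (cell_coord b i t))" for i
    by (intro continuous_on_mult continuous_on_const
        continuous_on_compose2[OF Suc.IH, where f = "cell_coord b i"])
      (auto simp: cell_coord_def intro!: continuous_intros)
  then show ?case by (simp add: continuous_on_sum)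
qed

lemma cell_cascade_mono:
  fixes y :: "nat list \<Rightarrow> nat \<Rightarrow> real"
  assumes "\<And>w i. w \<in> words b \<Longrightarrow> i < b \<Longrightarrow> 0 \<le> y w i" "s \<le> t"
  shows "cell_cascade b n y s \<le> cell_cascade b n y t"
  using assms
proof (induction n arbitrary: y s t)
  case (Suc n)
  show ?case unfolding cell_cascade.simps
  proof (rule sum_mono)
    fix i assume "i \<in> {..<b}"
    then show "y [] i * cell_cascade b n (subtree [i] y) (cell_coord b i s)
        \<le> y [] i * cell_cascade b n (subtree [i] y) (cell_coord b i t)"
      using Suc.prems by (intro mult_left_mono Suc.IH cell_coord_mono) (auto simp: subtree_apply)
  qed
qed auto

text \<open>The contributions of the \<open>n\<close>-th refinement of the subtree of \<open>w\<close> decay geometrically both in \<open>n\<close>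
  and in the length of \<open>w\<close>. The decay in the length makes the sum over the cells left of a point
  converge, which turns convergence of the total masses into uniform convergence of the functions.\<close>

locale contracting_family =
  fixes b :: nat
    and x :: "nat list \<Rightarrow> nat \<Rightarrow> 'v::{real_normed_field, banach, second_countable_topology}"
    and C r \<rho> :: real
  assumes b1: "1 \<le> b"
    and nonzero: "w \<in> words b \<Longrightarrow> i < b \<Longrightarrow> x w i \<noteq> 0"
    and r: "0 < r" "r < 1"
    and \<rho>: "0 < \<rho>" "\<rho> < 1"
    and weight_le: "w \<in> words b \<Longrightarrow> norm (path_weight x w) \<le> C * r ^ length w"
    and step_le: "w \<in> words b \<Longrightarrow>
      norm (path_weight x w * mass_step b n (subtree w x)) \<le> C * r ^ length w * \<rho> ^ n"
begin

lemma C_nonneg: "0 \<le> C"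
  using weight_le[of "[]"] by simp

lemma weight_nonzero: "w \<in> words b \<Longrightarrow> path_weight x w \<noteq> 0"
proof (induction w rule: rev_induct)
  case (snoc i w)
  then show ?case by (simp add: path_weight_snoc nonzero)
qed simp

definition rate :: real where "rate = (1 + max r \<rho>) / 2"

lemma rate: "r < rate" "\<rho> < rate" "0 < rate" "rate < 1"
  using r \<rho> by (auto simp: rate_def max_def)

text \<open>By induction over \<open>n\<close>: the children other than the one containing \<open>t\<close> contribute their whole
  increment or nothing, and the child containing \<open>t\<close> contributes one more factor \<open>r\<close>, which is smaller
  than \<^term>\<open>rate\<close>.\<close>

lemma cell_cascade_step_le:
  assumes "w \<in> words b" "t \<in> {0..1}"
  shows "norm (path_weight x w * (cell_cascade b (Suc n) (subtree w x) t - cell_cascade b n (subtree w x) t))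
    \<le> (real b + 1) * C / (rate - r) * r ^ length w * rate ^ n"
  using assms
proof (induction n arbitrary: w t)
  case 0
  have "norm (\<Sum>i<b. path_weight x (w @ [i]) * of_real (cell_coord b i t))
      \<le> (\<Sum>i<b. C * r ^ length w)"
  proof (rule sum_norm_le)
    fix i assume "i \<in> {..<b}"
    then have "norm (path_weight x (w @ [i])) \<le> C * r ^ length (w @ [i])"
      using 0 by (intro weight_le) auto
    also have "\<dots> \<le> C * r ^ length w"
      using r C_nonneg by (auto intro!: mult_left_mono simp: mult_left_le_one_le)
    finally show "norm (path_weight x (w @ [i]) * of_real (cell_coord b i t)) \<le> C * r ^ length w"
      by (simp add: norm_mult mult_le_one[THEN order_trans] mult_right_le_one_le[THEN order_trans])
  qed
  moreover have "norm (path_weight x w * of_real t) \<le> C * r ^ length w"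
    using weight_le[OF 0(1)] 0(2)
    by (simp add: norm_mult) (meson mult_right_le_one_le norm_ge_zero order_trans)
  moreover have "path_weight x w * (cell_cascade b (Suc 0) (subtree w x) t - cell_cascade b 0 (subtree w x) t)
      = (\<Sum>i<b. path_weight x (w @ [i]) * of_real (cell_coord b i t)) - path_weight x w * of_real t"
    by (simp add: right_diff_distrib sum_distrib_left path_weight_snoc mult.assoc)
  ultimately have "norm (path_weight x w * (cell_cascade b (Suc 0) (subtree w x) t - cell_cascade b 0 (subtree w x) t))
      \<le> (real b + 1) * C * r ^ length w"
    using norm_triangle_ineq4[of "\<Sum>i<b. path_weight x (w @ [i]) * of_real (cell_coord b i t)"
        "path_weight x w * of_real t"] by (simp add: algebra_simps)
  also have "(real b + 1) * C * r ^ length w \<le> (real b + 1) * C * r ^ length w / (rate - r)"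
    using rate r C_nonneg by (simp add: le_divide_eq mult_left_le)
  finally show ?case by simp
next
  case (Suc n)
  let ?K = "(real b + 1) * C / (rate - r)"
  let ?E = "\<lambda>w n t. path_weight x w * (cell_cascade b (Suc n) (subtree w x) t - cell_cascade b n (subtree w x) t)"
  obtain j where j: "j < b"
    "\<And>i. i < b \<Longrightarrow> i \<noteq> j \<Longrightarrow> cell_coord b i t = 0 \<or> cell_coord b i t = 1"
    using obtain_cell[OF b1 Suc.prems(2)] by metis
  have "?E w (Suc n) t = (\<Sum>i<b. ?E (w @ [i]) n (cell_coord b i t))"
    by (simp add: right_diff_distrib sum_distrib_left path_weight_snoc mult.assoc
        flip: sum_subtractf)
  also have "norm \<dots> \<le> real b * (C * r ^ Suc (length w) * \<rho> ^ n) + ?K * r ^ Suc (length w) * rate ^ n"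
  proof (rule norm_sum_one_exception[OF j(1)])
    fix i assume i: "i < b" "i \<noteq> j"
    have "norm (?E (w @ [i]) n 1) \<le> C * r ^ Suc (length w) * \<rho> ^ n"
      using step_le[of "w @ [i]" n] i Suc.prems by (simp add: mass_step_def cell_cascade_1)
    moreover have "0 \<le> C * r ^ Suc (length w) * \<rho> ^ n" using C_nonneg r \<rho> by simp
    ultimately show "norm (?E (w @ [i]) n (cell_coord b i t)) \<le> C * r ^ Suc (length w) * \<rho> ^ n"
      using j(2)[OF i] by (metis cell_cascade_0 diff_self mult_zero_right norm_zero)
  next
    show "norm (?E (w @ [j]) n (cell_coord b j t)) \<le> ?K * r ^ Suc (length w) * rate ^ n"
      using Suc.IH[of "w @ [j]" "cell_coord b j t"] Suc.prems j(1) by simp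
  qed (use C_nonneg r \<rho> in simp)
  also have "\<dots> \<le> real b * (C * r ^ Suc (length w) * rate ^ n) + ?K * r ^ Suc (length w) * rate ^ n"
    using C_nonneg r \<rho> rate by (intro add_mono mult_left_mono power_mono) auto
  also have "\<dots> = (real b * C * r + ?K * r) * (r ^ length w * rate ^ n)"
    by (simp add: algebra_simps)
  also have "\<dots> \<le> (?K * rate) * (r ^ length w * rate ^ n)"
  proof (rule mult_right_mono)
    have "?K * rate - ?K * r = ?K * (rate - r)" by (rule right_diff_distrib[symmetric])
    also have "\<dots> = (real b + 1) * C" using rate by simp
    finally have "?K * rate - ?K * r = (real b + 1) * C" .
    moreover have "real b * C * r \<le> (real b + 1) * C * 1"
      using r C_nonneg by (intro mult_mono) auto
    ultimately show "real b * C * r + ?K * r \<le> ?K * rate" by simp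
  qed (use r rate in simp)
  finally show ?case by (simp add: mult_ac)
qed

lemma uniform_limit_cell_cascade:
  assumes w: "w \<in> words b"
  shows "uniform_limit {0..1} (\<lambda>n. cell_cascade b n (subtree w x)) (cell_cascade_lim b (subtree w x)) sequentially"
proof -
  let ?f = "\<lambda>n t. cell_cascade b (Suc n) (subtree w x) t - cell_cascade b n (subtree w x) t"
  let ?M = "(real b + 1) * C / (rate - r) * r ^ length w / norm (path_weight x w)"
  have "uniform_limit {0..1} (\<lambda>n t. \<Sum>k<n. ?f k t) (\<lambda>t. \<Sum>k. ?f k t) sequentially"
  proof (rule Weierstrass_m_test)
    fix n and t :: real assume "t \<in> {0..1}"
    then have "norm (?f n t) * norm (path_weight x w)
        \<le> (real b + 1) * C / (rate - r) * r ^ length w * rate ^ n"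
      using cell_cascade_step_le[OF w, of t n] unfolding norm_mult by (simp only: mult.commute)
    then have "norm (?f n t)
        \<le> (real b + 1) * C / (rate - r) * r ^ length w * rate ^ n / norm (path_weight x w)"
      using weight_nonzero[OF w] by (subst pos_le_divide_eq) auto
    then show "norm (?f n t) \<le> ?M * rate ^ n" by simp
  next
    show "summable (\<lambda>n. ?M * rate ^ n)"
      using rate by (intro summable_mult summable_geometric) auto
  qed
  then have *: "uniform_limit {0..1} (\<lambda>n t. of_real t + (\<Sum>k<n. ?f k t))
      (\<lambda>t. of_real t + (\<Sum>k. ?f k t)) sequentially"
    by (intro uniform_limit_add uniform_limit_const)
  have tele: "of_real t + (\<Sum>k<n. ?f k t) = cell_cascade b n (subtree w x) t" for n t
    by (subst sum_lessThan_telescope) simp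
  have u: "uniform_limit {0..1} (\<lambda>n. cell_cascade b n (subtree w x)) (\<lambda>t. of_real t + (\<Sum>k. ?f k t))
      sequentially"
    using * unfolding tele .
  have "cell_cascade_lim b (subtree w x) t = of_real t + (\<Sum>k. ?f k t)" if "t \<in> {0..1}" for t
    unfolding cell_cascade_lim_def by (rule limI) (rule tendsto_uniform_limitI[OF u that])
  then show ?thesis by (rule uniform_limit_cong'[THEN iffD2, OF refl _ u])
qed

lemma cell_cascade_tendsto:
  "w \<in> words b \<Longrightarrow> t \<in> {0..1} \<Longrightarrow>
    (\<lambda>n. cell_cascade b n (subtree w x) t) \<longlonglongrightarrow> cell_cascade_lim b (subtree w x) t"
  by (rule tendsto_uniform_limitI[OF uniform_limit_cell_cascade])

lemma continuous_on_cell_cascade_lim: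
  "w \<in> words b \<Longrightarrow> continuous_on {0..1} (cell_cascade_lim b (subtree w x))"
  by (rule uniform_limit_theorem[OF always_eventually[OF allI[OF continuous_on_cell_cascade]] uniform_limit_cell_cascade])
    auto

text \<open>The increments of the limit function over the cell of the word \<open>w\<close>, in the coordinate of
  this cell.\<close>

definition cell_path :: "nat list \<Rightarrow> real \<Rightarrow> 'v" where
  "cell_path w t = path_weight x w * cell_cascade_lim b (subtree w x) t"

lemma cell_path_0 [simp]: "cell_path w 0 = 0"
  by (simp add: cell_path_def cell_cascade_lim_def)

lemma cell_path_1: "cell_path w 1 = path_weight x w * total_lim b (subtree w x)"
  by (simp add: cell_path_def cell_cascade_lim_def total_lim_def cell_cascade_1)

lemma cell_path_split:
  assumes w: "w \<in> words b" and t: "t \<in> {0..1}"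
  shows "cell_path w t = (\<Sum>i<b. cell_path (w @ [i]) (cell_coord b i t))"
proof -
  have "(\<lambda>n. cell_cascade b (Suc n) (subtree w x) t)
      \<longlonglongrightarrow> (\<Sum>i<b. x w i * cell_cascade_lim b (subtree (w @ [i]) x) (cell_coord b i t))"
    unfolding cell_cascade.simps subtree_subtree subtree_at_root
    by (intro tendsto_sum tendsto_mult tendsto_const cell_cascade_tendsto) (use w cell_coord_in in auto)
  moreover have "(\<lambda>n. cell_cascade b (Suc n) (subtree w x) t) \<longlonglongrightarrow> cell_cascade_lim b (subtree w x) t"
    by (rule LIMSEQ_Suc[OF cell_cascade_tendsto[OF assms]])
  ultimately have "cell_cascade_lim b (subtree w x) t
      = (\<Sum>i<b. x w i * cell_cascade_lim b (subtree (w @ [i]) x) (cell_coord b i t))"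
    by (rule LIMSEQ_unique[rotated])
  then show ?thesis
    by (simp add: cell_path_def sum_distrib_left path_weight_snoc mult.assoc)
qed

text \<open>The increments of all approximations, and so of the limit, obey the bound of the weights up to a
  constant: sum the geometric bounds of the steps.\<close>

lemma cell_path_le:
  obtains K where "0 \<le> K"
    "\<And>w t. w \<in> words b \<Longrightarrow> t \<in> {0..1} \<Longrightarrow> norm (cell_path w t) \<le> K * r ^ length w"
proof -
  define A where "A = (real b + 1) * C / (rate - r)"
  have A: "0 \<le> A" using rate C_nonneg by (simp add: A_def)
  have "norm (cell_path w t) \<le> (C + A / (1 - rate)) * r ^ length w"
    if w: "w \<in> words b" and t: "t \<in> {0..1}" for w t
  proof (rule LIMSEQ_le_const2)
    show "(\<lambda>n. norm (path_weight x w * cell_cascade b n (subtree w x) t)) \<longlonglongrightarrow> norm (cell_path w t)"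
      unfolding cell_path_def by (intro tendsto_intros cell_cascade_tendsto w t)
    have "norm (path_weight x w * cell_cascade b n (subtree w x) t) \<le> (C + A / (1 - rate)) * r ^ length w"
      for n
    proof -
      let ?f = "\<lambda>n. cell_cascade b (Suc n) (subtree w x) t - cell_cascade b n (subtree w x) t"
      have "cell_cascade b n (subtree w x) t = of_real t + (\<Sum>k<n. ?f k)"
        by (subst sum_lessThan_telescope) simp
      then have "path_weight x w * cell_cascade b n (subtree w x) t
          = path_weight x w * of_real t + (\<Sum>k<n. path_weight x w * ?f k)"
        unfolding sum_distrib_left[symmetric] distrib_left[symmetric] by (rule arg_cong)
      then have "norm (path_weight x w * cell_cascade b n (subtree w x) t)
          \<le> norm (path_weight x w * of_real t) + norm (\<Sum>k<n. path_weight x w * ?f k)"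
        by (simp only: norm_triangle_ineq)
      also have "norm (path_weight x w * of_real t) \<le> C * r ^ length w"
        using weight_le[OF w] t
        by (simp add: norm_mult) (meson mult_right_le_one_le norm_ge_zero order_trans)
      also have "norm (\<Sum>k<n. path_weight x w * ?f k) \<le> (\<Sum>k<n. A * r ^ length w * rate ^ k)"
        using cell_cascade_step_le[OF w t] by (intro sum_norm_le) (auto simp: A_def)
      also have "\<dots> = A * r ^ length w * (\<Sum>k<n. rate ^ k)" by (simp add: sum_distrib_left)
      also have "\<dots> \<le> A * r ^ length w * (1 / (1 - rate))"
        using A r rate
        by (intro mult_left_mono)
          (auto simp: sum_gp_strict divide_simps)
      finally show ?thesis by (simp add: algebra_simps)
    qed
    then show "\<exists>N. \<forall>n\<ge>N. norm (path_weight x w * cell_cascade b n (subtree w x) t)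
        \<le> (C + A / (1 - rate)) * r ^ length w" by blast
  qed
  moreover have "0 \<le> C + A / (1 - rate)" using A C_nonneg rate by simp
  ultimately show thesis using that by blast
qed

end

section \<open>Subexponential control of all subtrees\<close>

text \<open>The almost sure properties of a cascade from which its pointwise regularity follows: weights decay
  exponentially, whereas, up to any exponential factor \<open>q ^ length w\<close> with \<open>q > 1\<close>, every subtree
  converges at a common rate, oscillates by at least a constant, and has weight vectors that are bounded
  away from \<open>0\<close>.\<close>

definition regular_family ::
  "nat \<Rightarrow> (nat list \<Rightarrow> nat \<Rightarrow> 'v::{real_normed_field, banach, second_countable_topology}) \<Rightarrow> bool" where
  "regular_family b x \<longleftrightarrow>
    (\<exists>C r. 0 < r \<and> r < 1 \<and> (\<forall>w\<in>words b. norm (path_weight x w) \<le> C * r ^ length w)) \<and>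
    (\<forall>q>1. \<exists>C \<rho>. 0 < \<rho> \<and> \<rho> < 1 \<and>
      (\<forall>w\<in>words b. \<forall>n. norm (mass_step b n (subtree w x)) \<le> C * q ^ length w * \<rho> ^ n)) \<and>
    (\<forall>q>1. \<exists>c>0. \<forall>w\<in>words b. \<exists>v\<in>words b.
      c / q ^ length w \<le> norm (path_weight (subtree w x) v * total_lim b (subtree (w @ v) x))) \<and>
    (\<forall>q>1. \<exists>c>0. \<forall>w\<in>words b. \<forall>i<b. c / q ^ length w \<le> norm (x w i))"

lemma regular_family_weights:
  assumes "regular_family b x"
  obtains C r where "0 < r" "r < 1" "\<And>w. w \<in> words b \<Longrightarrow> norm (path_weight x w) \<le> C * r ^ length w"
  using assms unfolding regular_family_def by (elim conjE) blast

lemma regular_family_steps: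
  assumes "regular_family b x" "q > 1"
  obtains C \<rho> where "0 < \<rho>" "\<rho> < 1"
    "\<And>w n. w \<in> words b \<Longrightarrow> norm (mass_step b n (subtree w x)) \<le> C * q ^ length w * \<rho> ^ n"
proof -
  have "\<forall>q>1. \<exists>C \<rho>. 0 < \<rho> \<and> \<rho> < 1 \<and>
      (\<forall>w\<in>words b. \<forall>n. norm (mass_step b n (subtree w x)) \<le> C * q ^ length w * \<rho> ^ n)"
    using assms(1) unfolding regular_family_def by (elim conjE)
  then show thesis using assms(2) that by blast
qed

lemma regular_family_oscillation:
  assumes "regular_family b x" "q > 1"
  obtains c where "0 < c" "\<And>w. w \<in> words b \<Longrightarrow> \<exists>v\<in>words b.
    c / q ^ length w \<le> norm (path_weight (subtree w x) v * total_lim b (subtree (w @ v) x))"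
proof -
  have "\<forall>q>1. \<exists>c>0. \<forall>w\<in>words b. \<exists>v\<in>words b.
      c / q ^ length w \<le> norm (path_weight (subtree w x) v * total_lim b (subtree (w @ v) x))"
    using assms(1) unfolding regular_family_def by (elim conjE)
  then show thesis using assms(2) that by blast
qed

lemma regular_family_entries:
  assumes "regular_family b x" "q > 1"
  obtains c where "0 < c" "\<And>w i. w \<in> words b \<Longrightarrow> i < b \<Longrightarrow> c / q ^ length w \<le> norm (x w i)"
proof -
  have "\<forall>q>1. \<exists>c>0. \<forall>w\<in>words b. \<forall>i<b. c / q ^ length w \<le> norm (x w i)"
    using assms(1) unfolding regular_family_def by (elim conjE)
  then show thesis using assms(2) that by blast
qed

lemma regular_family_contracting:
  assumes x: "regular_family b x" and b: "1 \<le> b"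
  obtains C r \<rho> where "contracting_family b x C r \<rho>"
proof -
  obtain C1 r1 where r1: "0 < r1" "r1 < 1"
    and C1: "\<And>w. w \<in> words b \<Longrightarrow> norm (path_weight x w) \<le> C1 * r1 ^ length w"
    using regular_family_weights[OF x] by metis
  have C1_nonneg: "0 \<le> C1" using C1[of "[]"] by simp
  \<comment> \<open>the growth rate allowed for the increments has to be beaten by the decay of the weights\<close>
  define q where "q = (1 + 1 / r1) / 2"
  have q: "1 < q" "q * r1 < 1" "0 < q" using r1 by (auto simp: q_def field_simps)
  obtain C2 \<rho> where \<rho>: "0 < \<rho>" "\<rho> < 1"
    and C2: "\<And>w n. w \<in> words b \<Longrightarrow> norm (mass_step b n (subtree w x)) \<le> C2 * q ^ length w * \<rho> ^ n"
    using regular_family_steps[OF x q(1)] by metis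
  obtain c where c: "c > 0" "\<And>w i. w \<in> words b \<Longrightarrow> i < b \<Longrightarrow> c / 2 ^ length w \<le> norm (x w i)"
    using regular_family_entries[OF x, of 2] by auto
  have "contracting_family b x (C1 * max 1 C2) (q * r1) \<rho>"
  proof
    fix w assume w: "w \<in> words b"
    show "x w i \<noteq> 0" if "i < b" for i
    proof -
      have "0 < c / 2 ^ length w" using c by simp
      then show ?thesis using c(2)[OF w that] by auto
    qed
    have "norm (path_weight x w) \<le> C1 * r1 ^ length w" by (rule C1[OF w])
    also have "\<dots> \<le> (C1 * max 1 C2) * (q * r1) ^ length w"
      using C1_nonneg r1 q by (intro mult_mono power_mono mult_left_le)
        (auto intro: mult_right_le_one_le simp: mult_le_cancel_left1 mult_le_cancel_right1)
    finally show "norm (path_weight x w) \<le> (C1 * max 1 C2) * (q * r1) ^ length w" .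
    fix n
    have "norm (path_weight x w * mass_step b n (subtree w x))
        \<le> (C1 * r1 ^ length w) * (C2 * q ^ length w * \<rho> ^ n)"
      unfolding norm_mult using C1_nonneg r1 by (intro mult_mono C1 C2 w) auto
    also have "\<dots> = C1 * (q * r1) ^ length w * \<rho> ^ n * C2" by (simp add: power_mult_distrib)
    also have "\<dots> \<le> C1 * (q * r1) ^ length w * \<rho> ^ n * max 1 C2"
      using C1_nonneg r1 q \<rho> by (intro mult_left_mono) auto
    finally show "norm (path_weight x w * mass_step b n (subtree w x))
        \<le> C1 * max 1 C2 * (q * r1) ^ length w * \<rho> ^ n" by (simp add: mult_ac)
  qed (use b r1 q \<rho> in auto)
  then show thesis by (rule that)
qed

text \<open>Total masses of subtrees are sums of their increments.\<close>

lemma regular_family_total_le: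
  assumes x: "regular_family b x" and b: "1 \<le> b" and q: "q > 1"
  obtains C where "0 < C" "\<And>w. w \<in> words b \<Longrightarrow> norm (total_lim b (subtree w x)) \<le> C * q ^ length w"
proof -
  obtain C0 r0 \<rho>0 where "contracting_family b x C0 r0 \<rho>0"
    using regular_family_contracting[OF x b] .
  then interpret contracting_family b x C0 r0 \<rho>0 .
  obtain C2 \<rho>1 where \<rho>1: "0 < \<rho>1" "\<rho>1 < 1"
    and C2: "\<And>w n. w \<in> words b \<Longrightarrow> norm (mass_step b n (subtree w x)) \<le> C2 * q ^ length w * \<rho>1 ^ n"
    using regular_family_steps[OF x q] by metis
  have C2_nonneg: "0 \<le> C2" using order_trans[OF norm_ge_zero C2[of "[]" 0]] by simp
  have "norm (total_lim b (subtree w x)) \<le> (1 + C2 / (1 - \<rho>1)) * q ^ length w"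
    if w: "w \<in> words b" for w
  proof (rule LIMSEQ_le_const2)
    show "(\<lambda>n. norm (total_mass b n (subtree w x))) \<longlonglongrightarrow> norm (total_lim b (subtree w x))"
      using cell_cascade_tendsto[OF w, of 1] unfolding cell_cascade_1 cell_cascade_lim_def total_lim_def
      by (intro tendsto_norm) simp
    have "norm (total_mass b n (subtree w x)) \<le> (1 + C2 / (1 - \<rho>1)) * q ^ length w" for n
    proof -
      have "total_mass b n (subtree w x) = 1 + (\<Sum>k<n. mass_step b k (subtree w x))"
        unfolding mass_step_def by (subst sum_lessThan_telescope) simp
      then have "norm (total_mass b n (subtree w x))
          \<le> norm (1::'a) + norm (\<Sum>k<n. mass_step b k (subtree w x))"
        by (simp only: norm_triangle_ineq)
      also have "norm (\<Sum>k<n. mass_step b k (subtree w x)) \<le> (\<Sum>k<n. C2 * q ^ length w * \<rho>1 ^ k)"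
        using C2[OF w] by (intro sum_norm_le) auto
      also have "\<dots> = C2 * q ^ length w * (\<Sum>k<n. \<rho>1 ^ k)" by (simp add: sum_distrib_left)
      also have "\<dots> \<le> C2 * q ^ length w * (1 / (1 - \<rho>1))"
        using C2_nonneg q \<rho>1 by (intro mult_left_mono) (auto simp: sum_gp_strict divide_simps)
      also have "norm (1::'a) + C2 * q ^ length w * (1 / (1 - \<rho>1))
          \<le> q ^ length w + C2 * q ^ length w * (1 / (1 - \<rho>1))"
        using q by simp
      finally show ?thesis by (simp add: algebra_simps)
    qed
    then show "\<exists>N. \<forall>n\<ge>N. norm (total_mass b n (subtree w x))
        \<le> (1 + C2 / (1 - \<rho>1)) * q ^ length w" by blast
  qed
  moreover have "0 < 1 + C2 / (1 - \<rho>1)" using C2_nonneg \<rho>1 by (simp add: add_pos_nonneg)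
  ultimately show thesis using that by blast
qed

fun cell_point :: "nat \<Rightarrow> nat list \<Rightarrow> real \<Rightarrow> real" where
  "cell_point b [] s = s"
| "cell_point b (i # w) s = (real i + cell_point b w s) / real b"

lemma cell_point_in:
  assumes "w \<in> words b" "s \<in> {0..1}"
  shows "cell_point b w s \<in> {0..1}"
  using assms(1)
proof (induction w)
  case (Cons i w)
  then have "real i + cell_point b w s \<le> real (Suc i)" "0 \<le> cell_point b w s" by auto
  moreover have "real (Suc i) \<le> real b" using Cons.prems by (simp only: of_nat_le_iff) auto
  ultimately show ?case by (auto simp: divide_le_eq)
qed (use assms in simp)

lemma cell_point_snoc: "cell_point b (w @ [i]) s = cell_point b w ((real i + s) / real b)"
  by (induction w) auto

lemma cell_point_append: "cell_point b (u @ w) s = cell_point b u (cell_point b w s)"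
  by (induction u) auto

lemma cell_point_affine: "cell_point b w s = cell_point b w 0 + s / real b ^ length w"
  by (induction w) (auto simp: add_divide_distrib)

lemma cell_point_surj:
  assumes "1 \<le> b" "u \<in> {0..1}"
  shows "\<exists>w s. w \<in> words b \<and> length w = n \<and> s \<in> {0..1} \<and> u = cell_point b w s"
  using assms(2)
proof (induction n arbitrary: u)
  case 0
  then show ?case by (intro exI[of _ "[]"] exI[of _ u]) auto
next
  case (Suc n)
  obtain j where j: "j < b" "u = (real j + cell_coord b j u) / real b"
    using obtain_cell[OF assms(1) Suc.prems] by metis
  obtain w s where "w \<in> words b" "length w = n" "s \<in> {0..1}" "cell_coord b j u = cell_point b w s"
    using Suc.IH[OF cell_coord_in] by blast
  then show ?case using j by (intro exI[of _ "j # w"] exI[of _ s]) auto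
qed

lemma cell_coord_of_point:
  assumes "1 \<le> b" "s \<in> {0..1}"
  shows "cell_coord b k ((real i + s) / real b) = (if k < i then 1 else if k = i then s else 0)"
proof -
  have "real b * ((real i + s) / real b) = real i + s" using assms by simp
  moreover consider "real k + 1 \<le> real i" "k < i" | "k = i" | "real i + 1 \<le> real k" "i < k"
    by linarith
  ultimately show ?thesis using assms(2) by cases (auto simp: cell_coord_def)
qed

text \<open>Increments of a function that splits over the cells are inherited by every cell.\<close>

lemma splitting_increment:
  fixes f :: "nat list \<Rightarrow> real \<Rightarrow> 'v::real_normed_vector"
  assumes b: "1 \<le> b"
    and split: "\<And>w t. w \<in> words b \<Longrightarrow> t \<in> {0..1} \<Longrightarrow> f w t = (\<Sum>i<b. f (w @ [i]) (cell_coord b i t))"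
    and "u \<in> words b" "w \<in> words b" "s \<in> {0..1}" "t \<in> {0..1}"
  shows "f u (cell_point b w t) - f u (cell_point b w s) = f (u @ w) t - f (u @ w) s"
  using assms(3,4)
proof (induction w arbitrary: u)
  case (Cons i w)
  have i: "i < b" and w: "w \<in> words b" using Cons.prems by auto
  note in_cell = cell_point_in[OF w \<open>t \<in> {0..1}\<close>] cell_point_in[OF w \<open>s \<in> {0..1}\<close>]
  have "f u (cell_point b (i # w) t) - f u (cell_point b (i # w) s)
      = (\<Sum>k<b. f (u @ [k]) (cell_coord b k (cell_point b (i # w) t))
          - f (u @ [k]) (cell_coord b k (cell_point b (i # w) s)))"
    unfolding sum_subtractf
    by (subst (1 2) split) (use Cons.prems assms cell_point_in[of "i # w" b] in auto)
  also have "\<dots> = (\<Sum>k<b. if k = i then f (u @ [i]) (cell_point b w t) - f (u @ [i]) (cell_point b w s) else 0)"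
    by (intro sum.cong) (simp_all add: cell_coord_of_point[OF b] in_cell del: atLeastAtMost_iff)
  also have "\<dots> = f (u @ [i]) (cell_point b w t) - f (u @ [i]) (cell_point b w s)"
    using i by simp
  also have "\<dots> = f (u @ i # w) t - f (u @ i # w) s"
    using Cons.IH[of "u @ [i]"] Cons.prems by simp
  finally show ?case .
qed simp

lemma path_weight_norm_powr:
  fixes x :: "nat list \<Rightarrow> nat \<Rightarrow> 'v::real_normed_field" and y :: "nat list \<Rightarrow> nat \<Rightarrow> real"
  assumes "\<And>w i. w \<in> words b \<Longrightarrow> i < b \<Longrightarrow> y w i = norm (x w i) powr \<beta>" "w \<in> words b"
  shows "path_weight y w = norm (path_weight x w) powr \<beta>"
  using assms(2)
  by (induction w rule: rev_induct) (auto simp: path_weight_snoc assms(1) norm_mult powr_mult)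

section \<open>The exponent of the time-changed limit\<close>

lemma tendsto_ln_quotient:
  fixes f :: "real \<Rightarrow> real"
  assumes h: "0 < h"
    and bounds: "\<And>\<delta>. 0 < \<delta> \<Longrightarrow> \<delta> < h \<Longrightarrow> \<exists>c K r0. 0 < c \<and> 0 < r0 \<and>
      (\<forall>r. 0 < r \<longrightarrow> r < r0 \<longrightarrow> c * r powr (h + \<delta>) \<le> f r \<and> f r \<le> K * r powr (h - \<delta>))"
  shows "((\<lambda>r. ln (f r) / ln r) \<longlongrightarrow> h) (at_right 0)"
proof (rule tendstoI)
  fix e :: real assume e: "0 < e"
  define \<delta> where "\<delta> = min e h / 2"
  have \<delta>: "0 < \<delta>" "\<delta> < h" "\<delta> < e" using e h by (auto simp: \<delta>_def)
  obtain c K r0 where c: "0 < c" and r0: "0 < r0"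
    and f: "\<And>r. 0 < r \<Longrightarrow> r < r0 \<Longrightarrow> c * r powr (h + \<delta>) \<le> f r \<and> f r \<le> K * r powr (h - \<delta>)"
    using bounds[OF \<delta>(1,2)] by blast
  have K: "0 < K"
  proof -
    have "0 < c * (r0 / 2) powr (h + \<delta>)" using c r0 by simp
    also have "\<dots> \<le> K * (r0 / 2) powr (h - \<delta>)" using f[of "r0 / 2"] r0 by linarith
    finally show ?thesis by (simp add: zero_less_mult_iff)
  qed
  have small: "((\<lambda>r. a / ln r) \<longlongrightarrow> 0) (at_right (0::real))" for a :: real
    by (rule tendsto_divide_0[OF tendsto_const])
      (use filterlim_at_bot_imp_at_infinity[OF ln_at_0] in simp)
  have "\<forall>\<^sub>F r in at_right 0. \<bar>ln c / ln r\<bar> < e - \<delta>" "\<forall>\<^sub>F r in at_right 0. \<bar>ln K / ln r\<bar> < e - \<delta>"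
    using tendstoD[OF small[of "ln c"], of "e - \<delta>"] tendstoD[OF small[of "ln K"], of "e - \<delta>"] \<delta>
    by (auto simp: dist_real_def)
  moreover have "\<forall>\<^sub>F r in at_right 0. 0 < r \<and> r < min 1 r0"
    using eventually_at_right_less[of "0::real"] r0
    by (auto simp: eventually_at_right intro!: exI[of _ "min 1 r0"])
  ultimately show "\<forall>\<^sub>F r in at_right 0. dist (ln (f r) / ln r) h < e"
  proof eventually_elim
    case (elim r)
    then have r: "0 < r" "r < 1" "r < r0" and lr: "ln r < 0" by auto
    have fr: "c * r powr (h + \<delta>) \<le> f r" "f r \<le> K * r powr (h - \<delta>)" using f r by auto
    have "0 < c * r powr (h + \<delta>)" using c r by simp
    then have pos: "0 < f r" using fr by linarith
    have "ln (c * r powr (h + \<delta>)) \<le> ln (f r)" using fr c r pos by (intro ln_mono) auto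
    then have lo: "ln c + (h + \<delta>) * ln r \<le> ln (f r)" using c r by (simp add: ln_mult ln_powr)
    have "ln (f r) \<le> ln (K * r powr (h - \<delta>))" using fr K r pos by (intro ln_mono) auto
    then have up: "ln (f r) \<le> ln K + (h - \<delta>) * ln r" using K r by (simp add: ln_mult ln_powr)
    have "ln (f r) / ln r \<le> ln c / ln r + (h + \<delta>)"
      using divide_right_mono_neg[OF lo, of "ln r"] lr by (simp add: add_divide_distrib)
    moreover have "ln K / ln r + (h - \<delta>) \<le> ln (f r) / ln r"
      using divide_right_mono_neg[OF up, of "ln r"] lr by (simp add: add_divide_distrib)
    ultimately show ?case using elim(1,2) unfolding dist_real_def by linarith
  qed
qed

text \<open>The family \<open>y\<close> consists of the powers \<open>|x|\<^sup>\<beta>\<close>. The function \<open>F w\<close> describes the increments of the limit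
  of \<open>x\<close> inside the cell of \<open>w\<close>, and \<open>\<mu> w\<close> the masses that the limit of \<open>y\<close> gives to the initial parts
  of this cell.\<close>

locale coupled_families =
  X: contracting_family b x Cx rx \<rho>x + Y: contracting_family b y Cy ry \<rho>y
  for b and x :: "nat list \<Rightarrow> nat \<Rightarrow> 'v::{real_normed_field, banach, second_countable_topology}"
    and Cx rx \<rho>x and y :: "nat list \<Rightarrow> nat \<Rightarrow> real" and Cy ry \<rho>y +
  fixes \<beta> :: real
  assumes b2: "2 \<le> b" and \<beta>: "0 < \<beta>"
    and regular_x: "regular_family b x" and regular_y: "regular_family b y"
    and y_eq: "w \<in> words b \<Longrightarrow> i < b \<Longrightarrow> y w i = norm (x w i) powr \<beta>"
begin

abbreviation "F \<equiv> X.cell_path"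
abbreviation "\<mu> \<equiv> Y.cell_path"

lemmas b1 = X.b1

lemma y_pos: "w \<in> words b \<Longrightarrow> i < b \<Longrightarrow> 0 < y w i"
  using X.nonzero y_eq by simp

lemma weight_y: "w \<in> words b \<Longrightarrow> path_weight y w = norm (path_weight x w) powr \<beta>"
  by (rule path_weight_norm_powr[OF y_eq])

lemma weight_y_pos: "w \<in> words b \<Longrightarrow> 0 < path_weight y w"
  using X.weight_nonzero weight_y by simp

lemma \<mu>_mono:
  assumes w: "w \<in> words b" and st: "s \<in> {0..1}" "t \<in> {0..1}" "s \<le> t"
  shows "\<mu> w s \<le> \<mu> w t"
proof -
  have "cell_cascade_lim b (subtree w y) s \<le> cell_cascade_lim b (subtree w y) t"
  proof (rule LIMSEQ_le[OF Y.cell_cascade_tendsto[OF w st(1)] Y.cell_cascade_tendsto[OF w st(2)]])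
    show "\<exists>N. \<forall>n\<ge>N. cell_cascade b n (subtree w y) s \<le> cell_cascade b n (subtree w y) t"
      using y_pos w st by (intro exI[of _ 0] allI impI cell_cascade_mono) (auto simp: subtree_apply less_imp_le)
  qed
  then show ?thesis unfolding Y.cell_path_def using weight_y_pos[OF w] by simp
qed

lemma \<mu>_nonneg: "w \<in> words b \<Longrightarrow> t \<in> {0..1} \<Longrightarrow> 0 \<le> \<mu> w t"
  using \<mu>_mono[of w 0 t] by simp

lemma \<mu>_increment:
  "u \<in> words b \<Longrightarrow> w \<in> words b \<Longrightarrow> s \<in> {0..1} \<Longrightarrow> t \<in> {0..1} \<Longrightarrow>
    \<mu> u (cell_point b w t) - \<mu> u (cell_point b w s) = \<mu> (u @ w) t - \<mu> (u @ w) s"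
  by (rule splitting_increment[OF b1 Y.cell_path_split])

lemma F_increment:
  "u \<in> words b \<Longrightarrow> w \<in> words b \<Longrightarrow> s \<in> {0..1} \<Longrightarrow> t \<in> {0..1} \<Longrightarrow>
    F u (cell_point b w t) - F u (cell_point b w s) = F (u @ w) t - F (u @ w) s"
  by (rule splitting_increment[OF b1 X.cell_path_split])

lemma \<mu>_subcell_le:
  assumes "u \<in> words b" "v \<in> words b"
  shows "\<mu> (u @ v) 1 \<le> \<mu> u 1"
proof -
  have "\<mu> (u @ v) 1 = \<mu> u (cell_point b v 1) - \<mu> u (cell_point b v 0)"
    using \<mu>_increment[of u v 0 1] assms by simp
  also have "\<dots> \<le> \<mu> u 1"
    using \<mu>_mono[OF assms(1) cell_point_in[OF assms(2), of 1], of 1]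
      \<mu>_nonneg[OF assms(1) cell_point_in[OF assms(2), of 0]] cell_point_in[OF assms(2), of 1]
    by simp
  finally show ?thesis .
qed

text \<open>For a nonnegative family the mass of a cell dominates the masses of all its subcells, so a lower
  bound of the oscillation is a lower bound of the total mass.\<close>

lemma total_y_ge:
  assumes q: "q > 1"
  obtains c where "0 < c" "\<And>w. w \<in> words b \<Longrightarrow> c / q ^ length w \<le> total_lim b (subtree w y)"
proof -
  obtain c where c: "0 < c" "\<And>w. w \<in> words b \<Longrightarrow> \<exists>v\<in>words b.
      c / q ^ length w \<le> norm (path_weight (subtree w y) v * total_lim b (subtree (w @ v) y))"
    using regular_family_oscillation[OF regular_y q] by metis
  have "c / q ^ length w \<le> total_lim b (subtree w y)" if w: "w \<in> words b" for w
  proof -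
    obtain v where v: "v \<in> words b"
      "c / q ^ length w \<le> norm (path_weight (subtree w y) v * total_lim b (subtree (w @ v) y))"
      using c(2)[OF w] by blast
    have eq: "\<mu> (w @ v) 1
        = path_weight y w * (path_weight (subtree w y) v * total_lim b (subtree (w @ v) y))"
      by (simp add: Y.cell_path_1 path_weight_append)
    have "0 \<le> \<mu> (w @ v) 1" using w v by (intro \<mu>_nonneg) auto
    then have "0 \<le> path_weight (subtree w y) v * total_lim b (subtree (w @ v) y)"
      using weight_y_pos[OF w] by (simp add: eq zero_le_mult_iff)
    moreover have "path_weight y w * (path_weight (subtree w y) v * total_lim b (subtree (w @ v) y))
        \<le> path_weight y w * total_lim b (subtree w y)"
      using \<mu>_subcell_le[OF w v(1)] by (simp add: eq) (simp add: Y.cell_path_1)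
    then have "path_weight (subtree w y) v * total_lim b (subtree (w @ v) y)
        \<le> total_lim b (subtree w y)"
      using weight_y_pos[OF w] by simp
    ultimately show ?thesis using v(2) by simp
  qed
  then show thesis using that c(1) by blast
qed

lemma \<mu>_1_pos: "w \<in> words b \<Longrightarrow> 0 < \<mu> w 1"
proof -
  assume w: "w \<in> words b"
  obtain c where "0 < c" "c / 2 ^ length w \<le> total_lim b (subtree w y)"
    using total_y_ge[of 2] w by auto
  moreover then have "0 < c / 2 ^ length w" by simp
  ultimately show ?thesis using weight_y_pos[OF w] by (simp add: Y.cell_path_1 del: divide_pos_pos)
qed

lemma \<mu>_strict_mono:
  assumes st: "s \<in> {0..1}" "t \<in> {0..1}" "s < t"
  shows "\<mu> [] s < \<mu> [] t"
proof -
  obtain n where n: "1 / (t - s) < real b ^ n / 2"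
    using real_arch_pow[of "real b" "2 / (t - s)"] b2 by (auto simp: field_simps)
  define u where "u = (s + t) / 2"
  have "u \<in> {0..1}" using st by (auto simp: u_def)
  then obtain w p where w: "w \<in> words b" "length w = n" "p \<in> {0..1}" "u = cell_point b w p"
    using cell_point_surj[OF b1] by blast
  have len: "1 / real b ^ n < (t - s) / 2" using n st b2 by (simp add: field_simps)
  have "u = cell_point b w 0 + p / real b ^ n"
    using w cell_point_affine by metis
  moreover have "0 \<le> p / real b ^ n" "p / real b ^ n \<le> 1 / real b ^ n"
    using w b2 by (auto intro: divide_right_mono)
  moreover have one: "cell_point b w 1 = cell_point b w 0 + 1 / real b ^ n"
    using w cell_point_affine by metis
  moreover have "u - s = (t - s) / 2" "t - u = (t - s) / 2" by (auto simp: u_def field_simps)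
  ultimately have "s \<le> cell_point b w 0" "cell_point b w 1 \<le> t" using len by linarith+
  then have "\<mu> [] s \<le> \<mu> [] (cell_point b w 0)" "\<mu> [] (cell_point b w 1) \<le> \<mu> [] t"
    using st cell_point_in[OF w(1), of 0] cell_point_in[OF w(1), of 1]
    by (simp_all add: \<mu>_mono)
  moreover have "\<mu> [] (cell_point b w 1) - \<mu> [] (cell_point b w 0) = \<mu> w 1"
    using \<mu>_increment[of "[]" w 0 1] w by simp
  ultimately show ?thesis using \<mu>_1_pos[OF w(1)] by linarith
qed

end

context coupled_families
begin

lemma \<mu>_1_le:
  obtains K where "1 \<le> K" "\<And>w. w \<in> words b \<Longrightarrow> \<mu> w 1 \<le> K * ry ^ length w"
proof -
  obtain K where K: "0 \<le> K"
    "\<And>w t. w \<in> words b \<Longrightarrow> t \<in> {0..1} \<Longrightarrow> norm (\<mu> w t) \<le> K * ry ^ length w"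
    using Y.cell_path_le by blast
  have "\<mu> w 1 \<le> max 1 K * ry ^ length w" if "w \<in> words b" for w
  proof -
    have "\<mu> w 1 \<le> K * ry ^ length w" using K(2)[OF that, of 1] by simp
    also have "\<dots> \<le> max 1 K * ry ^ length w" using Y.r by (intro mult_right_mono) auto
    finally show ?thesis .
  qed
  then show thesis using that[of "max 1 K"] by simp
qed

text \<open>By \<open>P(w) = |Q(w)|\<^sup>\<beta>\<close> the increment over a cell is \<open>(\<mu>(w) / Z(w)) powr (1 / \<beta>) \<cdot> |Y(w)|\<close> in absolute value. The
  exponential decay of \<open>\<mu>(w)\<^sup>\<delta>\<close> absorbs \<open>Z(w)\<close> and \<open>Y(w)\<close> if their growth rate \<open>q\<close> is chosen close to
  one, and even leaves a factor \<open>\<kappa>\<close> to the power of the generation.\<close>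

lemma cell_estimate:
  assumes \<delta>: "0 < \<delta>" "\<delta> < 1 / \<beta>"
  obtains C \<kappa> where "0 \<le> C" "0 < \<kappa>" "\<kappa> < 1"
    "\<And>w. w \<in> words b \<Longrightarrow> norm (F w 1) \<le> C * \<kappa> ^ length w * \<mu> w 1 powr (1 / \<beta> - \<delta>)"
proof -
  obtain K where K: "1 \<le> K" "\<And>w. w \<in> words b \<Longrightarrow> \<mu> w 1 \<le> K * ry ^ length w"
    using \<mu>_1_le by blast
  define e where "e = 1 + 1 / \<beta>"
  have e: "0 < e" using \<beta> by (simp add: e_def add_pos_pos)
  \<comment> \<open>\<open>q ^ m\<close> will enter to the power \<open>e\<close>; this choice spends half of the decay \<open>ry powr (m * \<delta>)\<close>\<close>
  define q where "q = ry powr (- (\<delta> / (2 * e)))"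
  have "ry powr 0 < q"
    unfolding q_def using Y.r \<delta> e by (intro powr_less_mono') auto
  then have q: "1 < q" using Y.r by simp
  define \<kappa> where "\<kappa> = ry powr (\<delta> / 2)"
  have \<kappa>: "0 < \<kappa>" "\<kappa> < 1"
    using Y.r \<delta> powr_less_mono'[of ry 0 "\<delta> / 2"] by (auto simp: \<kappa>_def)
  obtain C where C: "0 < C" "\<And>w. w \<in> words b \<Longrightarrow> norm (total_lim b (subtree w x)) \<le> C * q ^ length w"
    using regular_family_total_le[OF regular_x b1 q] by blast
  obtain c where c: "0 < c" "\<And>w. w \<in> words b \<Longrightarrow> c / q ^ length w \<le> total_lim b (subtree w y)"
    using total_y_ge[OF q] by blast
  have "norm (F w 1) \<le> (C * (1 / c) powr (1 / \<beta>) * K powr \<delta>) * \<kappa> ^ length w * \<mu> w 1 powr (1 / \<beta> - \<delta>)"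
    if w: "w \<in> words b" for w
  proof -
    let ?m = "length w"
    let ?Z = "total_lim b (subtree w y)"
    have cq: "0 < c / q ^ ?m" using c q by simp
    then have Z: "0 < ?Z" using c(2)[OF w] by linarith
    have \<mu>pos: "0 < \<mu> w 1" by (rule \<mu>_1_pos[OF w])
    have "norm (path_weight x w) = path_weight y w powr (1 / \<beta>)"
      using weight_y[OF w] \<beta> by (simp add: powr_powr)
    also have "path_weight y w = \<mu> w 1 * (1 / ?Z)" using Z by (simp add: Y.cell_path_1)
    also have "(\<mu> w 1 * (1 / ?Z)) powr (1 / \<beta>) \<le> (\<mu> w 1 * (1 / (c / q ^ ?m))) powr (1 / \<beta>)"
      using Z c q mult_pos_pos[OF Z cq] \<mu>pos \<beta> c(2)[OF w] by (intro powr_mono2 mult_left_mono divide_left_mono) auto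
    also have "\<mu> w 1 * (1 / (c / q ^ ?m)) = \<mu> w 1 * ((1 / c) * q ^ ?m)" by simp
    also have "\<dots> powr (1 / \<beta>) = \<mu> w 1 powr (1 / \<beta>) * ((1 / c) powr (1 / \<beta>) * (q ^ ?m) powr (1 / \<beta>))"
      using \<mu>pos c q by (simp only: powr_mult)
    finally have Q: "norm (path_weight x w)
        \<le> \<mu> w 1 powr (1 / \<beta>) * ((1 / c) powr (1 / \<beta>) * (q ^ ?m) powr (1 / \<beta>))" .
    have "\<mu> w 1 powr (1 / \<beta>) = \<mu> w 1 powr \<delta> * \<mu> w 1 powr (1 / \<beta> - \<delta>)"
      using \<mu>pos by (simp flip: powr_add)
    also have "\<dots> \<le> (K powr \<delta> * (ry ^ ?m) powr \<delta>) * \<mu> w 1 powr (1 / \<beta> - \<delta>)"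
      using powr_mono2[of \<delta> "\<mu> w 1" "K * ry ^ ?m"] K(2)[OF w] \<mu>pos \<delta> K Y.r
      by (intro mult_right_mono) (auto simp: powr_mult)
    finally have M: "\<mu> w 1 powr (1 / \<beta>) \<le> (K powr \<delta> * (ry ^ ?m) powr \<delta>) * \<mu> w 1 powr (1 / \<beta> - \<delta>)" .
    have qm: "q ^ ?m = ry powr (- (\<delta> / (2 * e)) * ?m)"
      using q Y.r by (simp add: q_def powr_powr flip: powr_realpow)
    have "(ry ^ ?m) powr \<delta> * ((q ^ ?m) powr (1 / \<beta>) * q ^ ?m) = (ry ^ ?m) powr \<delta> * (q ^ ?m) powr e"
      using q by (simp add: e_def powr_add)
    also have "\<dots> = ry powr (?m * \<delta>) * ry powr (- (\<delta> / (2 * e)) * ?m * e)"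
      unfolding qm using Y.r by (simp add: powr_powr flip: powr_realpow)
    also have "\<dots> = ry powr (?m * \<delta> + - (\<delta> / (2 * e)) * ?m * e)" by (simp only: powr_add)
    also have "?m * \<delta> + - (\<delta> / (2 * e)) * ?m * e = \<delta> / 2 * ?m" using e by (simp add: field_simps)
    also have "ry powr (\<delta> / 2 * ?m) = \<kappa> ^ ?m"
      using Y.r by (simp add: \<kappa>_def powr_powr flip: powr_realpow)
    finally have P: "(ry ^ ?m) powr \<delta> * ((q ^ ?m) powr (1 / \<beta>) * q ^ ?m) = \<kappa> ^ ?m" .
    have "norm (F w 1) \<le> (\<mu> w 1 powr (1 / \<beta>) * ((1 / c) powr (1 / \<beta>) * (q ^ ?m) powr (1 / \<beta>)))
        * (C * q ^ ?m)"
      unfolding X.cell_path_1 norm_mult using Q C(2)[OF w] by (intro mult_mono) auto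
    also have "\<dots> \<le> (((K powr \<delta> * (ry ^ ?m) powr \<delta>) * \<mu> w 1 powr (1 / \<beta> - \<delta>))
        * ((1 / c) powr (1 / \<beta>) * (q ^ ?m) powr (1 / \<beta>))) * (C * q ^ ?m)"
      using M C q by (intro mult_right_mono) auto
    also have "\<dots> = (C * (1 / c) powr (1 / \<beta>) * K powr \<delta>)
        * ((ry ^ ?m) powr \<delta> * ((q ^ ?m) powr (1 / \<beta>) * q ^ ?m)) * \<mu> w 1 powr (1 / \<beta> - \<delta>)"
      by (simp only: mult_ac)
    finally show ?thesis unfolding P .
  qed
  then show thesis using that[of "C * (1 / c) powr (1 / \<beta>) * K powr \<delta>" \<kappa>] \<kappa> C(1) by simp
qed

lemma increment_split:
  assumes "w \<in> words b" "s \<in> {0..1}" "t \<in> {0..1}"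
  shows "F w t - F w s = (\<Sum>i<b. F (w @ [i]) (cell_coord b i t) - F (w @ [i]) (cell_coord b i s))"
    and "\<mu> w t - \<mu> w s = (\<Sum>i<b. \<mu> (w @ [i]) (cell_coord b i t) - \<mu> (w @ [i]) (cell_coord b i s))"
  using assms by (simp_all add: X.cell_path_split[of w] Y.cell_path_split[of w] sum_subtractf)

lemma \<mu>_piece_le:
  assumes w: "w \<in> words b" and st: "s \<in> {0..1}" "t \<in> {0..1}" "s \<le> t" and i: "i < b"
  shows "0 \<le> \<mu> (w @ [i]) (cell_coord b i t) - \<mu> (w @ [i]) (cell_coord b i s)"
    and "\<mu> (w @ [i]) (cell_coord b i t) - \<mu> (w @ [i]) (cell_coord b i s) \<le> \<mu> w t - \<mu> w s"
proof -
  let ?d = "\<lambda>i. \<mu> (w @ [i]) (cell_coord b i t) - \<mu> (w @ [i]) (cell_coord b i s)"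
  have nonneg: "0 \<le> ?d k" if "k < b" for k
    using \<mu>_mono[of "w @ [k]" "cell_coord b k s" "cell_coord b k t"] w st that
      cell_coord_mono[OF st(3), of b k] by simp
  show "0 \<le> ?d i" by (rule nonneg[OF i])
  show "?d i \<le> \<mu> w t - \<mu> w s"
    unfolding increment_split(2)[OF w st(1,2)] by (rule member_le_sum) (use i nonneg in auto)
qed

text \<open>An interval that shares an end point with its cell consists, in each generation, of fewer
  than \<open>b\<close> full cells and one smaller interval of the same kind. Each full cell inside the interval
  obeys the cell estimate with the mass of the whole interval, and the geometric factor makes the
  contributions of the generations summable.\<close>

lemma one_sided_estimate:
  assumes \<delta>: "0 < \<delta>" "\<delta> < 1 / \<beta>"
    and C: "0 \<le> C" "0 < \<kappa>" "\<kappa> < 1"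
    and cell: "\<And>w. w \<in> words b \<Longrightarrow> norm (F w 1) \<le> C * \<kappa> ^ length w * \<mu> w 1 powr (1 / \<beta> - \<delta>)"
    and w: "w \<in> words b" and st: "s \<in> {0..1}" "t \<in> {0..1}" "s \<le> t" and edge: "s = 0 \<or> t = 1"
  shows "norm (F w t - F w s)
    \<le> real b * C / (1 - \<kappa>) * \<kappa> ^ length w * (\<mu> w t - \<mu> w s) powr (1 / \<beta> - \<delta>)"
proof -
  let ?a = "1 / \<beta> - \<delta>"
  let ?D = "real b * C / (1 - \<kappa>)"
  have a: "0 < ?a" using \<delta> by simp
  have D: "0 \<le> ?D" using C by simp
  obtain K where K: "0 \<le> K"
    "\<And>w t. w \<in> words b \<Longrightarrow> t \<in> {0..1} \<Longrightarrow> norm (F w t) \<le> K * rx ^ length w"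
    using X.cell_path_le by blast
  \<comment> \<open>stop the decomposition after \<open>N\<close> generations; the rest is small uniformly in its position\<close>
  have trunc: "norm (F w t - F w s)
      \<le> ?D * \<kappa> ^ length w * (\<mu> w t - \<mu> w s) powr ?a + 2 * K * rx ^ (length w + N)" for N
    using w st edge
  proof (induction N arbitrary: w s t)
    case 0
    have "norm (F w t - F w s) \<le> norm (F w t) + norm (F w s)" by (rule norm_triangle_ineq4)
    also have "\<dots> \<le> 2 * K * rx ^ (length w + 0)"
      using K(2)[of w s] K(2)[of w t] 0 by simp
    also have "\<dots> \<le> ?D * \<kappa> ^ length w * (\<mu> w t - \<mu> w s) powr ?a + 2 * K * rx ^ (length w + 0)"
      using D C by simp
    finally show ?case .
  next
    case (Suc N)
    let ?m = "(\<mu> w t - \<mu> w s) powr ?a"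
    note st = \<open>s \<in> {0..1}\<close> \<open>t \<in> {0..1}\<close> \<open>s \<le> t\<close>
    note piece = \<mu>_piece_le[OF \<open>w \<in> words b\<close> st]
    have "\<exists>j<b. \<forall>i<b. i \<noteq> j \<longrightarrow> cell_coord b i s \<in> {0, 1} \<and> cell_coord b i t \<in> {0, 1}"
    proof (cases "s = 0")
      case True
      obtain j where "j < b" "\<And>i. i < b \<Longrightarrow> i \<noteq> j \<Longrightarrow> cell_coord b i t = 0 \<or> cell_coord b i t = 1"
        using obtain_cell[OF b1 \<open>t \<in> {0..1}\<close>] by metis
      then show ?thesis using True by auto
    next
      case False
      obtain j where "j < b" "\<And>i. i < b \<Longrightarrow> i \<noteq> j \<Longrightarrow> cell_coord b i s = 0 \<or> cell_coord b i s = 1"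
        using obtain_cell[OF b1 \<open>s \<in> {0..1}\<close>] by metis
      then show ?thesis using False Suc.prems by (auto simp: cell_coord_1)
    qed
    then obtain j where j: "j < b"
      "\<And>i. i < b \<Longrightarrow> i \<noteq> j \<Longrightarrow> cell_coord b i s \<in> {0, 1} \<and> cell_coord b i t \<in> {0, 1}" by blast
    have "norm (F w t - F w s) \<le> real b * (C * \<kappa> ^ Suc (length w) * ?m)
        + (?D * \<kappa> ^ Suc (length w) * ?m + 2 * K * rx ^ (Suc (length w) + N))"
      unfolding increment_split(1)[OF \<open>w \<in> words b\<close> st(1,2)]
    proof (rule norm_sum_one_exception[OF j(1)])
      fix i assume i: "i < b" "i \<noteq> j"
      have "cell_coord b i s \<le> cell_coord b i t" by (rule cell_coord_mono[OF st(3)])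
      then consider "cell_coord b i s = cell_coord b i t" | "cell_coord b i s = 0" "cell_coord b i t = 1"
        using j(2)[OF i] by fastforce
      then show "norm (F (w @ [i]) (cell_coord b i t) - F (w @ [i]) (cell_coord b i s))
          \<le> C * \<kappa> ^ Suc (length w) * ?m"
      proof cases
        case 1 then show ?thesis using C by simp
      next
        case 2
        have "norm (F (w @ [i]) 1) \<le> C * \<kappa> ^ Suc (length w) * \<mu> (w @ [i]) 1 powr ?a"
          using cell[of "w @ [i]"] Suc.prems i by simp
        also have "\<dots> \<le> C * \<kappa> ^ Suc (length w) * ?m"
          using piece[OF i(1)] 2 C a by (intro mult_left_mono powr_mono2) auto
        finally show ?thesis using 2 by simp
      qed
    next
      have "norm (F (w @ [j]) (cell_coord b j t) - F (w @ [j]) (cell_coord b j s))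
          \<le> ?D * \<kappa> ^ length (w @ [j]) *
              (\<mu> (w @ [j]) (cell_coord b j t) - \<mu> (w @ [j]) (cell_coord b j s)) powr ?a
            + 2 * K * rx ^ (length (w @ [j]) + N)"
        using Suc.prems j(1)
        by (intro Suc.IH cell_coord_in cell_coord_mono) (auto simp: cell_coord_1)
      also have "\<dots> \<le> ?D * \<kappa> ^ length (w @ [j]) * ?m + 2 * K * rx ^ (length (w @ [j]) + N)"
        using piece[OF j(1)] C D a by (intro add_right_mono mult_left_mono powr_mono2) auto
      finally show "norm (F (w @ [j]) (cell_coord b j t) - F (w @ [j]) (cell_coord b j s))
          \<le> ?D * \<kappa> ^ Suc (length w) * ?m + 2 * K * rx ^ (Suc (length w) + N)" by simp
    qed (use C in simp)
    also have "\<dots> = (real b * C + ?D) * \<kappa> * \<kappa> ^ length w * ?m + 2 * K * rx ^ (length w + Suc N)"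
      by (simp add: algebra_simps)
    also have "(real b * C + ?D) * \<kappa> \<le> ?D"
    proof -
      have "real b * C + ?D = real b * C * (2 - \<kappa>) / (1 - \<kappa>)" using C by (simp add: field_simps)
      moreover have "(2 - \<kappa>) * \<kappa> \<le> 1" using zero_le_power2[of "1 - \<kappa>"] by (simp add: power2_eq_square algebra_simps)
      then have "real b * C * ((2 - \<kappa>) * \<kappa>) / (1 - \<kappa>) \<le> real b * C * 1 / (1 - \<kappa>)"
        using C by (intro divide_right_mono mult_left_mono) auto
      ultimately show ?thesis by (simp add: mult_ac)
    qed
    finally show ?case using C by (simp add: mult_right_mono)
  qed
  have "(\<lambda>N. ?D * \<kappa> ^ length w * (\<mu> w t - \<mu> w s) powr ?a + 2 * K * rx ^ (length w + N))
      \<longlonglongrightarrow> ?D * \<kappa> ^ length w * (\<mu> w t - \<mu> w s) powr ?a + 2 * K * 0"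
    using X.r by (intro tendsto_intros LIMSEQ_ignore_initial_segment[OF LIMSEQ_power_zero, of rx "length w", unfolded add.commute[of _ "length w"]]) auto
  then show ?thesis
    using trunc by (intro LIMSEQ_le_const[where X = "\<lambda>N. ?D * \<kappa> ^ length w * (\<mu> w t - \<mu> w s) powr ?a + 2 * K * rx ^ (length w + N)"])
      auto
qed

text \<open>A general interval lies in a single child cell until, at some generation, its end points
  separate; from then on it consists of full cells and two one-sided intervals.\<close>

lemma modulus_of_continuity:
  assumes \<delta>: "0 < \<delta>" "\<delta> < 1 / \<beta>"
  obtains D where "0 \<le> D" "\<And>s t. s \<in> {0..1} \<Longrightarrow> t \<in> {0..1} \<Longrightarrow> s \<le> t \<Longrightarrow>
    norm (F [] t - F [] s) \<le> D * (\<mu> [] t - \<mu> [] s) powr (1 / \<beta> - \<delta>)"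
proof -
  let ?a = "1 / \<beta> - \<delta>"
  have a: "0 < ?a" using \<delta> by simp
  obtain C \<kappa> where C: "0 \<le> C" "0 < \<kappa>" "\<kappa> < 1"
    and cell: "\<And>w. w \<in> words b \<Longrightarrow> norm (F w 1) \<le> C * \<kappa> ^ length w * \<mu> w 1 powr ?a"
    using cell_estimate[OF \<delta>] by blast
  define D where "D = real b * C / (1 - \<kappa>)"
  have D: "0 \<le> D" using C by (simp add: D_def)
  obtain K where K: "0 \<le> K"
    "\<And>w t. w \<in> words b \<Longrightarrow> t \<in> {0..1} \<Longrightarrow> norm (F w t) \<le> K * rx ^ length w"
    using X.cell_path_le by blast
  have one_sided: "norm (F w t - F w s) \<le> D * (\<mu> w t - \<mu> w s) powr ?a"
    if w: "w \<in> words b" and st: "s \<in> {0..1}" "t \<in> {0..1}" "s \<le> t" and edge: "s \<in> {0, 1} \<or> t \<in> {0, 1}"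
    for w s t
  proof (cases "s = t")
    case False
    then have "s = 0 \<or> t = 1" using st edge by auto
    then have "norm (F w t - F w s) \<le> D * \<kappa> ^ length w * (\<mu> w t - \<mu> w s) powr ?a"
      using one_sided_estimate[OF \<delta> C cell w st] by (simp add: D_def)
    also have "\<dots> \<le> D * 1 * (\<mu> w t - \<mu> w s) powr ?a"
      using C D by (intro mult_right_mono mult_left_mono power_le_one) auto
    finally show ?thesis by simp
  qed simp
  have trunc: "norm (F w t - F w s)
      \<le> real b * D * (\<mu> w t - \<mu> w s) powr ?a + 2 * K * rx ^ (length w + N)"
    if "w \<in> words b" "s \<in> {0..1}" "t \<in> {0..1}" "s \<le> t" for w s t N
    using that
  proof (induction N arbitrary: w s t)
    case 0
    have "norm (F w t - F w s) \<le> norm (F w t) + norm (F w s)" by (rule norm_triangle_ineq4)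
    also have "\<dots> \<le> 2 * K * rx ^ (length w + 0)"
      using K(2)[of w s] K(2)[of w t] 0 by simp
    also have "\<dots> \<le> real b * D * (\<mu> w t - \<mu> w s) powr ?a + 2 * K * rx ^ (length w + 0)"
      using D by simp
    finally show ?case .
  next
    case (Suc N)
    let ?m = "(\<mu> w t - \<mu> w s) powr ?a"
    let ?f = "\<lambda>i. F (w @ [i]) (cell_coord b i t) - F (w @ [i]) (cell_coord b i s)"
    note st = \<open>s \<in> {0..1}\<close> \<open>t \<in> {0..1}\<close> \<open>s \<le> t\<close>
    note piece = \<mu>_piece_le[OF \<open>w \<in> words b\<close> st]
    note split = increment_split(1)[OF \<open>w \<in> words b\<close> st(1,2)]
    obtain j where j: "j < b" "\<And>i. i < b \<Longrightarrow> i \<noteq> j \<Longrightarrow> cell_coord b i s = 0 \<or> cell_coord b i s = 1"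
      using obtain_cell[OF b1 st(1)] by metis
    obtain k where k: "k < b" "\<And>i. i < b \<Longrightarrow> i \<noteq> k \<Longrightarrow> cell_coord b i t = 0 \<or> cell_coord b i t = 1"
      using obtain_cell[OF b1 st(2)] by metis
    have edge: "norm (?f i) \<le> D * ?m"
      if i: "i < b" and e: "cell_coord b i s \<in> {0, 1} \<or> cell_coord b i t \<in> {0, 1}" for i
    proof -
      have "norm (?f i) \<le> D *
          (\<mu> (w @ [i]) (cell_coord b i t) - \<mu> (w @ [i]) (cell_coord b i s)) powr ?a"
        using Suc.prems i e by (intro one_sided cell_coord_in cell_coord_mono) auto
      also have "\<dots> \<le> D * ?m"
        using piece[OF i] D a by (intro mult_left_mono powr_mono2) auto
      finally show ?thesis .
    qed
    show ?case
    proof (cases "j = k")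
      case False
      have "norm (F w t - F w s) \<le> (\<Sum>i<b. D * ?m)"
        unfolding split using j(2) k(2) False by (intro sum_norm_le edge) auto
      also have "\<dots> = real b * D * ?m" by simp
      also have "\<dots> \<le> real b * D * ?m + 2 * K * rx ^ (length w + Suc N)"
        using K X.r by simp
      finally show ?thesis .
    next
      case True
      have zero: "?f i = 0 \<or> cell_coord b i s = 0 \<and> cell_coord b i t = 1" if "i < b" "i \<noteq> j" for i
        using j(2)[OF that] k(2)[of i] that True cell_coord_mono[OF st(3), of b i] by fastforce
      show ?thesis
      proof (cases "\<exists>i<b. i \<noteq> j \<and> cell_coord b i s = 0 \<and> cell_coord b i t = 1")
        case False
        then have "(\<Sum>i<b. ?f i) = (\<Sum>i<b. if i = j then ?f j else 0)"
          using zero by (intro sum.cong) auto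
        also have "\<dots> = ?f j" using j by simp
        finally have "norm (F w t - F w s) = norm (?f j)" unfolding split by simp
        also have "\<dots> \<le> real b * D *
              (\<mu> (w @ [j]) (cell_coord b j t) - \<mu> (w @ [j]) (cell_coord b j s)) powr ?a
            + 2 * K * rx ^ (length (w @ [j]) + N)"
          using Suc.prems j(1) by (intro Suc.IH cell_coord_in cell_coord_mono) auto
        also have "\<dots> \<le> real b * D * ?m + 2 * K * rx ^ (length (w @ [j]) + N)"
          using piece[OF j(1)] D a by (intro add_right_mono mult_left_mono powr_mono2) auto
        finally show ?thesis by simp
      next
        \<comment> \<open>a full cell lies between \<open>s\<close> and \<open>t\<close>, so that at most one of them is an inner point of the
          \<open>j\<close>-th cell\<close>
        case True
        then obtain i where i: "i < b" "i \<noteq> j" "cell_coord b i s = 0" "cell_coord b i t = 1" by blast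
        then have "real b * s \<le> real i" "real i + 1 \<le> real b * t"
          by (auto simp: cell_coord_def max_def min_def split: if_splits)
        moreover have "real i + 1 \<le> real j \<or> real j + 1 \<le> real i" using i(2) by linarith
        ultimately have "cell_coord b j s \<in> {0, 1} \<or> cell_coord b j t \<in> {0, 1}"
          by (auto simp: cell_coord_def)
        then have "norm (F w t - F w s) \<le> (\<Sum>i<b. D * ?m)"
          unfolding split using j(2) by (intro sum_norm_le edge) blast+
        also have "\<dots> = real b * D * ?m" by simp
        also have "\<dots> \<le> real b * D * ?m + 2 * K * rx ^ (length w + Suc N)"
          using K X.r by simp
        finally show ?thesis .
      qed
    qed
  qed
  have "norm (F [] t - F [] s) \<le> real b * D * (\<mu> [] t - \<mu> [] s) powr ?a"
    if st: "s \<in> {0..1}" "t \<in> {0..1}" "s \<le> t" for s t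
  proof -
    have "(\<lambda>N. real b * D * (\<mu> [] t - \<mu> [] s) powr ?a + 2 * K * rx ^ (length ([]::nat list) + N))
        \<longlonglongrightarrow> real b * D * (\<mu> [] t - \<mu> [] s) powr ?a + 2 * K * 0"
      using X.r by (simp only: list.size add_0) (intro tendsto_intros LIMSEQ_power_zero, auto)
    from LIMSEQ_le_const[OF this, of "norm (F [] t - F [] s)"] show ?thesis
      using trunc[of "[]" s t] st by auto
  qed
  then show thesis using that[of "real b * D"] D by simp
qed

text \<open>The first cell of mass at most \<open>r\<close> around the point \<open>u\<close> has a parent of mass larger than
  \<open>r\<close>. Mass and oscillation lose at most a subexponential factor from the parent to the child, and
  subexponential factors are powers of \<open>r\<close> with small exponents, because masses of cells decay
  exponentially.\<close>

lemma oscillation_lower_bound: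
  assumes \<delta>: "0 < \<delta>"
  obtains c where "0 < c" "\<And>u r. u \<in> {0..1} \<Longrightarrow> 0 < r \<Longrightarrow> r < \<mu> [] 1 \<Longrightarrow>
    \<exists>p\<in>{0..1}. \<exists>p'\<in>{0..1}. \<bar>\<mu> [] p - \<mu> [] u\<bar> \<le> r \<and> \<bar>\<mu> [] p' - \<mu> [] u\<bar> \<le> r \<and>
      c * r powr (1 / \<beta> + \<delta>) \<le> norm (F [] p - F [] p')"
proof -
  obtain K where K: "1 \<le> K" "\<And>w. w \<in> words b \<Longrightarrow> \<mu> w 1 \<le> K * ry ^ length w"
    using \<mu>_1_le by blast
  define e where "e = 1 + 2 / \<beta>"
  have e: "0 < e" using \<beta> by (simp add: e_def add_pos_pos)
  \<comment> \<open>chosen such that \<open>q powr (- e * m) = (ry ^ m) powr \<delta>\<close>, where \<open>ry ^ m\<close> is at least of order \<open>r\<close>\<close>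
  define q where "q = ry powr (- (\<delta> / e))"
  have "ry powr 0 < q"
    unfolding q_def using Y.r \<delta> e by (intro powr_less_mono') auto
  then have q: "1 < q" using Y.r by simp
  obtain C where C: "0 < C" "\<And>w. w \<in> words b \<Longrightarrow> norm (total_lim b (subtree w y)) \<le> C * q ^ length w"
    using regular_family_total_le[OF regular_y b1 q] by blast
  obtain c1 where c1: "0 < c1" "\<And>w. w \<in> words b \<Longrightarrow> \<exists>v\<in>words b.
      c1 / q ^ length w \<le> norm (path_weight (subtree w x) v * total_lim b (subtree (w @ v) x))"
    using regular_family_oscillation[OF regular_x q] by metis
  obtain c2 where c2: "0 < c2" "\<And>w i. w \<in> words b \<Longrightarrow> i < b \<Longrightarrow> c2 / q ^ length w \<le> norm (y w i)"
    using regular_family_entries[OF regular_y q] by metis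
  define A where "A = c2 / C"
  have A: "0 < A" using c2 C by (simp add: A_def)
  define c where "c = A powr (1 / \<beta>) * (c1 / q) * (1 / K) powr \<delta>"
  have c: "0 < c" using A c1 q K by (simp add: c_def)
  have "\<exists>p\<in>{0..1}. \<exists>p'\<in>{0..1}. \<bar>\<mu> [] p - \<mu> [] u\<bar> \<le> r \<and> \<bar>\<mu> [] p' - \<mu> [] u\<bar> \<le> r \<and>
      c * r powr (1 / \<beta> + \<delta>) \<le> norm (F [] p - F [] p')"
    if u: "u \<in> {0..1}" and r: "0 < r" "r < \<mu> [] 1" for u r
  proof -
    define P where "P n \<longleftrightarrow> (\<exists>w s. w \<in> words b \<and> length w = n \<and> s \<in> {0..1} \<and>
      u = cell_point b w s \<and> \<mu> w 1 \<le> r)" for n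
    have "\<exists>n. P n"
    proof -
      obtain n where n: "ry ^ n < r / K" using real_arch_pow_inv[of "r / K" ry] r K Y.r by auto
      obtain w s where w: "w \<in> words b" "length w = n" "s \<in> {0..1}" "u = cell_point b w s"
        using cell_point_surj[OF b1 u] by blast
      have "\<mu> w 1 \<le> K * ry ^ n" using K(2)[OF w(1)] w(2) by simp
      also have "\<dots> \<le> r" using n K by (simp add: field_simps)
      finally show ?thesis unfolding P_def using w by blast
    qed
    define n where "n = (LEAST n. P n)"
    have "P n" using \<open>\<exists>n. P n\<close> unfolding n_def by (rule LeastI_ex)
    then obtain w s where w: "w \<in> words b" "length w = n" "s \<in> {0..1}"
      "u = cell_point b w s" "\<mu> w 1 \<le> r" unfolding P_def by blast
    obtain w0 i where w0: "w = w0 @ [i]"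
      using w(5) r by (cases w rule: rev_cases) auto
    define m where "m = length w0"
    have wm: "length w = Suc m" and w0b: "w0 \<in> words b" and i: "i < b"
      using w0 w(1) by (auto simp: m_def)
    have parent: "r < \<mu> w0 1"
    proof (rule ccontr)
      assume "\<not> r < \<mu> w0 1"
      moreover have "(real i + s) / real b \<in> {0..1}"
        using cell_point_in[of "[i]" b s] i w(3) by simp
      moreover have "u = cell_point b w0 ((real i + s) / real b)"
        using w(4) w0 by (simp add: cell_point_snoc)
      ultimately have "P m" unfolding P_def using w0b m_def by (metis not_less)
      moreover have "m < n" using wm w(2) by simp
      ultimately show False unfolding n_def using not_less_Least by blast
    qed
    have weight: "A * r / q ^ (2 * m) \<le> path_weight y w"
    proof -
      let ?Z = "total_lim b (subtree w0 y)"
      have Zpos: "0 < ?Z"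
        using \<mu>_1_pos[OF w0b] weight_y_pos[OF w0b] by (simp add: Y.cell_path_1 zero_less_mult_iff)
      have "r / (C * q ^ m) \<le> \<mu> w0 1 / (C * q ^ m)"
        using parent C q by (intro divide_right_mono) auto
      also have "\<dots> \<le> \<mu> w0 1 / ?Z"
        using C(2)[OF w0b] Zpos \<mu>_1_pos[OF w0b] C(1) q by (intro divide_left_mono) (auto simp: m_def)
      also have "\<dots> = path_weight y w0" using Zpos by (simp add: Y.cell_path_1)
      finally have "r / (C * q ^ m) \<le> path_weight y w0" .
      moreover have "c2 / q ^ m \<le> y w0 i"
        using c2(2)[OF w0b i] y_pos[OF w0b i] by (simp add: m_def)
      ultimately have "(r / (C * q ^ m)) * (c2 / q ^ m) \<le> path_weight y w0 * y w0 i"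
        using r c2 q C weight_y_pos[OF w0b] by (intro mult_mono) auto
      moreover have "q ^ (2 * m) = q ^ m * q ^ m" by (simp add: mult_2 power_add)
      then have "(r / (C * q ^ m)) * (c2 / q ^ m) = A * r / q ^ (2 * m)"
        by (simp add: A_def mult_ac)
      ultimately show ?thesis by (simp add: w0 path_weight_snoc)
    qed
    have Q: "(A * r / q ^ (2 * m)) powr (1 / \<beta>) \<le> norm (path_weight x w)"
    proof -
      have "(A * r / q ^ (2 * m)) powr (1 / \<beta>) \<le> path_weight y w powr (1 / \<beta>)"
        using weight A r q \<beta> by (intro powr_mono2) auto
      also have "\<dots> = norm (path_weight x w)" using weight_y[OF w(1)] \<beta> by (simp add: powr_powr)
      finally show ?thesis .
    qed
    obtain v where v: "v \<in> words b"
      "c1 / q ^ Suc m \<le> norm (path_weight (subtree w x) v * total_lim b (subtree (w @ v) x))"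
      using c1(2)[OF w(1)] wm by auto
    define p p' where "p = cell_point b (w @ v) 1" and "p' = cell_point b (w @ v) 0"
    have pp: "p \<in> {0..1}" "p' \<in> {0..1}" unfolding p_def p'_def
      by (rule cell_point_in; use w v in simp)+
    have near: "\<bar>\<mu> [] (cell_point b (w @ v) \<tau>) - \<mu> [] u\<bar> \<le> r" if \<tau>: "\<tau> \<in> {0..1}" for \<tau>
    proof -
      have in1: "cell_point b v \<tau> \<in> {0..1}" by (rule cell_point_in[OF v(1) \<tau>])
      have "\<mu> [] (cell_point b (w @ v) \<tau>) - \<mu> [] u = \<mu> w (cell_point b v \<tau>) - \<mu> w s"
        using \<mu>_increment[OF Nil_in_words w(1,3) in1] w(4) by (simp add: cell_point_append)
      moreover have "0 \<le> \<mu> w (cell_point b v \<tau>)" "\<mu> w (cell_point b v \<tau>) \<le> \<mu> w 1"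
        "0 \<le> \<mu> w s" "\<mu> w s \<le> \<mu> w 1"
        using in1 w by (auto intro!: \<mu>_nonneg \<mu>_mono)
      ultimately show ?thesis using w(5) by linarith
    qed
    have "F [] p - F [] p' = F (w @ v) 1"
      unfolding p_def p'_def using F_increment[of "[]" "w @ v" 0 1] w v by simp
    also have "\<dots> = path_weight x w * (path_weight (subtree w x) v * total_lim b (subtree (w @ v) x))"
      by (simp add: X.cell_path_1 path_weight_append)
    finally have Feq: "norm (F [] p - F [] p') = norm (path_weight x w)
        * norm (path_weight (subtree w x) v * total_lim b (subtree (w @ v) x))"
      by (simp add: norm_mult)
    have Fpp: "(A * r / q ^ (2 * m)) powr (1 / \<beta>) * (c1 / q ^ Suc m) \<le> norm (F [] p - F [] p')"
      unfolding Feq by (rule mult_mono[OF Q v(2)]) (use c1(1) q in simp_all)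
    have "(r / K) powr \<delta> \<le> (ry ^ m) powr \<delta>"
    proof (rule powr_mono2)
      have "r \<le> K * ry ^ m" using parent K(2)[OF w0b] by (simp add: m_def)
      then show "r / K \<le> ry ^ m" using K by (simp add: field_simps)
    qed (use r K \<delta> in auto)
    also have "(ry ^ m) powr \<delta> = (1 / q ^ (2 * m)) powr (1 / \<beta>) * (1 / q ^ m)"
    proof -
      have "(1 / q ^ (2 * m)) powr (1 / \<beta>) * (1 / q ^ m) = q powr (- real (2 * m) / \<beta>) * q powr (- real m)"
        using q by (simp add: powr_minus_divide powr_powr powr_divide powr_realpow[symmetric])
      also have "\<dots> = q powr (- real m * e)"
        using \<beta> by (simp add: e_def field_simps flip: powr_add)
      also have "\<dots> = ry powr (\<delta> * real m)" unfolding q_def using e by (simp add: powr_powr)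
      also have "\<dots> = (ry ^ m) powr \<delta>"
        using Y.r by (simp add: powr_powr mult.commute flip: powr_realpow)
      finally show ?thesis by simp
    qed
    finally have decay: "(r / K) powr \<delta> \<le> (1 / q ^ (2 * m)) powr (1 / \<beta>) * (1 / q ^ m)" .
    have "c * r powr (1 / \<beta> + \<delta>) = A powr (1 / \<beta>) * (c1 / q) * r powr (1 / \<beta>) * (r / K) powr \<delta>"
      using r K by (simp add: c_def powr_add powr_divide)
    also have "\<dots> \<le> A powr (1 / \<beta>) * (c1 / q) * r powr (1 / \<beta>)
        * ((1 / q ^ (2 * m)) powr (1 / \<beta>) * (1 / q ^ m))"
      using decay c1 q by (intro mult_left_mono) auto
    also have "\<dots> = (A * r / q ^ (2 * m)) powr (1 / \<beta>) * (c1 / q ^ Suc m)"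
      using A r q by (simp add: powr_mult powr_divide mult_ac)
    finally have "c * r powr (1 / \<beta> + \<delta>) \<le> norm (F [] p - F [] p')" using Fpp by linarith
    then show ?thesis
      using near[of 1] near[of 0] pp
      by (intro bexI[of _ p] bexI[of _ p'] conjI) (simp_all add: p_def p'_def)
  qed
  then show thesis using that c by blast
qed

text \<open>In the time scale given by \<open>\<mu>\<close>, the two preceding bounds become bounds of the oscillation
  over \<open>[\<tau> - r, \<tau> + r]\<close> by powers of \<open>r\<close>, with constants that do not depend on \<open>\<tau>\<close>.\<close>

theorem time_changed_exponent:
  fixes f :: "real \<Rightarrow> 'v" and g :: "real \<Rightarrow> real"
  assumes f: "\<And>t. t \<in> {0..1} \<Longrightarrow> f t = cell_cascade_lim b x t"
    and g: "\<And>t. t \<in> {0..1} \<Longrightarrow> g t = cell_cascade_lim b y t"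
    and \<tau>: "\<tau> \<in> {0..g 1}"
  shows "has_local_exponent {0..g 1} (f \<circ> the_inv_into {0..1} g) (1 / \<beta>) \<tau>"
proof -
  let ?B = "f \<circ> the_inv_into {0..1} g"
  let ?D = "{0..g 1}"
  have fF: "f t = F [] t" if "t \<in> {0..1}" for t using f[OF that] by (simp add: X.cell_path_def)
  have g\<mu>: "g t = \<mu> [] t" if "t \<in> {0..1}" for t using g[OF that] by (simp add: Y.cell_path_def)
  have g01: "g 0 = 0" "0 < g 1" using g\<mu>[of 0] g\<mu>[of 1] \<mu>_1_pos[of "[]"] by auto
  have inj: "inj_on g {0..1}"
  proof (rule inj_onI)
    fix s t assume st: "s \<in> {0..1}" "t \<in> {0..1}" "g s = g t"
    then show "s = t"
      using \<mu>_strict_mono[of s t] \<mu>_strict_mono[of t s] g\<mu>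
      by (cases s t rule: linorder_cases) auto
  qed
  have mono: "g s \<le> g t" if "s \<in> {0..1}" "t \<in> {0..1}" "s \<le> t" for s t
    using \<mu>_mono[OF Nil_in_words that] that by (simp add: g\<mu>)
  have img: "g ` {0..1} = ?D"
  proof
    show "g ` {0..1} \<subseteq> ?D" using mono[of 0] mono[of _ 1] g01 by auto
    have "continuous_on {0..1} (cell_cascade_lim b y)" using Y.continuous_on_cell_cascade_lim[of "[]"] by simp
    then have cont: "continuous_on {0..1} g" using g by (subst continuous_on_cong[OF refl]) auto
    show "?D \<subseteq> g ` {0..1}"
    proof
      fix z assume "z \<in> ?D"
      then have "\<exists>t\<ge>0. t \<le> 1 \<and> g t = z" using g01 by (intro IVT'[OF _ _ _ cont]) auto
      then show "z \<in> g ` {0..1}" by auto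
    qed
  qed
  have Bg: "?B (g t) = F [] t" if "t \<in> {0..1}" for t
    using the_inv_into_f_f[OF inj that] fF[OF that] by simp
  have bounds: "\<exists>c K r0. 0 < c \<and> 0 < r0 \<and> (\<forall>r. 0 < r \<longrightarrow> r < r0 \<longrightarrow>
      c * r powr (1 / \<beta> + \<delta>) \<le> Osc ?D ?B {\<tau> - r..\<tau> + r} \<and>
      Osc ?D ?B {\<tau> - r..\<tau> + r} \<le> K * r powr (1 / \<beta> - \<delta>))"
    if \<delta>: "0 < \<delta>" "\<delta> < 1 / \<beta>" for \<delta>
  proof -
    let ?a = "1 / \<beta> - \<delta>"
    obtain D where D: "0 \<le> D" "\<And>s t. s \<in> {0..1} \<Longrightarrow> t \<in> {0..1} \<Longrightarrow> s \<le> t \<Longrightarrow>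
        norm (F [] t - F [] s) \<le> D * (\<mu> [] t - \<mu> [] s) powr ?a"
      using modulus_of_continuity[OF \<delta>] by blast
    obtain c where c: "0 < c" "\<And>u r. u \<in> {0..1} \<Longrightarrow> 0 < r \<Longrightarrow> r < \<mu> [] 1 \<Longrightarrow>
        \<exists>p\<in>{0..1}. \<exists>p'\<in>{0..1}. \<bar>\<mu> [] p - \<mu> [] u\<bar> \<le> r \<and> \<bar>\<mu> [] p' - \<mu> [] u\<bar> \<le> r \<and>
          c * r powr (1 / \<beta> + \<delta>) \<le> norm (F [] p - F [] p')"
      using oscillation_lower_bound[OF \<delta>(1)] by blast
    have osc: "c * r powr (1 / \<beta> + \<delta>) \<le> Osc ?D ?B {\<tau> - r..\<tau> + r}"
        "Osc ?D ?B {\<tau> - r..\<tau> + r} \<le> D * 2 powr ?a * r powr ?a"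
      if r: "0 < r" "r < g 1" for r
    proof -
      let ?J = "{\<tau> - r..\<tau> + r} \<inter> ?D"
      let ?h = "\<lambda>(s, t). norm (?B t - ?B s)"
      have upper: "?h z \<le> D * 2 powr ?a * r powr ?a" if z: "z \<in> ?J \<times> ?J" for z
      proof -
        have "fst z \<in> g ` {0..1}" "snd z \<in> g ` {0..1}" unfolding img using z by auto
        then obtain s t where st: "s \<in> {0..1}" "t \<in> {0..1}" "z = (g s, g t)"
          by (cases z) auto
        have close: "\<bar>g s - g t\<bar> \<le> 2 * r" using z st(3) by auto
        have *: "norm (F [] t' - F [] s') \<le> D * (2 * r) powr ?a"
          if "s' \<in> {0..1}" "t' \<in> {0..1}" "s' \<le> t'" "\<bar>g s' - g t'\<bar> \<le> 2 * r" for s' t'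
        proof -
          have "norm (F [] t' - F [] s') \<le> D * (g t' - g s') powr ?a"
            using D(2)[OF that(1-3)] that by (simp add: g\<mu>)
          also have "\<dots> \<le> D * (2 * r) powr ?a"
            using that mono[OF that(1-3)] D(1) \<delta> by (intro mult_left_mono powr_mono2) auto
          finally show ?thesis .
        qed
        have "norm (F [] t - F [] s) \<le> D * (2 * r) powr ?a"
          using *[of s t] *[of t s] st close
          by (cases "s \<le> t") (auto simp: norm_minus_commute abs_minus_commute)
        then show ?thesis using st r Bg by (simp add: powr_mult)
      qed
      have ne: "?J \<times> ?J \<noteq> {}" using \<tau> r by auto
      show "Osc ?D ?B {\<tau> - r..\<tau> + r} \<le> D * 2 powr ?a * r powr ?a"
        unfolding Osc_def by (rule cSUP_least[OF ne upper])
      have bdd: "bdd_above (?h ` (?J \<times> ?J))"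
        using upper by (intro bdd_aboveI2)
      have "\<tau> \<in> g ` {0..1}" unfolding img by (rule \<tau>)
      then obtain u where u: "u \<in> {0..1}" "\<tau> = g u" by auto
      obtain p p' where p: "p \<in> {0..1}" "p' \<in> {0..1}" "\<bar>\<mu> [] p - \<mu> [] u\<bar> \<le> r"
          "\<bar>\<mu> [] p' - \<mu> [] u\<bar> \<le> r" "c * r powr (1 / \<beta> + \<delta>) \<le> norm (F [] p - F [] p')"
        using c(2)[OF u(1) r(1)] r(2) g\<mu>[of 1] by auto
      have gp: "g p \<in> ?D" "g p' \<in> ?D" using p img by auto
      have "(g p', g p) \<in> ?J \<times> ?J"
        using p(3,4) u g\<mu>[OF p(1)] g\<mu>[OF p(2)] g\<mu>[OF u(1)] gp by auto
      from cSUP_upper[OF this bdd] have "norm (F [] p - F [] p') \<le> Osc ?D ?B {\<tau> - r..\<tau> + r}"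
        unfolding Osc_def using Bg p by simp
      then show "c * r powr (1 / \<beta> + \<delta>) \<le> Osc ?D ?B {\<tau> - r..\<tau> + r}" using p(5) by linarith
    qed
    then show ?thesis using c(1) g01(2) by blast
  qed
  show ?thesis
    unfolding has_local_exponent_def
    by (rule tendsto_ln_quotient) (use \<beta> bounds in auto)
qed

end

section \<open>Independent cascades\<close>

text \<open>Fubini's theorem for independent random variables.\<close>

lemma (in prob_space) indep_var_nn_integral_pair:
  assumes ind: "indep_var S X T Y" and h [measurable]: "h \<in> borel_measurable (S \<Otimes>\<^sub>M T)"
  shows "(\<integral>\<^sup>+\<omega>. h (X \<omega>, Y \<omega>) \<partial>M) = (\<integral>\<^sup>+\<omega>. (\<integral>\<^sup>+\<omega>'. h (X \<omega>, Y \<omega>') \<partial>M) \<partial>M)"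
proof -
  have X [measurable]: "X \<in> M \<rightarrow>\<^sub>M S" and Y [measurable]: "Y \<in> M \<rightarrow>\<^sub>M T"
    using indep_var_rv1[OF ind] indep_var_rv2[OF ind] by auto
  interpret T: prob_space "distr M T Y" by (rule prob_space_distr) simp
  have "(\<integral>\<^sup>+\<omega>. h (X \<omega>, Y \<omega>) \<partial>M) = (\<integral>\<^sup>+z. h z \<partial>distr M (S \<Otimes>\<^sub>M T) (\<lambda>\<omega>. (X \<omega>, Y \<omega>)))"
    by (subst nn_integral_distr) auto
  also have "\<dots> = (\<integral>\<^sup>+z. h z \<partial>(distr M S X \<Otimes>\<^sub>M distr M T Y))"
    using ind unfolding indep_var_distribution_eq by simp
  also have "\<dots> = (\<integral>\<^sup>+s. (\<integral>\<^sup>+t. h (s, t) \<partial>distr M T Y) \<partial>distr M S X)"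
    by (subst T.nn_integral_fst[symmetric]) (auto cong: measurable_cong_sets)
  also have "\<dots> = (\<integral>\<^sup>+\<omega>. (\<integral>\<^sup>+t. h (X \<omega>, t) \<partial>distr M T Y) \<partial>M)"
    by (subst nn_integral_distr) (auto intro!: T.borel_measurable_nn_integral)
  also have "\<dots> = (\<integral>\<^sup>+\<omega>. (\<integral>\<^sup>+\<omega>'. h (X \<omega>, Y \<omega>') \<partial>M) \<partial>M)"
    by (intro nn_integral_cong, subst nn_integral_distr) auto
  finally show ?thesis .
qed

lemma (in prob_space) indep_var_nn_integral_mult:
  assumes ind: "indep_var S X T Y"
    and [measurable]: "f \<in> borel_measurable S" "g \<in> borel_measurable T"
  shows "(\<integral>\<^sup>+\<omega>. f (X \<omega>) * g (Y \<omega>) \<partial>M) = (\<integral>\<^sup>+\<omega>. f (X \<omega>) \<partial>M) * (\<integral>\<^sup>+\<omega>. g (Y \<omega>) \<partial>M)"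
proof -
  have [measurable]: "X \<in> M \<rightarrow>\<^sub>M S" "Y \<in> M \<rightarrow>\<^sub>M T"
    using indep_var_rv1[OF ind] indep_var_rv2[OF ind] by auto
  have "(\<integral>\<^sup>+\<omega>. f (X \<omega>) * g (Y \<omega>) \<partial>M) = (\<integral>\<^sup>+\<omega>. (\<integral>\<^sup>+\<omega>'. f (X \<omega>) * g (Y \<omega>') \<partial>M) \<partial>M)"
    using indep_var_nn_integral_pair[OF ind, of "\<lambda>z. f (fst z) * g (snd z)"] by simp
  then show ?thesis by (simp add: nn_integral_cmult nn_integral_multc)
qed

lemma power_add_le:
  fixes m s :: real
  assumes "0 \<le> m" "0 \<le> s"
  shows "(m + s) ^ Suc k \<le> m ^ Suc k + real (Suc k) * s * (m + s) ^ k"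
proof (induction k)
  case (Suc k)
  have "(m + s) ^ Suc (Suc k) = m * (m + s) ^ Suc k + s * (m + s) ^ Suc k"
    by (simp add: algebra_simps)
  also have "m * (m + s) ^ Suc k \<le> m * (m ^ Suc k + real (Suc k) * s * (m + s) ^ k)"
    using Suc.IH assms by (intro mult_left_mono)
  also have "\<dots> = m ^ Suc (Suc k) + real (Suc k) * s * (m * (m + s) ^ k)"
    by (simp add: algebra_simps)
  also have "real (Suc k) * s * (m * (m + s) ^ k) \<le> real (Suc k) * s * ((m + s) * (m + s) ^ k)"
    using assms by (intro mult_left_mono mult_right_mono) auto
  finally show ?case by (simp add: algebra_simps)
qed simp

text \<open>Splitting off the largest summand leaves only terms with at least one other factor.\<close>

lemma power_sum_le:
  fixes c :: "nat \<Rightarrow> real"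
  assumes b: "1 \<le> b" and c: "\<And>i. i < b \<Longrightarrow> 0 \<le> c i"
  shows "(\<Sum>i<b. c i) ^ Suc k \<le> (\<Sum>i<b. c i ^ Suc k)
    + real (Suc k) * real b ^ k * (\<Sum>i<b. \<Sum>j\<in>{..<b} - {i}. c i ^ k * c j)"
proof -
  have "\<exists>p<b. \<forall>i<b. c i \<le> c p"
  proof -
    have "finite (c ` {..<b})" "c ` {..<b} \<noteq> {}" using b by (auto simp: lessThan_empty_iff)
    from Max_in[OF this] obtain p where "p < b" "c p = Max (c ` {..<b})" by auto
    then show ?thesis by auto
  qed
  then obtain p where p: "p < b" "\<And>i. i < b \<Longrightarrow> c i \<le> c p" by blast
  define s where "s = (\<Sum>j\<in>{..<b} - {p}. c j)"
  have s: "0 \<le> s" unfolding s_def by (rule sum_nonneg) (use c in auto)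
  have sum: "(\<Sum>i<b. c i) = c p + s" unfolding s_def using p by (subst sum.remove[of _ p]) auto
  have "(\<Sum>i<b. c i) \<le> real b * c p" using sum_bounded_above[of "{..<b}" c "c p"] p by simp
  then have le: "(c p + s) ^ k \<le> (real b * c p) ^ k"
    unfolding sum using c[OF p(1)] s by (intro power_mono) auto
  have "(\<Sum>i<b. c i) ^ Suc k \<le> c p ^ Suc k + real (Suc k) * s * (c p + s) ^ k"
    unfolding sum by (rule power_add_le) (use c p s in auto)
  also have "\<dots> \<le> c p ^ Suc k + real (Suc k) * s * (real b * c p) ^ k"
    using le s by (intro add_left_mono mult_left_mono) auto
  also have "\<dots> = c p ^ Suc k + real (Suc k) * real b ^ k * (\<Sum>j\<in>{..<b} - {p}. c p ^ k * c j)"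
    by (simp add: s_def sum_distrib_left sum_distrib_right power_mult_distrib mult_ac)
  also have "\<dots> \<le> (\<Sum>i<b. c i ^ Suc k)
      + real (Suc k) * real b ^ k * (\<Sum>i<b. \<Sum>j\<in>{..<b} - {i}. c i ^ k * c j)"
    using c p by (intro add_mono mult_left_mono
        member_le_sum[where f = "\<lambda>i. c i ^ Suc k"]
        member_le_sum[where f = "\<lambda>i. \<Sum>j\<in>{..<b} - {i}. c i ^ k * c j"] sum_nonneg) auto
  finally show ?thesis .
qed

lemma mass_step_0: "mass_step b 0 x = (\<Sum>i<b. x [] i) - 1"
  by (simp add: mass_step_def)

lemma mass_step_Suc: "mass_step b (Suc n) x = (\<Sum>i<b. x [] i * mass_step b n (subtree [i] x))"
  by (simp add: mass_step_def right_diff_distrib flip: sum_subtractf)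

text \<open>The law \<open>N\<close> of a single weight vector and the cascade on the canonical space of independent
  copies of it, indexed by words. On this space \<open>subtree w\<close> is a measure preserving map, and the root
  vector and the subtrees of the children are independent.\<close>

locale cascade_law = N: prob_space N for N :: "(nat \<Rightarrow> complex) measure" +
  fixes b :: nat
  assumes b2: "2 \<le> b"
    and sets_N: "sets N = sets (vec_space b)"
    and bounded: "AE a in N. \<forall>i<b. norm (a i) \<le> 1"
    and nonzero: "AE a in N. \<forall>i<b. a i \<noteq> 0"
    and inverse_moment: "i < b \<Longrightarrow> (\<integral>\<^sup>+a. ennreal (1 / norm (a i) ^ k) \<partial>N) < \<infinity>"
    and mean: "(\<integral>a. (\<Sum>i<b. a i) \<partial>N) = 1"
    and subcritical: "(\<forall>k\<ge>2. (\<integral>\<^sup>+a. (\<Sum>i<b. ennreal (norm (a i) ^ k)) \<partial>N) < 1) \<or>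
      (AE a in N. (\<Sum>i<b. a i) = 1) \<and> (\<exists>k\<ge>1. (\<integral>\<^sup>+a. (\<Sum>i<b. ennreal (norm (a i) ^ k)) \<partial>N) < 1)"
begin

definition \<Omega> :: "(nat list \<Rightarrow> nat \<Rightarrow> complex) measure" where
  "\<Omega> = PiM (words b) (\<lambda>_. N)"

sublocale \<Omega>: prob_space \<Omega>
  unfolding \<Omega>_def by (rule prob_space_PiM) (rule N.prob_space_axioms)

lemma measurable_entry [measurable]: "i < b \<Longrightarrow> (\<lambda>a. a i) \<in> borel_measurable N"
  unfolding measurable_cong_sets[OF sets_N refl] vec_space_def
  by (rule measurable_component_singleton) simp

lemma measurable_vertex [measurable]: "w \<in> words b \<Longrightarrow> (\<lambda>x. x w) \<in> \<Omega> \<rightarrow>\<^sub>M N"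
  unfolding \<Omega>_def by (rule measurable_component_singleton)

lemma subtree_restrict:
  assumes "x \<in> space \<Omega>"
  shows "subtree w x = (\<lambda>v\<in>words b. x (w @ v))"
proof
  fix v
  show "subtree w x v = (\<lambda>v\<in>words b. x (w @ v)) v"
    using assms by (cases "v \<in> words b")
      (auto simp: subtree_apply \<Omega>_def space_PiM PiE_def extensional_def)
qed

lemma measurable_subtree [measurable]:
  assumes [simp]: "w \<in> words b"
  shows "subtree w \<in> \<Omega> \<rightarrow>\<^sub>M \<Omega>"
proof -
  have "(\<lambda>x. \<lambda>v\<in>words b. x (w @ v)) \<in> \<Omega> \<rightarrow>\<^sub>M \<Omega>"
    unfolding \<Omega>_def by (rule measurable_restrict) (rule measurable_component_singleton, simp)
  then show ?thesis by (subst measurable_cong[OF subtree_restrict])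
qed

lemma distr_subtree:
  assumes w: "w \<in> words b"
  shows "distr \<Omega> \<Omega> (subtree w) = \<Omega>"
proof -
  have "distr \<Omega> \<Omega> (subtree w) = distr \<Omega> \<Omega> (\<lambda>x. \<lambda>v\<in>words b. x (w @ v))"
    by (rule distr_cong) (auto simp: subtree_restrict)
  also have "\<dots> = \<Omega>"
    unfolding \<Omega>_def
    by (rule distr_PiM_reindex) (use w N.prob_space_axioms in \<open>auto simp: inj_on_def\<close>)
  finally show ?thesis .
qed

lemma distr_vertex: "w \<in> words b \<Longrightarrow> distr \<Omega> N (\<lambda>x. x w) = N"
  unfolding \<Omega>_def by (rule distr_PiM_component) (rule N.prob_space_axioms)

lemma nn_integral_subtree:
  "w \<in> words b \<Longrightarrow> f \<in> borel_measurable \<Omega> \<Longrightarrow> (\<integral>\<^sup>+x. f (subtree w x) \<partial>\<Omega>) = (\<integral>\<^sup>+x. f x \<partial>\<Omega>)"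
  by (subst (2) distr_subtree[symmetric, of w]) (auto simp: nn_integral_distr)

lemma nn_integral_vertex:
  "w \<in> words b \<Longrightarrow> f \<in> borel_measurable N \<Longrightarrow> (\<integral>\<^sup>+x. f (x w) \<partial>\<Omega>) = (\<integral>\<^sup>+a. f a \<partial>N)"
  by (subst distr_vertex[symmetric, of w]) (auto simp: nn_integral_distr)

lemma integral_subtree:
  fixes f :: "_ \<Rightarrow> complex"
  shows "w \<in> words b \<Longrightarrow> f \<in> borel_measurable \<Omega> \<Longrightarrow> (\<integral>x. f (subtree w x) \<partial>\<Omega>) = (\<integral>x. f x \<partial>\<Omega>)"
  by (subst (2) distr_subtree[symmetric, of w]) (auto simp: integral_distr)

lemma integral_vertex:
  fixes f :: "_ \<Rightarrow> complex"
  shows "w \<in> words b \<Longrightarrow> f \<in> borel_measurable N \<Longrightarrow> (\<integral>x. f (x w) \<partial>\<Omega>) = (\<integral>a. f a \<partial>N)"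
  by (subst distr_vertex[symmetric, of w]) (auto simp: integral_distr)

lemma AE_subtree:
  assumes w: "w \<in> words b" and P: "AE x in \<Omega>. P x"
  shows "AE x in \<Omega>. P (subtree w x)"
  by (rule AE_distrD[OF measurable_subtree[OF w]], subst distr_subtree[OF w], rule P)

lemma AE_vertex:
  assumes w: "w \<in> words b" and P: "AE a in N. P a"
  shows "AE x in \<Omega>. P (x w)"
  by (rule AE_distrD[OF measurable_vertex[OF w]], subst distr_vertex[OF w], rule P)

lemma indep_vertices: "\<Omega>.indep_vars (\<lambda>_. N) (\<lambda>w x. x w) (words b)"
proof (subst \<Omega>.indep_vars_iff_distr_eq_PiM')
  have "distr \<Omega> (PiM (words b) (\<lambda>_. N)) (\<lambda>x. \<lambda>w\<in>words b. x w) = distr \<Omega> \<Omega> (\<lambda>x. x)"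
    by (rule distr_cong) (auto simp: \<Omega>_def space_PiM)
  also have "\<dots> = PiM (words b) (\<lambda>_. N)" by (simp add: distr_id2) (simp add: \<Omega>_def)
  also have "\<dots> = PiM (words b) (\<lambda>w. distr \<Omega> N (\<lambda>x. x w))"
    by (rule PiM_cong) (simp_all add: distr_vertex)
  finally show "distr \<Omega> (PiM (words b) (\<lambda>_. N)) (\<lambda>x. \<lambda>w\<in>words b. x w)
      = PiM (words b) (\<lambda>w. distr \<Omega> N (\<lambda>x. x w))" .
qed (auto intro: Nil_in_words)

lemma measurable_graft [measurable]:
  assumes "i < b" "\<And>v. v \<in> words b \<Longrightarrow> i # v \<in> K"
  shows "(\<lambda>z. \<lambda>v\<in>words b. z (i # v)) \<in> PiM K (\<lambda>_. N) \<rightarrow>\<^sub>M \<Omega>"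
  unfolding \<Omega>_def
  by (rule measurable_restrict) (rule measurable_component_singleton, use assms in auto)

lemma indep_subtrees:
  assumes ij: "i < b" "j < b" "i \<noteq> j"
  shows "\<Omega>.indep_var \<Omega> (subtree [i]) \<Omega> (subtree [j])"
proof -
  let ?K = "\<lambda>i. (#) i ` words b"
  have "\<Omega>.indep_var (PiM (?K i) (\<lambda>_. N)) (\<lambda>x. restrict (\<lambda>w. x w) (?K i))
      (PiM (?K j) (\<lambda>_. N)) (\<lambda>x. restrict (\<lambda>w. x w) (?K j))"
    by (rule \<Omega>.indep_var_restrict[OF indep_vertices]) (use ij in auto)
  then have "\<Omega>.indep_var \<Omega> ((\<lambda>z. \<lambda>v\<in>words b. z (i # v)) \<circ> (\<lambda>x. restrict (\<lambda>w. x w) (?K i)))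
      \<Omega> ((\<lambda>z. \<lambda>v\<in>words b. z (j # v)) \<circ> (\<lambda>x. restrict (\<lambda>w. x w) (?K j)))"
    by (rule \<Omega>.indep_var_compose) (use ij in \<open>auto intro!: measurable_graft\<close>)
  moreover have "((\<lambda>z. \<lambda>v\<in>words b. z (i # v)) \<circ> (\<lambda>x. restrict (\<lambda>w. x w) (?K i))) x = subtree [i] x"
    if "x \<in> space \<Omega>" for x and i :: nat
    by (auto simp: subtree_restrict[OF that] restrict_def)
  ultimately show ?thesis
    unfolding \<Omega>.indep_var_distribution_eq by (simp cong: measurable_cong distr_cong)
qed

lemma indep_root: "\<Omega>.indep_var (PiM {[]} (\<lambda>_. N)) (\<lambda>x. restrict (\<lambda>w. x w) {[]})
    (PiM (words b - {[]}) (\<lambda>_. N)) (\<lambda>x. restrict (\<lambda>w. x w) (words b - {[]}))"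
  by (rule \<Omega>.indep_var_restrict[OF indep_vertices]) auto

lemma graft_restrict:
  assumes "x \<in> space \<Omega>" "i < b"
  shows "(\<lambda>v\<in>words b. restrict (\<lambda>w. x w) (words b - {[]}) (i # v)) = subtree [i] x"
  using assms(2) by (auto simp: subtree_restrict[OF assms(1)] restrict_def)

text \<open>Conditioning on the root vector. Two subtrees suffice for all that follows.\<close>

lemma nn_integral_root_split:
  assumes ij [simp]: "i < b" "j < b" and H [measurable]: "H \<in> borel_measurable (N \<Otimes>\<^sub>M (\<Omega> \<Otimes>\<^sub>M \<Omega>))"
  shows "(\<integral>\<^sup>+x. H (x [], (subtree [i] x, subtree [j] x)) \<partial>\<Omega>)
    = (\<integral>\<^sup>+a. (\<integral>\<^sup>+x. H (a, (subtree [i] x, subtree [j] x)) \<partial>\<Omega>) \<partial>N)"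
proof -
  let ?K = "words b - {[]}"
  let ?g = "\<lambda>i z. \<lambda>v\<in>words b. z (i # v)"
  let ?H = "\<lambda>(y, z). H (y [], (?g i z, ?g j z))"
  have [measurable]: "(\<lambda>y. y []) \<in> PiM {[]} (\<lambda>_. N) \<rightarrow>\<^sub>M N"
    by (rule measurable_component_singleton) simp
  have [measurable]: "?g k \<in> PiM ?K (\<lambda>_. N) \<rightarrow>\<^sub>M \<Omega>" if "k < b" for k
    by (rule measurable_graft) (use that in auto)
  have "(\<integral>\<^sup>+x. H (x [], (subtree [i] x, subtree [j] x)) \<partial>\<Omega>)
      = (\<integral>\<^sup>+x. ?H (restrict (\<lambda>w. x w) {[]}, restrict (\<lambda>w. x w) ?K) \<partial>\<Omega>)"
    by (intro nn_integral_cong) (simp only: case_prod_conv graft_restrict ij, simp)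
  also have "\<dots> = (\<integral>\<^sup>+x. (\<integral>\<^sup>+x'. ?H (restrict (\<lambda>w. x w) {[]}, restrict (\<lambda>w. x' w) ?K) \<partial>\<Omega>) \<partial>\<Omega>)"
    by (rule \<Omega>.indep_var_nn_integral_pair[OF indep_root]) measurable
  also have "\<dots> = (\<integral>\<^sup>+x. (\<integral>\<^sup>+x'. H (x [], (subtree [i] x', subtree [j] x')) \<partial>\<Omega>) \<partial>\<Omega>)"
    by (intro nn_integral_cong) (simp only: case_prod_conv graft_restrict ij, simp)
  also have "\<dots> = (\<integral>\<^sup>+a. (\<integral>\<^sup>+x. H (a, (subtree [i] x, subtree [j] x)) \<partial>\<Omega>) \<partial>N)"
    by (rule nn_integral_vertex) (auto intro!: \<Omega>.borel_measurable_nn_integral)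
  finally show ?thesis .
qed

lemma indep_root_subtrees:
  assumes ij [simp]: "i < b" "j < b"
    and [measurable]: "f \<in> N \<rightarrow>\<^sub>M S" "g \<in> \<Omega> \<Otimes>\<^sub>M \<Omega> \<rightarrow>\<^sub>M T"
  shows "\<Omega>.indep_var S (\<lambda>x. f (x [])) T (\<lambda>x. g (subtree [i] x, subtree [j] x))"
proof -
  let ?K = "words b - {[]}"
  let ?g = "\<lambda>i z. \<lambda>v\<in>words b. z (i # v)"
  have [measurable]: "(\<lambda>y. y []) \<in> PiM {[]} (\<lambda>_. N) \<rightarrow>\<^sub>M N"
    by (rule measurable_component_singleton) simp
  have [measurable]: "?g k \<in> PiM ?K (\<lambda>_. N) \<rightarrow>\<^sub>M \<Omega>" if "k < b" for k
    by (rule measurable_graft) (use that in auto)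
  have "\<Omega>.indep_var S ((\<lambda>z. f (z [])) \<circ> (\<lambda>x. restrict (\<lambda>w. x w) {[]}))
      T ((\<lambda>z. g (?g i z, ?g j z)) \<circ> (\<lambda>x. restrict (\<lambda>w. x w) ?K))"
    by (rule \<Omega>.indep_var_compose[OF indep_root]) measurable
  moreover have "((\<lambda>z. g (?g i z, ?g j z)) \<circ> (\<lambda>x. restrict (\<lambda>w. x w) ?K)) x
      = g (subtree [i] x, subtree [j] x)" if "x \<in> space \<Omega>" for x
    using that by (simp only: comp_def graft_restrict ij)
  moreover have "((\<lambda>z. f (z [])) \<circ> (\<lambda>x. restrict (\<lambda>w. x w) {[]})) = (\<lambda>x. f (x []))" by auto
  ultimately show ?thesis
    unfolding \<Omega>.indep_var_distribution_eq by (simp cong: measurable_cong distr_cong)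
qed

lemma nn_integral_root_subtrees:
  assumes ij: "i < b" "j < b" "i \<noteq> j"
    and [measurable]: "f \<in> borel_measurable N" "g \<in> borel_measurable \<Omega>" "h \<in> borel_measurable \<Omega>"
  shows "(\<integral>\<^sup>+x. f (x []) * (g (subtree [i] x) * h (subtree [j] x)) \<partial>\<Omega>)
    = (\<integral>\<^sup>+a. f a \<partial>N) * ((\<integral>\<^sup>+x. g x \<partial>\<Omega>) * (\<integral>\<^sup>+x. h x \<partial>\<Omega>))"
proof -
  have [measurable]: "subtree [i] \<in> \<Omega> \<rightarrow>\<^sub>M \<Omega>" "subtree [j] \<in> \<Omega> \<rightarrow>\<^sub>M \<Omega>" using ij by auto
  have "(\<integral>\<^sup>+x. f (x []) * (g (subtree [i] x) * h (subtree [j] x)) \<partial>\<Omega>)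
      = (\<integral>\<^sup>+a. (\<integral>\<^sup>+x. f a * (g (subtree [i] x) * h (subtree [j] x)) \<partial>\<Omega>) \<partial>N)"
    using nn_integral_root_split[OF ij(1,2), of "\<lambda>(a, y, z). f a * (g y * h z)"] by simp
  also have "\<dots> = (\<integral>\<^sup>+a. f a \<partial>N) * (\<integral>\<^sup>+x. g (subtree [i] x) * h (subtree [j] x) \<partial>\<Omega>)"
    by (simp add: nn_integral_cmult nn_integral_multc)
  also have "(\<integral>\<^sup>+x. g (subtree [i] x) * h (subtree [j] x) \<partial>\<Omega>)
      = (\<integral>\<^sup>+x. g (subtree [i] x) \<partial>\<Omega>) * (\<integral>\<^sup>+x. h (subtree [j] x) \<partial>\<Omega>)"
    by (rule \<Omega>.indep_var_nn_integral_mult[OF indep_subtrees[OF ij]]) auto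
  finally show ?thesis using ij by (simp add: nn_integral_subtree)
qed

lemma nn_integral_root_subtree:
  assumes i: "i < b"
    and [measurable]: "f \<in> borel_measurable N" "g \<in> borel_measurable \<Omega>"
  shows "(\<integral>\<^sup>+x. f (x []) * g (subtree [i] x) \<partial>\<Omega>) = (\<integral>\<^sup>+a. f a \<partial>N) * (\<integral>\<^sup>+x. g x \<partial>\<Omega>)"
proof -
  define j where "j = (if i = 0 then 1 else 0 :: nat)"
  have "j < b" "i \<noteq> j" using b2 by (auto simp: j_def)
  from nn_integral_root_subtrees[OF i this, of f g "\<lambda>_. 1"] show ?thesis
    by (simp add: \<Omega>.emeasure_space_1)
qed

lemma measurable_total_mass [measurable]: "total_mass b n \<in> borel_measurable \<Omega>"
proof (induction n)
  case 0 then show ?case by simp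
next
  case (Suc n)
  note Suc.IH [measurable]
  have "(\<lambda>x. \<Sum>i<b. x [] i * total_mass b n (subtree [i] x)) \<in> borel_measurable \<Omega>"
    by (intro borel_measurable_sum borel_measurable_times
        measurable_compose[OF measurable_vertex measurable_entry]
        measurable_compose[OF measurable_subtree Suc.IH]) auto
  then show ?case by (simp cong: measurable_cong)
qed

lemma measurable_mass_step [measurable]: "mass_step b n \<in> borel_measurable \<Omega>"
  unfolding mass_step_def by (intro borel_measurable_diff) auto

lemma measurable_vertex_entry [measurable]:
  "w \<in> words b \<Longrightarrow> i < b \<Longrightarrow> (\<lambda>x. x w i) \<in> borel_measurable \<Omega>"
  by (rule measurable_compose[OF measurable_vertex measurable_entry])

end

section \<open>Decay of the moments of the increments\<close>

lemma geometric_recursion: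
  fixes a :: "nat \<Rightarrow> ennreal"
  assumes a0: "a 0 < \<infinity>" and m: "0 \<le> m" "m < 1" and B: "0 \<le> B" and \<theta>: "0 < \<theta>" "\<theta> < 1"
    and step: "\<And>n. a (Suc n) \<le> ennreal m * a n + ennreal (B * \<theta> ^ n)"
  obtains C \<eta> where "0 \<le> C" "0 < \<eta>" "\<eta> < 1" "\<And>n. a n \<le> ennreal (C * \<eta> ^ n)"
proof -
  define \<eta> where "\<eta> = (1 + max m \<theta>) / 2"
  have \<eta>: "m < \<eta>" "\<theta> < \<eta>" "0 < \<eta>" "\<eta> < 1" using m \<theta> by (auto simp: \<eta>_def max_def)
  define C where "C = enn2real (a 0) + B / (\<eta> - m)"
  have C: "0 \<le> C" "B \<le> C * (\<eta> - m)"
    using B \<eta> by (auto simp: C_def distrib_right)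
  have "a n \<le> ennreal (C * \<eta> ^ n)" for n
  proof (induction n)
    case 0
    have "a 0 = ennreal (enn2real (a 0))" using a0 by simp
    also have "\<dots> \<le> ennreal C" using B \<eta> by (intro ennreal_leI) (simp add: C_def)
    finally show ?case by simp
  next
    case (Suc n)
    have "a (Suc n) \<le> ennreal m * ennreal (C * \<eta> ^ n) + ennreal (B * \<theta> ^ n)"
      using step[of n] Suc.IH by (meson add_right_mono mult_left_mono order_trans zero_le)
    also have "\<dots> = ennreal (m * (C * \<eta> ^ n) + B * \<theta> ^ n)"
      using m C \<eta> B \<theta> by (simp add: ennreal_mult ennreal_plus)
    also have "\<dots> \<le> ennreal (C * \<eta> ^ Suc n)"
    proof (rule ennreal_leI)
      have "B * \<theta> ^ n \<le> C * (\<eta> - m) * \<eta> ^ n"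
        using B C \<theta> \<eta> by (intro mult_mono power_mono) auto
      then show "m * (C * \<eta> ^ n) + B * \<theta> ^ n \<le> C * \<eta> ^ Suc n" by (simp add: algebra_simps)
    qed
    finally show ?case .
  qed
  then show thesis using that C(1) \<eta>(3,4) by blast
qed

lemma measurable_cnj [measurable]: "cnj \<in> borel_measurable borel"
  by (intro borel_measurable_continuous_onI continuous_intros)

context cascade_law
begin

definition vertex_moment :: "nat \<Rightarrow> ennreal" where
  "vertex_moment k = (\<integral>\<^sup>+a. (\<Sum>i<b. ennreal (norm (a i) ^ k)) \<partial>N)"

definition step_moment :: "nat \<Rightarrow> nat \<Rightarrow> ennreal" where
  "step_moment k n = (\<integral>\<^sup>+x. ennreal (norm (mass_step b n x) ^ k) \<partial>\<Omega>)"

lemma AE_root_bounded: "AE x in \<Omega>. \<forall>i<b. norm (x [] i) \<le> 1"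
  by (rule AE_vertex[OF Nil_in_words bounded])

lemma AE_subtrees:
  assumes "AE x in \<Omega>. P x"
  shows "AE x in \<Omega>. \<forall>i<b. P (subtree [i] x)"
proof -
  have "AE x in \<Omega>. \<forall>i\<in>{..<b}. P (subtree [i] x)"
    by (rule AE_finite_allI) (auto intro!: AE_subtree assms)
  then show ?thesis by (simp add: Ball_def)
qed

lemma mass_step_bounded: "\<exists>K. AE x in \<Omega>. norm (mass_step b n x) \<le> K"
proof (induction n)
  case 0
  have "AE x in \<Omega>. norm (mass_step b 0 x) \<le> real b + 1"
    using AE_root_bounded
  proof eventually_elim
    case (elim x)
    have "norm (\<Sum>i<b. x [] i) \<le> real b"
      using sum_norm_le[of "{..<b}" "x []" "\<lambda>_. 1"] elim by simp
    then show ?case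
      using norm_triangle_ineq4[of "\<Sum>i<b. x [] i" 1] by (simp add: mass_step_0)
  qed
  then show ?case by blast
next
  case (Suc n)
  then obtain K where K: "AE x in \<Omega>. norm (mass_step b n x) \<le> K" by blast
  have "AE x in \<Omega>. norm (mass_step b (Suc n) x) \<le> real b * K"
    using AE_root_bounded AE_subtrees[OF K]
  proof eventually_elim
    case (elim x)
    have "norm (\<Sum>i<b. x [] i * mass_step b n (subtree [i] x)) \<le> (\<Sum>i<b. K)"
    proof (rule sum_norm_le)
      fix i assume "i \<in> {..<b}"
      then have "norm (x [] i) \<le> 1" "norm (mass_step b n (subtree [i] x)) \<le> K" using elim by auto
      then have "norm (x [] i) * norm (mass_step b n (subtree [i] x)) \<le> 1 * K"
        by (intro mult_mono) auto
      then show "norm (x [] i * mass_step b n (subtree [i] x)) \<le> K" by (simp add: norm_mult)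
    qed
    then show ?case by (simp add: mass_step_Suc)
  qed
  then show ?case by blast
qed

lemma integrable_mass_step_mult:
  assumes [measurable]: "f \<in> borel_measurable \<Omega>" and f: "\<And>x. norm (f x) = norm (mass_step b n x) ^ k"
  shows "integrable \<Omega> (f :: _ \<Rightarrow> 'w::{banach, second_countable_topology})"
proof -
  obtain K where K: "AE x in \<Omega>. norm (mass_step b n x) \<le> K" using mass_step_bounded by blast
  show ?thesis
  proof (rule \<Omega>.integrable_const_bound)
    show "AE x in \<Omega>. norm (f x) \<le> K ^ k"
      using K by eventually_elim (auto simp: f intro: power_mono)
  qed simp
qed

lemma integrable_mass_step: "integrable \<Omega> (mass_step b n)"
  by (rule integrable_mass_step_mult[where k = 1]) auto

lemma step_moment_finite: "step_moment k n < \<infinity>"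
  using integrable_mass_step_mult[of "\<lambda>x. norm (mass_step b n x) ^ k" n k]
  unfolding step_moment_def by (auto simp: integrable_iff_bounded)

lemma integrable_entry: "i < b \<Longrightarrow> integrable N (\<lambda>a. a i)"
  by (rule N.integrable_const_bound[where B = 1]) (use bounded in \<open>auto elim: eventually_mono\<close>)

lemma integrable_subtree:
  "w \<in> words b \<Longrightarrow> integrable \<Omega> f \<Longrightarrow> integrable \<Omega> (\<lambda>x. f (subtree w x) :: complex)"
  by (rule integrable_distr[OF measurable_subtree]) (simp_all add: distr_subtree)

lemma integrable_vertex:
  "w \<in> words b \<Longrightarrow> integrable N f \<Longrightarrow> integrable \<Omega> (\<lambda>x. f (x w) :: complex)"
  by (rule integrable_distr[OF measurable_vertex]) (simp_all add: distr_vertex)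

lemma integral_mass_step: "(\<integral>x. mass_step b n x \<partial>\<Omega>) = 0"
proof (induction n)
  case 0
  have "(\<integral>x. (\<Sum>i<b. x [] i) - 1 \<partial>\<Omega>) = (\<integral>a. (\<Sum>i<b. a i) - 1 \<partial>N)"
    by (rule integral_vertex) auto
  also have "\<dots> = 0"
    using integrable_entry by (subst Bochner_Integration.integral_diff) (auto simp: mean N.prob_space)
  finally show ?case by (simp add: mass_step_0)
next
  case (Suc n)
  have ind: "\<Omega>.indep_var borel (\<lambda>x. x [] i) borel (\<lambda>x. mass_step b n (subtree [i] x))" if "i < b" for i
    using indep_root_subtrees[OF that that, of "\<lambda>a. a i" borel "\<lambda>z. mass_step b n (fst z)" borel] that
    by simp
  have int: "integrable \<Omega> (\<lambda>x. x [] i)" "integrable \<Omega> (\<lambda>x. mass_step b n (subtree [i] x))"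
    if "i < b" for i
    using integrable_vertex[OF Nil_in_words integrable_entry[OF that]]
      integrable_subtree[of "[i]", OF _ integrable_mass_step] that by auto
  have zero: "(\<integral>x. x [] i * mass_step b n (subtree [i] x) \<partial>\<Omega>) = 0" if "i < b" for i
    using \<Omega>.indep_var_lebesgue_integral[OF ind int] integral_subtree[of "[i]" "mass_step b n"] that Suc.IH
    by simp
  have "(\<integral>x. mass_step b (Suc n) x \<partial>\<Omega>) = (\<Sum>i<b. \<integral>x. x [] i * mass_step b n (subtree [i] x) \<partial>\<Omega>)"
    unfolding mass_step_Suc
    by (rule Bochner_Integration.integral_sum) (use \<Omega>.indep_var_integrable[OF ind int] in auto)
  then show ?case using zero by simp
qed

lemma integral_mult_cnj:
  "(\<integral>x. f x * cnj (f x) \<partial>M) = of_real (\<integral>x. norm (f x :: complex) ^ 2 \<partial>M)"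
  unfolding complex_norm_square[symmetric] by (rule integral_complex_of_real)

lemma nn_integral_eq_of_cnj:
  assumes "integrable M (\<lambda>x. norm (f x :: complex) ^ 2)" "(\<integral>x. f x * cnj (f x) \<partial>M) = of_real c"
  shows "(\<integral>\<^sup>+x. ennreal (norm (f x) ^ 2) \<partial>M) = ennreal c"
proof -
  have "(\<integral>x. norm (f x) ^ 2 \<partial>M) = c"
    using assms(2) unfolding integral_mult_cnj of_real_eq_iff .
  then show ?thesis using nn_integral_eq_integral[OF assms(1)] by simp
qed

text \<open>In the second moment the mixed terms vanish, because increments of different subtrees are
  independent of each other and of the root, and centred.\<close>

lemma step_moment_2_Suc: "step_moment 2 (Suc n) = vertex_moment 2 * step_moment 2 n"
proof -
  let ?D = "\<lambda>x. mass_step b n x"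
  let ?R = "\<integral>x. norm (?D x) ^ 2 \<partial>\<Omega>"
  let ?m = "\<Sum>i<b. \<integral>a. norm (a i) ^ 2 \<partial>N"
  have int_a: "integrable N (\<lambda>a. a i * cnj (a j))" if "i < b" "j < b" for i j
  proof (rule N.integrable_const_bound[where B = 1])
    show "(\<lambda>a. a i * cnj (a j)) \<in> borel_measurable N"
      using that by measurable
  qed (use bounded that in \<open>auto elim!: eventually_mono simp: norm_mult intro!: mult_le_one\<close>)
  have int_a2: "integrable N (\<lambda>a. norm (a i) ^ 2)" if "i < b" for i
    by (rule N.integrable_const_bound[where B = 1])
      (use bounded that in \<open>auto elim!: eventually_mono intro!: power_le_one\<close>)
  have int_R: "integrable \<Omega> (\<lambda>x. norm (?D x) ^ 2)"
    by (rule integrable_mass_step_mult[where k = 2]) auto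
  have sub [measurable]: "subtree [i] \<in> \<Omega> \<rightarrow>\<^sub>M \<Omega>" if "i < b" for i using that by simp
  have int_cnj: "integrable \<Omega> (\<lambda>x. cnj (?D x))"
    by (rule integrable_mass_step_mult[where k = 1]) auto
  have DD: "integrable \<Omega> (\<lambda>x. ?D (subtree [i] x) * cnj (?D (subtree [j] x)))
      \<and> (\<integral>x. ?D (subtree [i] x) * cnj (?D (subtree [j] x)) \<partial>\<Omega>) = (if i = j then of_real ?R else 0)"
    if ij: "i < b" "j < b" for i j
  proof (cases "i = j")
    case True
    have "integrable \<Omega> (\<lambda>x. ?D x * cnj (?D x))"
      by (rule integrable_mass_step_mult[where k = 2]) (auto simp: norm_mult power2_eq_square)
    then show ?thesis
      using True ij integrable_subtree[of "[i]" "\<lambda>x. ?D x * cnj (?D x)"]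
        integral_subtree[of "[i]" "\<lambda>x. ?D x * cnj (?D x)"] integral_mult_cnj[where f = ?D and M = \<Omega>] by simp
  next
    case False
    have "\<Omega>.indep_var borel (?D \<circ> subtree [i]) borel ((\<lambda>x. cnj (?D x)) \<circ> subtree [j])"
      by (rule \<Omega>.indep_var_compose[OF indep_subtrees[OF ij False]]) auto
    then have ind: "\<Omega>.indep_var borel (\<lambda>x. ?D (subtree [i] x)) borel (\<lambda>x. cnj (?D (subtree [j] x)))"
      by (simp add: comp_def)
    have int: "integrable \<Omega> (\<lambda>x. ?D (subtree [i] x))" "integrable \<Omega> (\<lambda>x. cnj (?D (subtree [j] x)))"
      using integrable_subtree[of "[i]", OF _ integrable_mass_step] integrable_subtree[of "[j]", OF _ int_cnj] ij by auto
    show ?thesis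
      using \<Omega>.indep_var_lebesgue_integral[OF ind int] \<Omega>.indep_var_integrable[OF ind int]
        integral_subtree[of "[i]" ?D] integral_mass_step[of n] ij False by simp
  qed
  have T: "integrable \<Omega> (\<lambda>x. (x [] i * cnj (x [] j)) * (?D (subtree [i] x) * cnj (?D (subtree [j] x))))
      \<and> (\<integral>x. (x [] i * cnj (x [] j)) * (?D (subtree [i] x) * cnj (?D (subtree [j] x))) \<partial>\<Omega>)
        = (if i = j then of_real (\<integral>a. norm (a i) ^ 2 \<partial>N) * of_real ?R else 0)"
    if ij: "i < b" "j < b" for i j
  proof -
    have ind: "\<Omega>.indep_var borel (\<lambda>x. x [] i * cnj (x [] j))
        borel (\<lambda>x. ?D (subtree [i] x) * cnj (?D (subtree [j] x)))"
      using indep_root_subtrees[OF ij, of "\<lambda>a. a i * cnj (a j)" borel "\<lambda>(y, z). ?D y * cnj (?D z)" borel] ij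
      by simp
    have int: "integrable \<Omega> (\<lambda>x. x [] i * cnj (x [] j))"
      by (rule integrable_vertex[OF Nil_in_words int_a[OF ij]])
    have E: "(\<integral>x. x [] i * cnj (x [] j) \<partial>\<Omega>) = (\<integral>a. a i * cnj (a j) \<partial>N)"
      by (rule integral_vertex) (use ij in auto)
    show ?thesis
      using \<Omega>.indep_var_lebesgue_integral[OF ind int] \<Omega>.indep_var_integrable[OF ind int] DD[OF ij] E
        integral_mult_cnj[where f = "\<lambda>a. a i" and M = N] by auto
  qed
  have "(\<integral>x. mass_step b (Suc n) x * cnj (mass_step b (Suc n) x) \<partial>\<Omega>)
      = (\<integral>x. (\<Sum>i<b. \<Sum>j<b. (x [] i * cnj (x [] j)) * (?D (subtree [i] x) * cnj (?D (subtree [j] x)))) \<partial>\<Omega>)"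
    by (simp add: mass_step_Suc sum_product cnj_sum mult_ac)
  also have "\<dots> = (\<Sum>i<b. \<Sum>j<b. if i = j then of_real (\<integral>a. norm (a i) ^ 2 \<partial>N) * of_real ?R else 0)"
    using T by (subst Bochner_Integration.integral_sum)
      (auto intro!: sum.cong Bochner_Integration.integrable_sum simp: Bochner_Integration.integral_sum)
  also have "\<dots> = of_real (?m * ?R)" by (simp add: sum_distrib_right)
  finally have "step_moment 2 (Suc n) = ennreal (?m * ?R)"
    unfolding step_moment_def
    by (intro nn_integral_eq_of_cnj integrable_mass_step_mult[where k = 2]) auto
  also have "\<dots> = ennreal ?m * ennreal ?R" by (intro ennreal_mult) (auto intro!: sum_nonneg)
  also have "ennreal ?R = step_moment 2 n"
    unfolding step_moment_def using int_R by (simp add: nn_integral_eq_integral)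
  also have "ennreal ?m = vertex_moment 2"
  proof -
    have "vertex_moment 2 = (\<Sum>i<b. \<integral>\<^sup>+a. ennreal (norm (a i) ^ 2) \<partial>N)"
      unfolding vertex_moment_def by (rule nn_integral_sum) simp
    also have "\<dots> = (\<Sum>i<b. ennreal (\<integral>a. norm (a i) ^ 2 \<partial>N))"
      using int_a2 by (intro sum.cong refl nn_integral_eq_integral) auto
    finally show ?thesis by (simp add: sum_ennreal)
  qed
  finally show ?thesis .
qed

text \<open>As the weights are at most one, each mixed term of the \<open>(k + 1)\<close>-st moment is at most the product
  of a moment of order \<open>k\<close> and one of order \<open>1\<close> of two independent subtrees.\<close>

lemma step_moment_Suc_le:
  "step_moment (Suc k) (Suc n) \<le> vertex_moment (Suc k) * step_moment (Suc k) n
    + of_nat b * (of_nat (b - 1) * (ennreal (real (Suc k) * real b ^ k) * (step_moment k n * step_moment 1 n)))"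
proof -
  let ?D = "\<lambda>i x. norm (mass_step b n (subtree [i] x))"
  let ?c = "real (Suc k) * real b ^ k"
  have [measurable]: "subtree [i] \<in> \<Omega> \<rightarrow>\<^sub>M \<Omega>" if "i < b" for i using that by simp
  have meas1: "(\<lambda>x. ennreal (norm (x [] i) ^ Suc k) * ennreal (?D i x ^ Suc k)) \<in> borel_measurable \<Omega>"
    if "i < b" for i using that by measurable
  have meas2: "(\<lambda>x. ennreal ?c * (ennreal (?D i x ^ k) * ennreal (?D j x))) \<in> borel_measurable \<Omega>"
    if "i < b" "j < b" for i j using that by measurable
  have "AE x in \<Omega>. ennreal (norm (mass_step b (Suc n) x) ^ Suc k)
      \<le> (\<Sum>i<b. ennreal (norm (x [] i) ^ Suc k) * ennreal (?D i x ^ Suc k))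
        + (\<Sum>i<b. \<Sum>j\<in>{..<b} - {i}. ennreal ?c * (ennreal (?D i x ^ k) * ennreal (?D j x)))"
    using AE_root_bounded
  proof eventually_elim
    case (elim x)
    let ?z = "\<lambda>i. norm (x [] i) * ?D i x"
    have z: "?z i \<le> ?D i x" if "i < b" for i using elim that by (simp add: mult_left_le_one_le)
    have "norm (mass_step b (Suc n) x) \<le> (\<Sum>i<b. ?z i)"
      unfolding mass_step_Suc by (rule sum_norm_le) (simp add: norm_mult)
    then have "norm (mass_step b (Suc n) x) ^ Suc k \<le> (\<Sum>i<b. ?z i) ^ Suc k" by (rule power_mono) simp
    also have "\<dots> \<le> (\<Sum>i<b. ?z i ^ Suc k) + ?c * (\<Sum>i<b. \<Sum>j\<in>{..<b} - {i}. ?z i ^ k * ?z j)"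
      by (rule power_sum_le) (use b2 in auto)
    also have "\<dots> \<le> (\<Sum>i<b. ?z i ^ Suc k) + ?c * (\<Sum>i<b. \<Sum>j\<in>{..<b} - {i}. ?D i x ^ k * ?D j x)"
      by (intro add_left_mono mult_left_mono sum_mono mult_mono power_mono z) auto
    finally have "norm (mass_step b (Suc n) x) ^ Suc k
        \<le> (\<Sum>i<b. norm (x [] i) ^ Suc k * ?D i x ^ Suc k)
          + (\<Sum>i<b. \<Sum>j\<in>{..<b} - {i}. ?c * (?D i x ^ k * ?D j x))"
      by (simp add: power_mult_distrib sum_distrib_left del: power_Suc of_nat_Suc)
    then have "ennreal (norm (mass_step b (Suc n) x) ^ Suc k)
        \<le> ennreal ((\<Sum>i<b. norm (x [] i) ^ Suc k * ?D i x ^ Suc k)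
          + (\<Sum>i<b. \<Sum>j\<in>{..<b} - {i}. ?c * (?D i x ^ k * ?D j x)))"
      by (rule ennreal_leI)
    also have "\<dots> = (\<Sum>i<b. ennreal (norm (x [] i) ^ Suc k) * ennreal (?D i x ^ Suc k))
        + (\<Sum>i<b. \<Sum>j\<in>{..<b} - {i}. ennreal ?c * (ennreal (?D i x ^ k) * ennreal (?D j x)))"
      by (subst ennreal_plus)
        (auto simp: ennreal_mult sum_nonneg simp del: power_Suc of_nat_Suc sum_ennreal
          simp flip: sum_ennreal intro!: sum_nonneg)
    finally show ?case .
  qed
  then have "step_moment (Suc k) (Suc n)
      \<le> (\<integral>\<^sup>+x. (\<Sum>i<b. ennreal (norm (x [] i) ^ Suc k) * ennreal (?D i x ^ Suc k))
        + (\<Sum>i<b. \<Sum>j\<in>{..<b} - {i}. ennreal ?c * (ennreal (?D i x ^ k) * ennreal (?D j x))) \<partial>\<Omega>)"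
    unfolding step_moment_def by (rule nn_integral_mono_AE)
  also have "\<dots> = (\<Sum>i<b. \<integral>\<^sup>+x. ennreal (norm (x [] i) ^ Suc k) * ennreal (?D i x ^ Suc k) \<partial>\<Omega>)
      + (\<Sum>i<b. \<Sum>j\<in>{..<b} - {i}. \<integral>\<^sup>+x. ennreal ?c * (ennreal (?D i x ^ k) * ennreal (?D j x)) \<partial>\<Omega>)"
  proof -
    let ?u = "\<lambda>i x. ennreal (norm (x [] i) ^ Suc k) * ennreal (?D i x ^ Suc k)"
    let ?v = "\<lambda>i j x. ennreal ?c * (ennreal (?D i x ^ k) * ennreal (?D j x))"
    have u: "?u i \<in> borel_measurable \<Omega>" if "i \<in> {..<b}" for i
      by (rule meas1) (use that in simp)
    have v: "?v i j \<in> borel_measurable \<Omega>" if "i \<in> {..<b}" "j \<in> {..<b} - {i}" for i j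
      by (rule meas2) (use that in auto)
    have v': "(\<lambda>x. \<Sum>j\<in>{..<b} - {i}. ?v i j x) \<in> borel_measurable \<Omega>" if "i \<in> {..<b}" for i
      by (rule borel_measurable_sum) (rule v[OF that])
    have "(\<integral>\<^sup>+x. (\<Sum>i<b. ?u i x) + (\<Sum>i<b. \<Sum>j\<in>{..<b} - {i}. ?v i j x) \<partial>\<Omega>)
        = (\<integral>\<^sup>+x. (\<Sum>i<b. ?u i x) \<partial>\<Omega>) + (\<integral>\<^sup>+x. (\<Sum>i<b. \<Sum>j\<in>{..<b} - {i}. ?v i j x) \<partial>\<Omega>)"
      by (rule nn_integral_add) (rule borel_measurable_sum, (rule u v'), assumption)+
    also have "(\<integral>\<^sup>+x. (\<Sum>i<b. ?u i x) \<partial>\<Omega>) = (\<Sum>i<b. \<integral>\<^sup>+x. ?u i x \<partial>\<Omega>)"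
      by (rule nn_integral_sum) (rule u)
    also have "(\<integral>\<^sup>+x. (\<Sum>i<b. \<Sum>j\<in>{..<b} - {i}. ?v i j x) \<partial>\<Omega>)
        = (\<Sum>i<b. \<integral>\<^sup>+x. (\<Sum>j\<in>{..<b} - {i}. ?v i j x) \<partial>\<Omega>)"
      by (rule nn_integral_sum) (rule v')
    also have "\<dots> = (\<Sum>i<b. \<Sum>j\<in>{..<b} - {i}. \<integral>\<^sup>+x. ?v i j x \<partial>\<Omega>)"
      by (intro sum.cong refl nn_integral_sum) (rule v)
    finally show ?thesis .
  qed
  also have "(\<Sum>i<b. \<integral>\<^sup>+x. ennreal (norm (x [] i) ^ Suc k) * ennreal (?D i x ^ Suc k) \<partial>\<Omega>)
      = (\<Sum>i<b. (\<integral>\<^sup>+a. ennreal (norm (a i) ^ Suc k) \<partial>N) * step_moment (Suc k) n)"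
    unfolding step_moment_def
    by (intro sum.cong refl nn_integral_root_subtree[where g = "\<lambda>x. ennreal (norm (mass_step b n x) ^ Suc k)"]) auto
  also have "\<dots> = vertex_moment (Suc k) * step_moment (Suc k) n"
    unfolding vertex_moment_def by (subst nn_integral_sum) (auto simp: sum_distrib_right)
  also have "(\<Sum>i<b. \<Sum>j\<in>{..<b} - {i}. \<integral>\<^sup>+x. ennreal ?c * (ennreal (?D i x ^ k) * ennreal (?D j x)) \<partial>\<Omega>)
      = (\<Sum>i<b. \<Sum>j\<in>{..<b} - {i}. ennreal ?c * (step_moment k n * step_moment 1 n))"
  proof (intro sum.cong refl)
    fix i j assume "i \<in> {..<b}" "j \<in> {..<b} - {i}"
    then show "(\<integral>\<^sup>+x. ennreal ?c * (ennreal (?D i x ^ k) * ennreal (?D j x)) \<partial>\<Omega>)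
        = ennreal ?c * (step_moment k n * step_moment 1 n)"
      using nn_integral_root_subtrees[of i j "\<lambda>_. ennreal ?c" "\<lambda>x. ennreal (norm (mass_step b n x) ^ k)"
          "\<lambda>x. ennreal (norm (mass_step b n x))"]
      by (auto simp: step_moment_def N.emeasure_space_1)
  qed
  also have "\<dots> = of_nat b * (of_nat (b - 1) * (ennreal ?c * (step_moment k n * step_moment 1 n)))"
    by (simp add: card_Diff_singleton_if)
  finally show ?thesis .
qed

lemma step_moment_1_le: "step_moment 1 n \<le> 1 + step_moment 2 n"
proof -
  have "t \<le> 1 + t ^ 2" if "0 \<le> t" for t :: real
    using zero_le_power2[of "t - 1"] that by (simp add: power2_diff)
  then have "step_moment 1 n \<le> (\<integral>\<^sup>+x. 1 + ennreal (norm (mass_step b n x) ^ 2) \<partial>\<Omega>)"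
    unfolding step_moment_def
    by (intro nn_integral_mono) (auto simp flip: ennreal_1 ennreal_plus intro!: ennreal_leI)
  also have "\<dots> = 1 + step_moment 2 n"
    unfolding step_moment_def by (subst nn_integral_add) (auto simp: \<Omega>.emeasure_space_1)
  finally show ?thesis .
qed

lemma mass_step_zero:
  assumes "AE a in N. (\<Sum>i<b. a i) = 1"
  shows "AE x in \<Omega>. mass_step b n x = 0"
proof (induction n)
  case 0
  show ?case using AE_vertex[OF Nil_in_words assms] by (simp add: mass_step_0)
next
  case (Suc n)
  show ?case using AE_subtrees[OF Suc] by eventually_elim (simp add: mass_step_Suc)
qed

text \<open>Induction over the order, starting from the second moment. If the entries sum to one, there are no
  increments at all.\<close>

lemma step_moment_decay:
  assumes k: "2 \<le> k"
  obtains C \<theta> where "0 \<le> C" "0 < \<theta>" "\<theta> < 1" "\<And>n. step_moment k n \<le> ennreal (C * \<theta> ^ n)"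
proof -
  have "\<exists>C \<theta>. 0 \<le> C \<and> 0 < \<theta> \<and> \<theta> < 1 \<and> (\<forall>n. step_moment k n \<le> ennreal (C * \<theta> ^ n))"
  proof (cases "\<forall>k\<ge>2. vertex_moment k < 1")
    case False
    then have "AE a in N. (\<Sum>i<b. a i) = 1" using subcritical by (auto simp: vertex_moment_def)
    from mass_step_zero[OF this] have "step_moment k n = 0" for n
      unfolding step_moment_def using k
      by (subst nn_integral_0_iff_AE) (auto elim!: eventually_mono)
    then show ?thesis by (intro exI[of _ 0] exI[of _ "1/2"]) simp
  next
    case sub: True
    have real_moment: "\<exists>m. vertex_moment k = ennreal m \<and> 0 \<le> m \<and> m < 1" if "2 \<le> k" for k
    proof -
      have "vertex_moment k < 1" using sub that by blast
      then show ?thesis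
        by (cases "vertex_moment k") (auto simp: ennreal_less_one_iff)
    qed
    have second: "\<exists>C \<theta>. 0 \<le> C \<and> 0 < \<theta> \<and> \<theta> < 1 \<and> (\<forall>n. step_moment 2 n \<le> ennreal (C * \<theta> ^ n))"
    proof -
      obtain m where m: "vertex_moment 2 = ennreal m" "0 \<le> m" "m < 1" using real_moment[of 2] by auto
      obtain C \<eta> where "0 \<le> C" "0 < \<eta>" "\<eta> < 1" "\<And>n. step_moment 2 n \<le> ennreal (C * \<eta> ^ n)"
      proof (rule geometric_recursion[of "step_moment 2" m 0 "1/2"])
        show "step_moment 2 (Suc n) \<le> ennreal m * step_moment 2 n + ennreal (0 * (1 / 2) ^ n)" for n
          by (simp add: step_moment_2_Suc m)
      qed (use m step_moment_finite in auto)
      then show ?thesis by blast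
    qed
    then obtain C2 \<theta>2 where C2: "0 \<le> C2" "0 < \<theta>2" "\<theta>2 < 1" "\<And>n. step_moment 2 n \<le> ennreal (C2 * \<theta>2 ^ n)"
      by blast
    have first: "step_moment 1 n \<le> ennreal (1 + C2)" for n
    proof -
      have "step_moment 1 n \<le> 1 + ennreal (C2 * \<theta>2 ^ n)"
        using step_moment_1_le[of n] C2(4)[of n] by (meson add_left_mono order_trans)
      also have "\<dots> = ennreal (1 + C2 * \<theta>2 ^ n)" using C2 by simp
      also have "\<dots> \<le> ennreal (1 + C2)"
        using C2 by (intro ennreal_leI) (simp add: mult_left_le power_le_one)
      finally show ?thesis .
    qed
    obtain E where E: "0 \<le> E" "\<And>n. step_moment 1 n \<le> ennreal E"
      using first C2(1) by (metis add_nonneg_nonneg zero_le_one)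
    show ?thesis
      using k
    proof (induction k rule: dec_induct)
      case base
      then show ?case by (rule second)
    next
      case (step k)
      then obtain C \<theta> where C: "0 \<le> C" "0 < \<theta>" "\<theta> < 1" "\<And>n. step_moment k n \<le> ennreal (C * \<theta> ^ n)"
        by blast
      obtain m where m: "vertex_moment (Suc k) = ennreal m" "0 \<le> m" "m < 1"
        using real_moment[of "Suc k"] step by auto
      define B where "B = real b * (real (b - 1) * (real (Suc k) * real b ^ k * (C * E)))"
      obtain C' \<eta> where "0 \<le> C'" "0 < \<eta>" "\<eta> < 1" "\<And>n. step_moment (Suc k) n \<le> ennreal (C' * \<eta> ^ n)"
      proof (rule geometric_recursion[of "step_moment (Suc k)" m B \<theta>])
        fix n
        have "step_moment k n * step_moment 1 n \<le> ennreal (C * \<theta> ^ n) * ennreal E"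
          using C(4)[of n] E(2)[of n] by (rule mult_mono) auto
        then have "step_moment (Suc k) (Suc n) \<le> ennreal m * step_moment (Suc k) n
            + of_nat b * (of_nat (b - 1) * (ennreal (real (Suc k) * real b ^ k) * (ennreal (C * \<theta> ^ n) * ennreal E)))"
          using step_moment_Suc_le[of k n] unfolding m(1)
          by (elim order_trans[rotated] order_trans) (intro add_left_mono mult_left_mono; simp)
        also have "of_nat b * (of_nat (b - 1) * (ennreal (real (Suc k) * real b ^ k) * (ennreal (C * \<theta> ^ n) * ennreal E)))
            = ennreal (B * \<theta> ^ n)"
          using C E(1) unfolding B_def ennreal_of_nat_eq_real_of_nat
          by (simp add: ennreal_mult[symmetric] mult_ac del: of_nat_Suc)
        finally show "step_moment (Suc k) (Suc n) \<le> ennreal m * step_moment (Suc k) n + ennreal (B * \<theta> ^ n)" .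
      qed (use m C E(1) step_moment_finite in \<open>auto simp: B_def\<close>)
      then show ?case by blast
    qed
  qed
  then show thesis using that by blast
qed

end

section \<open>Almost sure bounds for all words\<close>

definition level :: "nat \<Rightarrow> nat \<Rightarrow> nat list set" where
  "level b m = {w \<in> words b. length w = m}"

lemma finite_level [simp]: "finite (level b m)"
  and card_level: "card (level b m) = b ^ m"
  using finite_lists_length_eq[of "{..<b}" m] card_lists_length_eq[of "{..<b}" m]
  by (auto simp: level_def words_def)

lemma level_Suc: "level b (Suc m) = (\<lambda>(i, w). i # w) ` ({..<b} \<times> level b m)"
  by (auto simp: level_def image_iff length_Suc_conv)

lemma sum_level_Suc:
  "(\<Sum>w\<in>level b (Suc m). f w) = (\<Sum>i<b. \<Sum>w\<in>level b m. f (i # w))"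
  by (simp add: level_Suc sum.cartesian_product sum.reindex inj_on_def case_prod_unfold)

lemma nn_integral_ennreal_cmult:
  "0 \<le> c \<Longrightarrow> g \<in> borel_measurable M \<Longrightarrow>
    (\<integral>\<^sup>+x. ennreal (c * g x) \<partial>M) = ennreal c * (\<integral>\<^sup>+x. ennreal (g x) \<partial>M)"
  by (simp add: ennreal_mult' nn_integral_cmult)

text \<open>A family of random variables indexed by words and integers is almost surely bounded as soon as
  the sum of its expectations is finite.\<close>

lemma AE_bounded_family:
  fixes f :: "nat list \<Rightarrow> nat \<Rightarrow> 'x \<Rightarrow> real"
  assumes meas: "\<And>w n. w \<in> words b \<Longrightarrow> f w n \<in> borel_measurable M"
    and C: "0 \<le> C" and \<alpha>: "0 \<le> \<alpha>" "\<alpha> < 1" and \<gamma>: "0 \<le> \<gamma>" "\<gamma> < 1"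
    and bound: "\<And>m n. (\<Sum>w\<in>level b m. \<integral>\<^sup>+x. ennreal (f w n x) \<partial>M) \<le> ennreal (C * \<alpha> ^ m * \<gamma> ^ n)"
  shows "AE x in M. \<exists>K>0. \<forall>w\<in>words b. \<forall>n. f w n x \<le> K"
proof -
  define S where "S x = (\<Sum>m. \<Sum>n. \<Sum>w\<in>level b m. ennreal (f w n x))" for x
  have in_words: "w \<in> words b" if "w \<in> level b m" for w m using that by (simp add: level_def)
  note meas [measurable]
  have m1: "(\<lambda>x. \<Sum>w\<in>level b m. ennreal (f w n x)) \<in> borel_measurable M" for m n
    by (intro borel_measurable_sum measurable_compose[OF meas measurable_ennreal] in_words)
  have m2: "(\<lambda>x. \<Sum>n. \<Sum>w\<in>level b m. ennreal (f w n x)) \<in> borel_measurable M" for m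
    by (intro borel_measurable_suminf_order m1)
  have S: "S \<in> borel_measurable M"
    unfolding S_def[abs_def] by (intro borel_measurable_suminf_order m2)
  have "(\<integral>\<^sup>+x. S x \<partial>M) = (\<Sum>m. \<Sum>n. \<Sum>w\<in>level b m. \<integral>\<^sup>+x. ennreal (f w n x) \<partial>M)"
    unfolding S_def
    by (subst nn_integral_suminf[OF m2], subst nn_integral_suminf[OF m1], subst nn_integral_sum)
      (auto intro!: measurable_compose[OF meas measurable_ennreal] in_words)
  also have "\<dots> \<le> (\<Sum>m. \<Sum>n. ennreal (C * \<alpha> ^ m * \<gamma> ^ n))"
    by (intro suminf_le bound summableI)
  also have "\<dots> = (\<Sum>m. ennreal (C * \<alpha> ^ m * (1 / (1 - \<gamma>))))"
  proof (rule arg_cong[where f = suminf], rule ext)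
    fix m
    have "(\<lambda>n. C * \<alpha> ^ m * \<gamma> ^ n) sums (C * \<alpha> ^ m * (1 / (1 - \<gamma>)))"
      using \<gamma> by (intro sums_mult geometric_sums) auto
    then show "(\<Sum>n. ennreal (C * \<alpha> ^ m * \<gamma> ^ n)) = ennreal (C * \<alpha> ^ m * (1 / (1 - \<gamma>)))"
      using C \<alpha> \<gamma> by (intro suminf_ennreal_eq) auto
  qed
  also have "\<dots> = ennreal (1 / (1 - \<alpha>) * (C * (1 / (1 - \<gamma>))))"
  proof (rule suminf_ennreal_eq)
    have "(\<lambda>m. \<alpha> ^ m * (C * (1 / (1 - \<gamma>)))) sums (1 / (1 - \<alpha>) * (C * (1 / (1 - \<gamma>))))"
      using \<alpha> by (intro sums_mult2 geometric_sums) auto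
    then show "(\<lambda>m. C * \<alpha> ^ m * (1 / (1 - \<gamma>))) sums (1 / (1 - \<alpha>) * (C * (1 / (1 - \<gamma>))))"
      by (simp add: mult_ac)
  qed (use C \<alpha> \<gamma> in simp)
  finally have "(\<integral>\<^sup>+x. S x \<partial>M) \<noteq> \<infinity>" by (auto simp: top_unique)
  then have "AE x in M. S x \<noteq> \<infinity>" by (rule nn_integral_PInf_AE[OF S])
  then show ?thesis
  proof eventually_elim
    case (elim x)
    have "f w n x \<le> enn2real (S x)" if w: "w \<in> words b" for w n
    proof -
      have "w \<in> level b (length w)" using w by (simp add: level_def)
      then have "ennreal (f w n x) \<le> (\<Sum>w\<in>level b (length w). ennreal (f w n x))"
        by (rule member_le_sum) simp_all
      also have "\<dots> \<le> (\<Sum>n. \<Sum>w\<in>level b (length w). ennreal (f w n x))"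
        using sum_le_suminf[OF summableI, of "{n}" "\<lambda>n. \<Sum>w\<in>level b (length w). ennreal (f w n x)"] by simp
      also have "\<dots> \<le> S x"
        unfolding S_def
        using sum_le_suminf[OF summableI, of "{length w}" "\<lambda>m. \<Sum>n. \<Sum>w\<in>level b m. ennreal (f w n x)"] by simp
      also have "S x = ennreal (enn2real (S x))" using elim by (simp add: less_top)
      finally show ?thesis using ennreal_le_iff[OF enn2real_nonneg] by blast
    qed
    then have "\<forall>w\<in>words b. \<forall>n. f w n x \<le> enn2real (S x) + 1" by (simp add: add_increasing2)
    then show ?case by (intro exI[of _ "enn2real (S x) + 1"]) (simp add: add_nonneg_pos)
  qed
qed

lemma AE_bounded_words:
  fixes f :: "nat list \<Rightarrow> 'x \<Rightarrow> real"
  assumes meas: "\<And>w. w \<in> words b \<Longrightarrow> f w \<in> borel_measurable M"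
    and C: "0 \<le> C" and \<alpha>: "0 \<le> \<alpha>" "\<alpha> < 1"
    and bound: "\<And>m. (\<Sum>w\<in>level b m. \<integral>\<^sup>+x. ennreal (f w x) \<partial>M) \<le> ennreal (C * \<alpha> ^ m)"
  shows "AE x in M. \<exists>K>0. \<forall>w\<in>words b. f w x \<le> K"
proof -
  have "AE x in M. \<exists>K>0. \<forall>w\<in>words b. \<forall>n. (1 / 2) ^ n * f w x \<le> K"
  proof (rule AE_bounded_family[of b "\<lambda>w n x. (1 / 2) ^ n * f w x"])
    fix m n
    have "(\<Sum>w\<in>level b m. \<integral>\<^sup>+x. ennreal ((1 / 2) ^ n * f w x) \<partial>M)
        = ennreal ((1 / 2) ^ n) * (\<Sum>w\<in>level b m. \<integral>\<^sup>+x. ennreal (f w x) \<partial>M)"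
      unfolding sum_distrib_left
      by (intro sum.cong refl nn_integral_ennreal_cmult meas) (auto simp: level_def)
    also have "\<dots> \<le> ennreal ((1 / 2) ^ n) * ennreal (C * \<alpha> ^ m)" by (intro mult_left_mono bound) simp
    also have "\<dots> = ennreal (C * \<alpha> ^ m * (1 / 2) ^ n)"
      using C \<alpha> by (subst ennreal_mult[symmetric]) (auto simp: mult_ac)
    finally show "(\<Sum>w\<in>level b m. \<integral>\<^sup>+x. ennreal ((1 / 2) ^ n * f w x) \<partial>M)
        \<le> ennreal (C * \<alpha> ^ m * (1 / 2) ^ n)" .
  qed (use meas C \<alpha> in auto)
  then show ?thesis
  proof eventually_elim
    case (elim x)
    then obtain K where K: "K > 0" "\<forall>w\<in>words b. \<forall>n. (1 / 2) ^ n * f w x \<le> K" by blast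
    have "f w x \<le> K" if "w \<in> words b" for w
      using spec[OF bspec[OF K(2) that], of 0] by simp
    then show ?case using K(1) by blast
  qed
qed

text \<open>Exponential bounds for every base \<open>q > 1\<close> follow from those for a sequence of bases.\<close>

lemma regular_familyI:
  assumes weights: "\<exists>C r. 0 < r \<and> r < 1 \<and> (\<forall>w\<in>words b. norm (path_weight x w) \<le> C * r ^ length w)"
    and steps: "\<And>j::nat. \<exists>C \<rho>. 0 < \<rho> \<and> \<rho> < 1 \<and> (\<forall>w\<in>words b. \<forall>n.
      norm (mass_step b n (subtree w x)) \<le> C * (1 + 1 / real (Suc j)) ^ length w * \<rho> ^ n)"
    and oscillation: "\<And>j::nat. \<exists>c>0. \<forall>w\<in>words b. \<exists>v\<in>words b. c / (1 + 1 / real (Suc j)) ^ length w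
      \<le> norm (path_weight (subtree w x) v * total_lim b (subtree (w @ v) x))"
    and entries: "\<And>j::nat. \<exists>c>0. \<forall>w\<in>words b. \<forall>i<b. c / (1 + 1 / real (Suc j)) ^ length w \<le> norm (x w i)"
  shows "regular_family b x"
proof -
  have base: "\<exists>j::nat. 1 + 1 / real (Suc j) \<le> q" if q: "q > 1" for q :: real
  proof -
    obtain n where "inverse (real (Suc n)) < q - 1" using reals_Archimedean[of "q - 1"] q by auto
    then show ?thesis by (intro exI[of _ n]) (simp add: inverse_eq_divide)
  qed
  have smaller: "c / q ^ m \<le> t" if "0 < c" "c / q' ^ m \<le> t" "0 < q'" "q' \<le> q" for c q q' t :: real and m :: nat
  proof -
    have "c / q ^ m \<le> c / q' ^ m" using that by (intro divide_left_mono power_mono mult_pos_pos) auto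
    then show ?thesis using that by simp
  qed
  have "\<exists>C \<rho>. 0 < \<rho> \<and> \<rho> < 1 \<and> (\<forall>w\<in>words b. \<forall>n. norm (mass_step b n (subtree w x)) \<le> C * q ^ length w * \<rho> ^ n)"
    if q: "q > 1" for q :: real
  proof -
    obtain j :: nat where j: "1 + 1 / real (Suc j) \<le> q" using base[OF q] by blast
    obtain C \<rho> where \<rho>: "0 < \<rho>" "\<rho> < 1" and C: "\<And>w n. w \<in> words b \<Longrightarrow>
        norm (mass_step b n (subtree w x)) \<le> C * (1 + 1 / real (Suc j)) ^ length w * \<rho> ^ n"
      using steps[of j] by blast
    have "0 \<le> C" using order_trans[OF norm_ge_zero C[of "[]" 0]] by simp
    then have "C * (1 + 1 / real (Suc j)) ^ length w * \<rho> ^ n \<le> C * q ^ length w * \<rho> ^ n" for w :: "nat list" and n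
      using \<rho> j by (intro mult_right_mono mult_left_mono power_mono) auto
    then show ?thesis using C \<rho> by (meson order_trans)
  qed
  moreover have "\<exists>c>0. \<forall>w\<in>words b. \<exists>v\<in>words b.
      c / q ^ length w \<le> norm (path_weight (subtree w x) v * total_lim b (subtree (w @ v) x))"
    if q: "q > 1" for q :: real
  proof -
    obtain j :: nat where j: "1 + 1 / real (Suc j) \<le> q" using base[OF q] by blast
    have pos: "0 < 1 + 1 / real (Suc j)" by (simp add: add_pos_nonneg)
    show ?thesis using oscillation[of j] smaller[OF _ _ pos j] by meson
  qed
  moreover have "\<exists>c>0. \<forall>w\<in>words b. \<forall>i<b. c / q ^ length w \<le> norm (x w i)" if q: "q > 1" for q :: real
  proof -
    obtain j :: nat where j: "1 + 1 / real (Suc j) \<le> q" using base[OF q] by blast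
    have pos: "0 < 1 + 1 / real (Suc j)" by (simp add: add_pos_nonneg)
    show ?thesis using entries[of j] smaller[OF _ _ pos j] by meson
  qed
  ultimately show ?thesis unfolding regular_family_def using weights by blast
qed

lemma exists_power_gt:
  assumes "1 < (q::real)"
  obtains k where "2 \<le> k" "real b < q ^ k"
proof -
  obtain n where n: "real b < q ^ n" using real_arch_pow[OF assms] by blast
  have "q ^ n \<le> q ^ max n 2" using assms by (intro power_increasing) auto
  then show thesis using n that[of "max n 2"] by simp
qed

lemma le_of_power_le:
  fixes t K :: real
  assumes "t ^ k \<le> K" "1 \<le> k" "0 \<le> t"
  shows "t \<le> K + 1"
proof (cases "t \<le> 1")
  case True
  have "0 \<le> K" using assms by (meson zero_le_power order_trans)
  then show ?thesis using True by simp
next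
  case False
  then have "t \<le> t ^ k" using assms self_le_power[of t k] by simp
  then show ?thesis using assms by simp
qed

context cascade_law
begin

lemma measurable_path_weight [measurable]: "w \<in> words b \<Longrightarrow> (\<lambda>x. path_weight x w) \<in> borel_measurable \<Omega>"
proof (induction w)
  case (Cons i w)
  have "(\<lambda>x. path_weight (subtree [i] x) w) \<in> borel_measurable \<Omega>"
    using Cons by (intro measurable_compose[OF measurable_subtree Cons.IH]) auto
  then show ?case using Cons.prems by simp
qed simp

lemma measurable_total_lim [measurable]: "total_lim b \<in> borel_measurable \<Omega>"
  unfolding total_lim_def by (rule borel_measurable_lim_metric) simp

lemma sum_weight_moment:
  "(\<Sum>w\<in>level b m. \<integral>\<^sup>+x. ennreal (norm (path_weight x w) ^ k) \<partial>\<Omega>) = vertex_moment k ^ m"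
proof (induction m)
  case 0
  have "level b 0 = {[]}" by (auto simp: level_def)
  then show ?case by (simp add: \<Omega>.emeasure_space_1)
next
  case (Suc m)
  have "(\<integral>\<^sup>+x. ennreal (norm (path_weight x (i # w)) ^ k) \<partial>\<Omega>)
      = (\<integral>\<^sup>+a. ennreal (norm (a i) ^ k) \<partial>N) * (\<integral>\<^sup>+x. ennreal (norm (path_weight x w) ^ k) \<partial>\<Omega>)"
    if "i < b" "w \<in> level b m" for i w
    using that nn_integral_root_subtree[of i "\<lambda>a. ennreal (norm (a i) ^ k)" "\<lambda>x. ennreal (norm (path_weight x w) ^ k)"]
    by (simp add: level_def norm_mult power_mult_distrib ennreal_mult)
  then have "(\<Sum>w\<in>level b (Suc m). \<integral>\<^sup>+x. ennreal (norm (path_weight x w) ^ k) \<partial>\<Omega>)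
      = (\<Sum>i<b. \<Sum>w\<in>level b m. (\<integral>\<^sup>+a. ennreal (norm (a i) ^ k) \<partial>N)
          * (\<integral>\<^sup>+x. ennreal (norm (path_weight x w) ^ k) \<partial>\<Omega>))"
    unfolding sum_level_Suc by (intro sum.cong refl) simp
  also have "\<dots> = (\<Sum>i<b. \<integral>\<^sup>+a. ennreal (norm (a i) ^ k) \<partial>N) * vertex_moment k ^ m"
    unfolding Suc.IH[symmetric] sum_product ..
  also have "(\<Sum>i<b. \<integral>\<^sup>+a. ennreal (norm (a i) ^ k) \<partial>N) = vertex_moment k"
    unfolding vertex_moment_def by (rule nn_integral_sum[symmetric]) simp
  finally show ?case by simp
qed

text \<open>The \<open>k\<close>-th moments of all weights of length \<open>m\<close> sum up to \<open>vertex_moment k ^ m\<close>; any \<open>r\<close> with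
  \<open>vertex_moment k < r\<^sup>k < 1\<close> serves as the rate.\<close>

lemma AE_weights_decay:
  "AE x in \<Omega>. \<exists>C r. 0 < r \<and> r < 1 \<and> (\<forall>w\<in>words b. norm (path_weight x w) \<le> C * r ^ length w)"
proof -
  obtain k where k: "1 \<le> k" "vertex_moment k < 1"
  proof -
    have "vertex_moment 2 < 1 \<or> (\<exists>k\<ge>1. vertex_moment k < 1)"
      using subcritical unfolding vertex_moment_def by blast
    then show thesis using that[of 2] that by auto
  qed
  then obtain m0 where m0: "vertex_moment k = ennreal m0" "0 \<le> m0" "m0 < 1"
    by (cases "vertex_moment k") (auto simp: ennreal_less_one_iff)
  define s where "s = (1 + m0) / 2"
  have s: "m0 < s" "0 < s" "s < 1" using m0 by (auto simp: s_def)
  define r where "r = root k s"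
  have rk: "r ^ k = s" using k s by (simp add: r_def)
  have r: "0 < r" "r < 1" using k s by (auto simp: r_def)
  have "AE x in \<Omega>. \<exists>K>0. \<forall>w\<in>words b. (norm (path_weight x w) / r ^ length w) ^ k \<le> K"
  proof (rule AE_bounded_words[where C = 1 and \<alpha> = "m0 / s"])
    fix m
    have "(\<Sum>w\<in>level b m. \<integral>\<^sup>+x. ennreal ((norm (path_weight x w) / r ^ length w) ^ k) \<partial>\<Omega>)
        = (\<Sum>w\<in>level b m. ennreal (1 / s ^ m) * (\<integral>\<^sup>+x. ennreal (norm (path_weight x w) ^ k) \<partial>\<Omega>))"
    proof (rule sum.cong[OF refl])
      fix w assume w: "w \<in> level b m"
      have "(norm (path_weight x w) / r ^ length w) ^ k = (1 / s ^ m) * norm (path_weight x w) ^ k"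
        for x :: "nat list \<Rightarrow> nat \<Rightarrow> complex"
        using w by (simp add: level_def power_divide rk[symmetric] mult.commute flip: power_mult)
      then show "(\<integral>\<^sup>+x. ennreal ((norm (path_weight x w) / r ^ length w) ^ k) \<partial>\<Omega>)
          = ennreal (1 / s ^ m) * (\<integral>\<^sup>+x. ennreal (norm (path_weight x w) ^ k) \<partial>\<Omega>)"
        using s w by (simp only:) (rule nn_integral_ennreal_cmult, auto simp: level_def)
    qed
    also have "\<dots> = ennreal (1 / s ^ m) * ennreal (m0 ^ m)"
      using m0 by (simp add: sum_weight_moment ennreal_power flip: sum_distrib_left)
    also have "\<dots> = ennreal (1 * (m0 / s) ^ m)"
      using s m0 by (simp add: power_divide mult_ac flip: ennreal_mult)
    finally show "(\<Sum>w\<in>level b m. \<integral>\<^sup>+x. ennreal ((norm (path_weight x w) / r ^ length w) ^ k) \<partial>\<Omega>)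
        \<le> ennreal (1 * (m0 / s) ^ m)" by simp
  qed (use s m0 in auto)
  then show ?thesis
  proof eventually_elim
    case (elim x)
    then obtain K where K: "\<And>w. w \<in> words b \<Longrightarrow> (norm (path_weight x w) / r ^ length w) ^ k \<le> K"
      by blast
    have "norm (path_weight x w) \<le> (K + 1) * r ^ length w" if "w \<in> words b" for w
      using le_of_power_le[OF K[OF that] k(1)] r by (simp add: divide_le_eq)
    then show ?case using r by blast
  qed
qed

text \<open>There are \<open>b\<^sup>m\<close> words of length \<open>m\<close>; moments of an order \<open>k\<close> with \<open>b < q\<^sup>k\<close> outweigh their
  number.\<close>

lemma AE_steps:
  assumes q: "1 < q"
  shows "AE x in \<Omega>. \<exists>C \<rho>. 0 < \<rho> \<and> \<rho> < 1 \<and>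
    (\<forall>w\<in>words b. \<forall>n. norm (mass_step b n (subtree w x)) \<le> C * q ^ length w * \<rho> ^ n)"
proof -
  obtain k where k: "2 \<le> k" "real b < q ^ k" using exists_power_gt[OF q] by blast
  obtain C \<theta> where C: "0 \<le> C" "0 < \<theta>" "\<theta> < 1" "\<And>n. step_moment k n \<le> ennreal (C * \<theta> ^ n)"
    using step_moment_decay[OF k(1)] by blast
  define \<rho> where "\<rho> = root k (sqrt \<theta>)"
  have \<rho>k: "\<rho> ^ k = sqrt \<theta>" using k C by (simp add: \<rho>_def)
  have \<rho>: "0 < \<rho>" "\<rho> < 1" using k C by (auto simp: \<rho>_def)
  have "AE x in \<Omega>. \<exists>K>0. \<forall>w\<in>words b. \<forall>n.
      (\<lambda>w n x. (norm (mass_step b n (subtree w x)) / (q ^ length w * \<rho> ^ n)) ^ k) w n x \<le> K"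
  proof (rule AE_bounded_family[where C = C and \<alpha> = "b / q ^ k" and \<gamma> = "sqrt \<theta>"])
    fix m n
    let ?c = "1 / (q ^ k) ^ m / sqrt \<theta> ^ n"
    have "(\<Sum>w\<in>level b m. \<integral>\<^sup>+x. ennreal ((norm (mass_step b n (subtree w x)) / (q ^ length w * \<rho> ^ n)) ^ k) \<partial>\<Omega>)
        = (\<Sum>w\<in>level b m. ennreal ?c * step_moment k n)"
    proof (rule sum.cong[OF refl])
      fix w assume w: "w \<in> level b m"
      have "(norm (mass_step b n y) / (q ^ length w * \<rho> ^ n)) ^ k = ?c * norm (mass_step b n y) ^ k"
        for y :: "nat list \<Rightarrow> nat \<Rightarrow> complex"
        using w by (simp add: level_def power_divide power_mult_distrib \<rho>k[symmetric] mult.commute flip: power_mult)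
      then have "(\<integral>\<^sup>+x. ennreal ((norm (mass_step b n (subtree w x)) / (q ^ length w * \<rho> ^ n)) ^ k) \<partial>\<Omega>)
          = (\<integral>\<^sup>+x. ennreal (?c * norm (mass_step b n (subtree w x)) ^ k) \<partial>\<Omega>)" by simp
      also have "\<dots> = (\<integral>\<^sup>+x. ennreal (?c * norm (mass_step b n x) ^ k) \<partial>\<Omega>)"
        using w by (intro nn_integral_subtree[where f = "\<lambda>x. ennreal (?c * norm (mass_step b n x) ^ k)"])
          (auto simp: level_def)
      also have "\<dots> = ennreal ?c * step_moment k n"
        unfolding step_moment_def using q C by (intro nn_integral_ennreal_cmult) auto
      finally show "(\<integral>\<^sup>+x. ennreal ((norm (mass_step b n (subtree w x)) / (q ^ length w * \<rho> ^ n)) ^ k) \<partial>\<Omega>)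
          = ennreal ?c * step_moment k n" .
    qed
    also have "\<dots> = ennreal (real (b ^ m)) * (ennreal ?c * step_moment k n)"
      by (simp add: card_level ennreal_of_nat_eq_real_of_nat)
    also have "\<dots> \<le> ennreal (real (b ^ m)) * (ennreal ?c * ennreal (C * \<theta> ^ n))"
      by (intro mult_left_mono C) auto
    also have "\<dots> = ennreal (real (b ^ m) * (?c * (C * \<theta> ^ n)))"
    proof -
      have "0 \<le> ?c" "0 \<le> C * \<theta> ^ n" using q C by simp_all
      then have "ennreal ?c * ennreal (C * \<theta> ^ n) = ennreal (?c * (C * \<theta> ^ n))" "0 \<le> ?c * (C * \<theta> ^ n)"
        by (simp_all only: ennreal_mult mult_nonneg_nonneg)
      then show ?thesis by (simp only: ennreal_mult of_nat_0_le_iff)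
    qed
    also have "real (b ^ m) * (?c * (C * \<theta> ^ n)) = C * (b / q ^ k) ^ m * (\<theta> / sqrt \<theta>) ^ n"
      by (simp add: power_divide)
    also have "\<theta> / sqrt \<theta> = sqrt \<theta>" using C by (simp add: real_div_sqrt)
    finally show "(\<Sum>w\<in>level b m. \<integral>\<^sup>+x. ennreal ((norm (mass_step b n (subtree w x)) / (q ^ length w * \<rho> ^ n)) ^ k) \<partial>\<Omega>)
        \<le> ennreal (C * (b / q ^ k) ^ m * sqrt \<theta> ^ n)" .
  qed (use q k C in auto)
  then show ?thesis
  proof eventually_elim
    case (elim x)
    then obtain K where K: "\<And>w n. w \<in> words b \<Longrightarrow>
        (norm (mass_step b n (subtree w x)) / (q ^ length w * \<rho> ^ n)) ^ k \<le> K" by blast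
    have "norm (mass_step b n (subtree w x)) \<le> (K + 1) * q ^ length w * \<rho> ^ n" if "w \<in> words b" for w n
      using le_of_power_le[OF K[OF that, of n]] k q \<rho> by (simp add: divide_le_eq mult.assoc)
    then show ?case using \<rho> by blast
  qed
qed

lemma AE_entries:
  assumes q: "1 < q"
  shows "AE x in \<Omega>. \<exists>c>0. \<forall>w\<in>words b. \<forall>i<b. c / q ^ length w \<le> norm (x w i)"
proof -
  obtain k where k: "2 \<le> k" "real b < q ^ k" using exists_power_gt[OF q] by blast
  define I where "I = (\<Sum>i<b. \<integral>\<^sup>+a. ennreal (1 / norm (a i) ^ k) \<partial>N)"
  have I: "I = ennreal (enn2real I)"
    unfolding I_def using inverse_moment by (simp add: less_top[symmetric])
  have "AE x in \<Omega>. \<exists>K>0. \<forall>w\<in>words b. (\<Sum>i<b. (1 / (norm (x w i) * q ^ length w)) ^ k) \<le> K"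
  proof (rule AE_bounded_words[where C = "enn2real I" and \<alpha> = "b / q ^ k"])
    fix m
    let ?c = "1 / (q ^ k) ^ m"
    have c: "0 \<le> ?c" using q by simp
    have "(\<Sum>w\<in>level b m. \<integral>\<^sup>+x. ennreal (\<Sum>i<b. (1 / (norm (x w i) * q ^ length w)) ^ k) \<partial>\<Omega>)
        = (\<Sum>w\<in>level b m. ennreal ?c * I)"
    proof (rule sum.cong[OF refl])
      fix w assume w: "w \<in> level b m"
      have "(\<Sum>i<b. (1 / (norm (a i) * q ^ length w)) ^ k) = ?c * (\<Sum>i<b. 1 / norm (a i) ^ k)"
        for a :: "nat \<Rightarrow> complex"
        using w by (simp add: level_def sum_distrib_left power_divide power_mult_distrib mult.commute flip: power_mult)
      then have "(\<integral>\<^sup>+x. ennreal (\<Sum>i<b. (1 / (norm (x w i) * q ^ length w)) ^ k) \<partial>\<Omega>)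
          = (\<integral>\<^sup>+x. ennreal (?c * (\<Sum>i<b. 1 / norm (x w i) ^ k)) \<partial>\<Omega>)" by simp
      also have "\<dots> = (\<integral>\<^sup>+a. ennreal (?c * (\<Sum>i<b. 1 / norm (a i) ^ k)) \<partial>N)"
        using w by (intro nn_integral_vertex) (auto simp: level_def)
      also have "\<dots> = ennreal ?c * (\<integral>\<^sup>+a. ennreal (\<Sum>i<b. 1 / norm (a i) ^ k) \<partial>N)"
        by (rule nn_integral_ennreal_cmult[OF c]) auto
      also have "(\<integral>\<^sup>+a. ennreal (\<Sum>i<b. 1 / norm (a i) ^ k) \<partial>N) = I"
        unfolding I_def by (subst nn_integral_sum[symmetric]) (auto simp: sum_ennreal)
      finally show "(\<integral>\<^sup>+x. ennreal (\<Sum>i<b. (1 / (norm (x w i) * q ^ length w)) ^ k) \<partial>\<Omega>)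
          = ennreal ?c * I" .
    qed
    also have "\<dots> = ennreal (real (b ^ m)) * (ennreal ?c * ennreal (enn2real I))"
      by (subst I[symmetric]) (simp add: card_level ennreal_of_nat_eq_real_of_nat)
    also have "\<dots> = ennreal (real (b ^ m) * (?c * enn2real I))"
    proof -
      have "ennreal ?c * ennreal (enn2real I) = ennreal (?c * enn2real I)" "0 \<le> ?c * enn2real I"
        using c by (simp_all only: ennreal_mult enn2real_nonneg mult_nonneg_nonneg)
      then show ?thesis by (simp only: ennreal_mult of_nat_0_le_iff)
    qed
    also have "real (b ^ m) * (?c * enn2real I) = enn2real I * (b / q ^ k) ^ m"
      by (simp add: power_divide)
    finally show "(\<Sum>w\<in>level b m. \<integral>\<^sup>+x. ennreal (\<Sum>i<b. (1 / (norm (x w i) * q ^ length w)) ^ k) \<partial>\<Omega>)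
        \<le> ennreal (enn2real I * (b / q ^ k) ^ m)" by simp
  qed (use q k in auto)
  moreover have "AE x in \<Omega>. \<forall>w\<in>words b. \<forall>i<b. x w i \<noteq> 0"
    by (rule AE_ball_countable') (auto intro: AE_vertex nonzero)
  ultimately show ?thesis
  proof eventually_elim
    case (elim x)
    then obtain K where K: "K > 0" "\<And>w. w \<in> words b \<Longrightarrow> (\<Sum>i<b. (1 / (norm (x w i) * q ^ length w)) ^ k) \<le> K"
      by blast
    have "1 / (K + 1) / q ^ length w \<le> norm (x w i)" if w: "w \<in> words b" and i: "i < b" for w i
    proof -
      have pos: "0 < norm (x w i) * q ^ length w" using elim(2) w i q by simp
      have "(1 / (norm (x w i) * q ^ length w)) ^ k \<le> (\<Sum>i<b. (1 / (norm (x w i) * q ^ length w)) ^ k)"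
        by (rule member_le_sum) (use i q in auto)
      then have "(1 / (norm (x w i) * q ^ length w)) ^ k \<le> K" using K(2)[OF w] by linarith
      then have "1 / (norm (x w i) * q ^ length w) \<le> K + 1"
        using pos k by (intro le_of_power_le[of _ k]) auto
      then have "1 \<le> (K + 1) * (norm (x w i) * q ^ length w)" using pos by (simp add: divide_le_eq)
      then show ?thesis using K(1) q by (simp add: divide_le_eq mult_ac)
    qed
    then show ?case using K(1) by (intro exI[of _ "1 / (K + 1)"]) auto
  qed
qed

text \<open>The increments are summable in mean, so the mean of the total mass passes to the limit.\<close>

lemma integral_total_lim: "(\<integral>x. total_lim b x \<partial>\<Omega>) = 1"
proof -
  obtain C \<theta> where C: "0 \<le> C" "0 < \<theta>" "\<theta> < 1" "\<And>n. step_moment 2 n \<le> ennreal (C * \<theta> ^ n)"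
    using step_moment_decay[of 2] by auto
  have first: "(\<integral>x. norm (mass_step b n x) \<partial>\<Omega>) \<le> (1 + C) * sqrt \<theta> ^ n" for n
  proof -
    let ?s = "sqrt \<theta> ^ n"
    have s: "0 < ?s" using C by simp
    \<comment> \<open>\<open>t \<le> s + t\<^sup>2 / s\<close> turns the second moment into a first moment\<close>
    have split: "t \<le> ?s + t ^ 2 / ?s" if "0 \<le> t" for t
    proof (cases "t \<le> ?s")
      case True then show ?thesis using s by (simp add: add_increasing2)
    next
      case False
      then have "t * ?s \<le> t * t" using that by (intro mult_left_mono) auto
      then have "t \<le> t ^ 2 / ?s" using s by (simp add: le_divide_eq power2_eq_square)
      then show ?thesis using s by simp
    qed
    have int2: "integrable \<Omega> (\<lambda>x. norm (mass_step b n x) ^ 2)"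
      by (rule integrable_mass_step_mult[where k = 2]) auto
    have "ennreal (\<integral>x. norm (mass_step b n x) ^ 2 \<partial>\<Omega>) \<le> ennreal (C * \<theta> ^ n)"
      using C(4)[of n] int2 by (simp add: step_moment_def nn_integral_eq_integral)
    then have m2: "(\<integral>x. norm (mass_step b n x) ^ 2 \<partial>\<Omega>) \<le> C * \<theta> ^ n" using C by simp
    have "(\<integral>x. norm (mass_step b n x) \<partial>\<Omega>) \<le> (\<integral>x. ?s + norm (mass_step b n x) ^ 2 / ?s \<partial>\<Omega>)"
      using int2 integrable_mass_step[of n] by (intro integral_mono split) auto
    also have "\<dots> = ?s + (\<integral>x. norm (mass_step b n x) ^ 2 \<partial>\<Omega>) / ?s"
      using int2 by (simp add: \<Omega>.prob_space)
    also have "\<dots> \<le> ?s + C * \<theta> ^ n / ?s" using m2 s by (intro add_left_mono divide_right_mono) auto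
    also have "C * \<theta> ^ n / ?s = C * (\<theta> / sqrt \<theta>) ^ n" by (simp add: power_divide)
    also have "\<theta> / sqrt \<theta> = sqrt \<theta>" using C by (simp add: real_div_sqrt)
    finally show ?thesis by (simp add: algebra_simps)
  qed
  have sum1: "summable (\<lambda>n. \<integral>x. norm (mass_step b n x) \<partial>\<Omega>)"
  proof (rule summable_comparison_test'[where N = 0])
    show "summable (\<lambda>n. (1 + C) * sqrt \<theta> ^ n)" using C by (intro summable_mult summable_geometric) auto
    show "norm (\<integral>x. norm (mass_step b n x) \<partial>\<Omega>) \<le> (1 + C) * sqrt \<theta> ^ n" for n
      using first[of n] by (simp add: integral_nonneg_AE)
  qed
  have ae: "AE x in \<Omega>. summable (\<lambda>n. norm (mass_step b n x))"
    using AE_steps[of 2, simplified]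
  proof eventually_elim
    case (elim x)
    then obtain K \<rho> where \<rho>: "0 < \<rho>" "\<rho> < 1"
      and K: "\<forall>w\<in>words b. \<forall>n. norm (mass_step b n (subtree w x)) \<le> K * 2 ^ length w * \<rho> ^ n" by blast
    have step: "norm (mass_step b n x) \<le> K * \<rho> ^ n" for n using bspec[OF K Nil_in_words] by simp
    show ?case
    proof (rule summable_comparison_test'[where N = 0])
      show "summable (\<lambda>n. K * \<rho> ^ n)" using \<rho> by (intro summable_mult summable_geometric) auto
    qed (simp add: step)
  qed
  have lim: "AE x in \<Omega>. total_lim b x = 1 + (\<Sum>n. mass_step b n x)"
    using ae
  proof eventually_elim
    case (elim x)
    have "(\<lambda>n. 1 + (\<Sum>k<n. mass_step b k x)) \<longlonglongrightarrow> 1 + (\<Sum>n. mass_step b n x)"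
      by (intro tendsto_add tendsto_const summable_LIMSEQ summable_norm_cancel[OF elim])
    moreover have "1 + (\<Sum>k<n. mass_step b k x) = total_mass b n x" for n
      unfolding mass_step_def by (subst sum_lessThan_telescope) simp
    ultimately show ?case unfolding total_lim_def by (simp add: limI)
  qed
  have "(\<integral>x. total_lim b x \<partial>\<Omega>) = (\<integral>x. 1 + (\<Sum>n. mass_step b n x) \<partial>\<Omega>)"
    using lim by (intro integral_cong_AE) auto
  also have "\<dots> = 1 + (\<integral>x. (\<Sum>n. mass_step b n x) \<partial>\<Omega>)"
    using integrable_suminf[OF integrable_mass_step ae sum1] by (simp add: \<Omega>.prob_space)
  also have "(\<integral>x. (\<Sum>n. mass_step b n x) \<partial>\<Omega>) = 0"
    using integral_suminf[OF integrable_mass_step ae sum1] by (simp add: integral_mass_step)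
  finally show ?thesis by simp
qed

end

section \<open>The lower tail of the oscillation\<close>

context cascade_law
begin

text \<open>No increment of the limit over a cell exceeds \<open>t\<close> in absolute value. These increments bound the
  oscillation over \<open>[0, 1]\<close> from below, and there are only countably many of them.\<close>

definition increments_le :: "real \<Rightarrow> (nat list \<Rightarrow> nat \<Rightarrow> complex) \<Rightarrow> bool" where
  "increments_le t x \<longleftrightarrow> (\<forall>v\<in>words b. norm (path_weight x v * total_lim b (subtree v x)) \<le> t)"

definition prob_increments_le :: "real \<Rightarrow> ennreal" where
  "prob_increments_le t = emeasure \<Omega> {x \<in> space \<Omega>. increments_le t x}"

lemma measurable_increments_le [measurable]:
  assumes [measurable]: "f \<in> borel_measurable K" "g \<in> K \<rightarrow>\<^sub>M \<Omega>"
  shows "Measurable.pred K (\<lambda>z. increments_le (f z) (g z))"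
  unfolding increments_le_def by measurable

lemma sets_increments_le: "{x \<in> space \<Omega>. increments_le t x} \<in> sets \<Omega>"
  by measurable

lemma prob_increments_le_nn_integral: "prob_increments_le t = (\<integral>\<^sup>+x. indicator {x. increments_le t x} x \<partial>\<Omega>)"
proof -
  have "prob_increments_le t = (\<integral>\<^sup>+x. indicator {x \<in> space \<Omega>. increments_le t x} x \<partial>\<Omega>)"
    unfolding prob_increments_le_def by (simp add: sets_increments_le)
  also have "\<dots> = (\<integral>\<^sup>+x. indicator {x. increments_le t x} x \<partial>\<Omega>)"
    by (intro nn_integral_cong) (auto simp: indicator_def)
  finally show ?thesis .
qed

lemma increments_le_mono: "increments_le s x \<Longrightarrow> s \<le> t \<Longrightarrow> increments_le t x"
  unfolding increments_le_def by force

lemma increments_le_subtree: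
  assumes "increments_le t x" "i < b" "x [] i \<noteq> 0"
  shows "increments_le (t / norm (x [] i)) (subtree [i] x)"
  unfolding increments_le_def
proof
  fix v assume "v \<in> words b"
  then have "norm (path_weight x (i # v) * total_lim b (subtree (i # v) x)) \<le> t"
    using assms unfolding increments_le_def by (metis Cons_in_words)
  then show "norm (path_weight (subtree [i] x) v * total_lim b (subtree v (subtree [i] x)))
      \<le> t / norm (x [] i)"
    using assms(3) by (simp add: norm_mult le_divide_eq mult_ac)
qed

lemma prob_increments_le_two_subtrees:
  fixes f :: "(nat \<Rightarrow> complex) \<Rightarrow> real"
  assumes f [measurable]: "f \<in> borel_measurable N"
  shows "(\<integral>\<^sup>+x. indicator {x. increments_le s (subtree [0] x) \<and> increments_le (f (x [])) (subtree [1] x)} x \<partial>\<Omega>)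
    = prob_increments_le s * (\<integral>\<^sup>+a. prob_increments_le (f a) \<partial>N)"
proof -
  have ij: "0 < b" "1 < b" using b2 by auto
  have [measurable]: "subtree [0] \<in> \<Omega> \<rightarrow>\<^sub>M \<Omega>" "subtree [1] \<in> \<Omega> \<rightarrow>\<^sub>M \<Omega>" using ij by auto
  let ?H = "\<lambda>(a, y, z). indicator {w. increments_le s w} y * indicator {w. increments_le (f a) w} z :: ennreal"
  have H: "?H \<in> borel_measurable (N \<Otimes>\<^sub>M (\<Omega> \<Otimes>\<^sub>M \<Omega>))"
    unfolding indicator_def by measurable
  have one: "(\<integral>\<^sup>+x. indicator {w. increments_le t w} (subtree [i] x) \<partial>\<Omega>) = prob_increments_le t" if "i < b" for i t
    unfolding prob_increments_le_nn_integral
    by (rule nn_integral_subtree) (use that in \<open>auto simp: indicator_def\<close>)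
  have "(\<integral>\<^sup>+x. indicator {x. increments_le s (subtree [0] x) \<and> increments_le (f (x [])) (subtree [1] x)} x \<partial>\<Omega>)
      = (\<integral>\<^sup>+x. ?H (x [], (subtree [0] x, subtree [1] x)) \<partial>\<Omega>)"
    by (intro nn_integral_cong) (auto simp: indicator_def)
  also have "\<dots> = (\<integral>\<^sup>+a. (\<integral>\<^sup>+x. ?H (a, (subtree [0] x, subtree [1] x)) \<partial>\<Omega>) \<partial>N)"
    by (rule nn_integral_root_split[OF ij H])
  also have "\<dots> = (\<integral>\<^sup>+a. prob_increments_le s * prob_increments_le (f a) \<partial>N)"
  proof (rule nn_integral_cong)
    fix a
    have "(\<integral>\<^sup>+x. indicator {w. increments_le s w} (subtree [0] x) * indicator {w. increments_le (f a) w} (subtree [1] x) \<partial>\<Omega>)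
        = (\<integral>\<^sup>+x. indicator {w. increments_le s w} (subtree [0] x) \<partial>\<Omega>)
          * (\<integral>\<^sup>+x. indicator {w. increments_le (f a) w} (subtree [1] x) \<partial>\<Omega>)"
      by (rule \<Omega>.indep_var_nn_integral_mult[OF indep_subtrees])
        (use ij in \<open>auto simp: indicator_def\<close>)
    then show "(\<integral>\<^sup>+x. ?H (a, (subtree [0] x, subtree [1] x)) \<partial>\<Omega>) = prob_increments_le s * prob_increments_le (f a)"
      using one ij by simp
  qed
  also have "\<dots> = prob_increments_le s * (\<integral>\<^sup>+a. prob_increments_le (f a) \<partial>N)"
  proof (rule nn_integral_cmult)
    have "(\<lambda>a. \<integral>\<^sup>+x. indicator {x. increments_le (f a) x} x \<partial>\<Omega>) \<in> borel_measurable N"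
      unfolding indicator_def by measurable
    then show "(\<lambda>a. prob_increments_le (f a)) \<in> borel_measurable N" unfolding prob_increments_le_nn_integral .
  qed
  finally show ?thesis .
qed

text \<open>A zero-one law: if the limit is constant, so is its restriction to each of the independent
  subtrees. The mean excludes that it is almost surely constant.\<close>

lemma prob_increments_le_0: "prob_increments_le 0 = 0"
proof -
  have b: "0 < b" "1 < b" using b2 by auto
  have "prob_increments_le 0 \<le> (\<integral>\<^sup>+x. indicator {x. increments_le 0 (subtree [0] x) \<and> increments_le 0 (subtree [1] x)} x \<partial>\<Omega>)"
    unfolding prob_increments_le_nn_integral
  proof (rule nn_integral_mono_AE)
    show "AE x in \<Omega>. indicator {x. increments_le 0 x} x
        \<le> (indicator {x. increments_le 0 (subtree [0] x) \<and> increments_le 0 (subtree [1] x)} x :: ennreal)"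
      using AE_vertex[OF Nil_in_words nonzero]
    proof eventually_elim
      case (elim x)
      then show ?case using increments_le_subtree[of 0 x 0] increments_le_subtree[of 0 x 1] b by (auto simp: indicator_def)
    qed
  qed
  also have "\<dots> = prob_increments_le 0 * prob_increments_le 0"
    using prob_increments_le_two_subtrees[of "\<lambda>_. 0" 0] by (simp add: N.emeasure_space_1)
  finally have "prob_increments_le 0 \<le> prob_increments_le 0 * prob_increments_le 0" .
  moreover define p where "p = measure \<Omega> {x \<in> space \<Omega>. increments_le 0 x}"
  have p: "prob_increments_le 0 = ennreal p" unfolding prob_increments_le_def p_def by (rule \<Omega>.emeasure_eq_measure)
  moreover have "0 \<le> p" "p \<le> 1" unfolding p_def by auto
  ultimately have "p \<le> p * p" by (simp flip: ennreal_mult)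
  then have "p = 0 \<or> p = 1" using \<open>0 \<le> p\<close> \<open>p \<le> 1\<close> by (metis antisym mult.right_neutral mult_le_cancel_left_pos order_le_less)
  moreover have "p \<noteq> 1"
  proof
    assume "p = 1"
    then have "AE x in \<Omega>. increments_le 0 x"
      unfolding p_def using sets_increments_le[of 0] by (subst (asm) \<Omega>.prob_Collect_eq_1) auto
    then have "AE x in \<Omega>. total_lim b x = 0"
      by eventually_elim (auto simp: increments_le_def dest: bspec[OF _ Nil_in_words])
    then have "(\<integral>x. total_lim b x \<partial>\<Omega>) = (\<integral>x. 0 \<partial>\<Omega>)" by (intro integral_cong_AE) auto
    then show False using integral_total_lim by simp
  qed
  ultimately show ?thesis using p by simp
qed

lemma prob_increments_le_small:
  assumes "0 < \<epsilon>"
  obtains t where "0 < t" "prob_increments_le t \<le> ennreal \<epsilon>"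
proof -
  let ?A = "\<lambda>n. {x \<in> space \<Omega>. increments_le (1 / real (Suc n)) x}"
  have "(\<lambda>n. measure \<Omega> (?A n)) \<longlonglongrightarrow> measure \<Omega> (\<Inter>n. ?A n)"
  proof (rule \<Omega>.finite_Lim_measure_decseq)
    show "decseq ?A"
      by (intro decseq_SucI) (auto elim!: increments_le_mono simp: frac_le)
  qed (use sets_increments_le in auto)
  also have "(\<Inter>n. ?A n) = {x \<in> space \<Omega>. increments_le 0 x}"
  proof
    show "(\<Inter>n. ?A n) \<subseteq> {x \<in> space \<Omega>. increments_le 0 x}"
    proof
      fix x assume x: "x \<in> (\<Inter>n. ?A n)"
      have "norm (path_weight x v * total_lim b (subtree v x)) \<le> 0" if "v \<in> words b" for v
      proof (rule LIMSEQ_le_const[OF LIMSEQ_inverse_real_of_nat])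
        show "\<exists>N. \<forall>n\<ge>N. norm (path_weight x v * total_lim b (subtree v x)) \<le> inverse (real (Suc n))"
          using x that by (auto simp: increments_le_def inverse_eq_divide)
      qed
      then show "x \<in> {x \<in> space \<Omega>. increments_le 0 x}" using x by (auto simp: increments_le_def)
    qed
  qed (auto elim!: increments_le_mono)
  also have "measure \<Omega> {x \<in> space \<Omega>. increments_le 0 x} = 0"
    using prob_increments_le_0 by (simp add: prob_increments_le_def \<Omega>.emeasure_eq_measure)
  finally have "\<exists>n. measure \<Omega> (?A n) < \<epsilon>"
    using order_tendstoD(2)[of _ 0 sequentially \<epsilon>] assms by (meson eventually_happens trivial_limit_sequentially)
  then obtain n where "measure \<Omega> (?A n) < \<epsilon>" by blast
  then have "prob_increments_le (1 / real (Suc n)) \<le> ennreal \<epsilon>"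
    by (simp add: prob_increments_le_def \<Omega>.emeasure_eq_measure ennreal_leI)
  then show thesis using that[of "1 / real (Suc n)"] by simp
qed

text \<open>If all increments are at most \<open>t\<close>, those of the first subtree are at most \<open>t / |a\<^sub>0|\<close> and those of the
  second one at most \<open>t / |a\<^sub>1|\<close>. Either \<open>|a\<^sub>0| < t / t\<^sub>0\<close>, which is unlikely by the inverse moments, or the
  increments of the first subtree are at most \<open>t\<^sub>0\<close>, which contributes the small factor
  \<open>prob_increments_le t\<^sub>0\<close>.\<close>

lemma prob_increments_le_recursion:
  assumes t: "0 < t" "0 < t0"
  shows "prob_increments_le t \<le> ennreal ((t / t0) ^ s) * (\<integral>\<^sup>+a. ennreal (1 / norm (a 0) ^ s) \<partial>N)
    + prob_increments_le t0 * (\<integral>\<^sup>+a. prob_increments_le (t / norm (a 1)) \<partial>N)"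
proof -
  have b: "0 < b" "1 < b" using b2 by auto
  have meas: "(\<lambda>x. ennreal ((t / t0) ^ s) * ennreal (1 / norm (x [] 0) ^ s)) \<in> borel_measurable \<Omega>"
    using measurable_vertex_entry[OF Nil_in_words b(1)] by measurable
  have [measurable]: "subtree [0] \<in> \<Omega> \<rightarrow>\<^sub>M \<Omega>" "subtree [1] \<in> \<Omega> \<rightarrow>\<^sub>M \<Omega>" using b by auto
  have meas_a [measurable]: "(\<lambda>a. a 0) \<in> borel_measurable N" "(\<lambda>a. a 1) \<in> borel_measurable N"
    using b by auto
  have [measurable]: "(\<lambda>x. x [] 1) \<in> borel_measurable \<Omega>" using b by simp
  have "prob_increments_le t \<le> (\<integral>\<^sup>+x. ennreal ((t / t0) ^ s) * ennreal (1 / norm (x [] 0) ^ s)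
      + indicator {x. increments_le t0 (subtree [0] x) \<and> increments_le (t / norm (x [] 1)) (subtree [1] x)} x \<partial>\<Omega>)"
    unfolding prob_increments_le_nn_integral
  proof (rule nn_integral_mono_AE)
    show "AE x in \<Omega>. indicator {x. increments_le t x} x
        \<le> ennreal ((t / t0) ^ s) * ennreal (1 / norm (x [] 0) ^ s)
          + (indicator {x. increments_le t0 (subtree [0] x) \<and> increments_le (t / norm (x [] 1)) (subtree [1] x)} x :: ennreal)"
      using AE_vertex[OF Nil_in_words nonzero]
    proof eventually_elim
      case (elim x)
      show ?case
      proof (cases "increments_le t x \<and> norm (x [] 0) < t / t0")
        case True
        then have "norm (x [] 0) \<le> t / t0" "0 < norm (x [] 0)" using elim b by auto
        then have "1 \<le> t / t0 / norm (x [] 0)" by (subst pos_le_divide_eq) simp_all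
        then have "1 \<le> (t / t0 / norm (x [] 0)) ^ s" by (rule one_le_power)
        then have "1 \<le> ennreal ((t / t0) ^ s * (1 / norm (x [] 0) ^ s))"
          by (simp add: power_divide power_mult_distrib)
        then have "1 \<le> ennreal ((t / t0) ^ s) * ennreal (1 / norm (x [] 0) ^ s)"
          using t by (subst ennreal_mult[symmetric]) auto
        then show ?thesis using True by (auto simp: indicator_def add_increasing2)
      next
        case False
        show ?thesis
        proof (cases "increments_le t x")
          case True
          then have "t / norm (x [] 0) \<le> t0" using False elim t b by (simp add: field_simps)
          then have "increments_le t0 (subtree [0] x)" using increments_le_subtree[OF True b(1)] elim b by (auto elim: increments_le_mono)
          moreover have "increments_le (t / norm (x [] 1)) (subtree [1] x)" using increments_le_subtree[OF True b(2)] elim b by auto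
          ultimately show ?thesis by (simp add: True indicator_def add_increasing)
        qed simp
      qed
    qed
  qed
  also have "\<dots> = (\<integral>\<^sup>+x. ennreal ((t / t0) ^ s) * ennreal (1 / norm (x [] 0) ^ s) \<partial>\<Omega>)
      + (\<integral>\<^sup>+x. indicator {x. increments_le t0 (subtree [0] x) \<and> increments_le (t / norm (x [] 1)) (subtree [1] x)} x \<partial>\<Omega>)"
  proof (rule nn_integral_add[OF meas])
    show "(\<lambda>x. indicator {x. increments_le t0 (subtree [0] x) \<and> increments_le (t / norm (x [] 1)) (subtree [1] x)} x :: ennreal)
        \<in> borel_measurable \<Omega>"
      unfolding indicator_def by measurable
  qed
  also have "(\<integral>\<^sup>+x. ennreal ((t / t0) ^ s) * ennreal (1 / norm (x [] 0) ^ s) \<partial>\<Omega>)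
      = ennreal ((t / t0) ^ s) * (\<integral>\<^sup>+a. ennreal (1 / norm (a 0) ^ s) \<partial>N)"
    by (subst nn_integral_vertex[of "[]" "\<lambda>a. ennreal ((t / t0) ^ s) * ennreal (1 / norm (a 0) ^ s)"])
      (auto simp: nn_integral_cmult)
  also have "(\<integral>\<^sup>+x. indicator {x. increments_le t0 (subtree [0] x) \<and> increments_le (t / norm (x [] 1)) (subtree [1] x)} x \<partial>\<Omega>)
      = prob_increments_le t0 * (\<integral>\<^sup>+a. prob_increments_le (t / norm (a 1)) \<partial>N)"
    by (rule prob_increments_le_two_subtrees) measurable
  finally show ?thesis .
qed

text \<open>The recursion reads \<open>g t \<le> C t\<^sup>s + \<epsilon> E(g (t / |a\<^sub>1|))\<close>. Here \<open>\<epsilon>\<close> is arbitrarily small, so the map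
  \<open>h \<mapsto> \<epsilon> E(h (t / |a\<^sub>1|))\<close> contracts multiples of \<open>t\<^sup>s\<close>, and iteration starting from \<open>g \<le> 1\<close> leaves
  a multiple of \<open>t\<^sup>s\<close> only.\<close>

lemma prob_increments_le_power:
  obtains D where "0 \<le> D" "\<And>t. 0 < t \<Longrightarrow> prob_increments_le t \<le> ennreal (D * t ^ s)"
proof -
  have b: "0 < b" "1 < b" using b2 by auto
  define i0 where "i0 = enn2real (\<integral>\<^sup>+a. ennreal (1 / norm (a 0) ^ s) \<partial>N)"
  define i1 where "i1 = enn2real (\<integral>\<^sup>+a. ennreal (1 / norm (a 1) ^ s) \<partial>N)"
  have i: "(\<integral>\<^sup>+a. ennreal (1 / norm (a 0) ^ s) \<partial>N) = ennreal i0" "0 \<le> i0"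
    "(\<integral>\<^sup>+a. ennreal (1 / norm (a 1) ^ s) \<partial>N) = ennreal i1" "0 \<le> i1"
    unfolding i0_def i1_def using inverse_moment[OF b(1), of s] inverse_moment[OF b(2), of s] by auto
  \<comment> \<open>small enough that replacing \<open>t\<close> by \<open>t / |a\<^sub>1|\<close> in \<open>t ^ s\<close> costs less than is gained\<close>
  define \<epsilon> where "\<epsilon> = 1 / (2 * (i1 + 1))"
  have \<epsilon>: "0 < \<epsilon>" "\<epsilon> < 1" "\<epsilon> * i1 \<le> 1 / 2" using i(4) by (auto simp: \<epsilon>_def field_simps)
  obtain t0 where t0: "0 < t0" "prob_increments_le t0 \<le> ennreal \<epsilon>" using prob_increments_le_small[OF \<epsilon>(1)] by blast
  define D where "D = 2 * i0 / t0 ^ s"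
  have D: "0 \<le> D" using i t0 by (simp add: D_def)
  have iter: "prob_increments_le t \<le> ennreal (\<epsilon> ^ n + D * t ^ s)" if "0 < t" for t n
    using that
  proof (induction n arbitrary: t)
    case 0
    have "prob_increments_le t \<le> 1" unfolding prob_increments_le_def by (rule \<Omega>.emeasure_le_1)
    also have "1 \<le> ennreal (\<epsilon> ^ 0 + D * t ^ s)" using D 0 by simp
    finally show ?case .
  next
    case (Suc n)
    have [measurable]: "(\<lambda>a. a 1) \<in> borel_measurable N" using b by simp
    have "(\<integral>\<^sup>+a. prob_increments_le (t / norm (a 1)) \<partial>N)
        \<le> (\<integral>\<^sup>+a. ennreal (\<epsilon> ^ n) + ennreal (D * t ^ s) * ennreal (1 / norm (a 1) ^ s) \<partial>N)"
    proof (rule nn_integral_mono_AE)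
      show "AE a in N. prob_increments_le (t / norm (a 1))
          \<le> ennreal (\<epsilon> ^ n) + ennreal (D * t ^ s) * ennreal (1 / norm (a 1) ^ s)"
        using nonzero
      proof eventually_elim
        case (elim a)
        then have "0 < t / norm (a 1)" using b Suc.prems by simp
        from Suc.IH[OF this]
        have "prob_increments_le (t / norm (a 1)) \<le> ennreal (\<epsilon> ^ n + (D * t ^ s) * (1 / norm (a 1) ^ s))"
          by (simp add: power_divide)
        also have "\<dots> = ennreal (\<epsilon> ^ n) + ennreal (D * t ^ s) * ennreal (1 / norm (a 1) ^ s)"
        proof -
          have "0 \<le> D * t ^ s" "0 \<le> 1 / norm (a 1) ^ s" "0 \<le> \<epsilon> ^ n" using D Suc.prems \<epsilon> by auto
          then show ?thesis by (simp only: ennreal_plus ennreal_mult mult_nonneg_nonneg)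
        qed
        finally show ?case .
      qed
    qed
    also have "\<dots> = ennreal (\<epsilon> ^ n) + ennreal (D * t ^ s) * ennreal i1"
    proof -
      have m: "(\<lambda>a. ennreal (1 / norm (a 1) ^ s)) \<in> borel_measurable N" by measurable
      then have "(\<lambda>a. ennreal (D * t ^ s) * ennreal (1 / norm (a 1) ^ s)) \<in> borel_measurable N"
        by (intro borel_measurable_times_ennreal borel_measurable_const)
      then have "(\<integral>\<^sup>+a. ennreal (\<epsilon> ^ n) + ennreal (D * t ^ s) * ennreal (1 / norm (a 1) ^ s) \<partial>N)
          = (\<integral>\<^sup>+a. ennreal (\<epsilon> ^ n) \<partial>N) + (\<integral>\<^sup>+a. ennreal (D * t ^ s) * ennreal (1 / norm (a 1) ^ s) \<partial>N)"
        by (intro nn_integral_add borel_measurable_const)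
      then show ?thesis by (simp only: nn_integral_cmult[OF m] i(3)) (simp add: N.emeasure_space_1)
    qed
    also have "\<dots> = ennreal (\<epsilon> ^ n + D * t ^ s * i1)"
      using D Suc.prems \<epsilon> i by (subst ennreal_plus) (auto simp: ennreal_mult)
    finally have int: "(\<integral>\<^sup>+a. prob_increments_le (t / norm (a 1)) \<partial>N) \<le> ennreal (\<epsilon> ^ n + D * t ^ s * i1)" .
    have "prob_increments_le t \<le> ennreal ((t / t0) ^ s) * ennreal i0
        + prob_increments_le t0 * (\<integral>\<^sup>+a. prob_increments_le (t / norm (a 1)) \<partial>N)"
      using prob_increments_le_recursion[OF Suc.prems t0(1), of s] unfolding i .
    also have "\<dots> \<le> ennreal ((t / t0) ^ s) * ennreal i0 + ennreal \<epsilon> * ennreal (\<epsilon> ^ n + D * t ^ s * i1)"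
      using t0(2) int by (intro add_left_mono mult_mono) auto
    also have "\<dots> = ennreal ((t / t0) ^ s * i0 + \<epsilon> * (\<epsilon> ^ n + D * t ^ s * i1))"
    proof -
      have "0 \<le> (t / t0) ^ s" "0 \<le> \<epsilon> ^ n + D * t ^ s * i1" using Suc.prems t0 D \<epsilon> i by simp_all
      then show ?thesis using i(2) \<epsilon>(1)
        by (simp only: ennreal_mult[symmetric] ennreal_plus[symmetric] mult_nonneg_nonneg less_imp_le)
    qed
    also have "\<dots> \<le> ennreal (\<epsilon> ^ Suc n + D * t ^ s)"
    proof (rule ennreal_leI)
      have "(t / t0) ^ s * i0 = 1 / 2 * (D * t ^ s)" by (simp add: D_def power_divide)
      moreover have "\<epsilon> * i1 * (D * t ^ s) \<le> 1 / 2 * (D * t ^ s)"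
        using \<epsilon>(3) D Suc.prems by (intro mult_right_mono) auto
      ultimately show "(t / t0) ^ s * i0 + \<epsilon> * (\<epsilon> ^ n + D * t ^ s * i1) \<le> \<epsilon> ^ Suc n + D * t ^ s"
        by (simp add: algebra_simps)
    qed
    finally show ?case .
  qed
  have "prob_increments_le t \<le> ennreal (D * t ^ s)" if "0 < t" for t
  proof (rule LIMSEQ_le_const)
    have "(\<lambda>n. \<epsilon> ^ n + D * t ^ s) \<longlonglongrightarrow> 0 + D * t ^ s"
      using \<epsilon> by (intro tendsto_add tendsto_const LIMSEQ_power_zero) auto
    then show "(\<lambda>n. ennreal (\<epsilon> ^ n + D * t ^ s)) \<longlonglongrightarrow> ennreal (D * t ^ s)"
      using tendsto_ennrealI by fastforce
  qed (use iter[OF that] in blast)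
  then show thesis using that D by blast
qed

text \<open>The weighted indicators \<open>2\<^sup>n 1{all increments in the subtree of w are at most q\<^sup>-\<^sup>m 2\<^sup>-\<^sup>n}\<close>, where \<open>m\<close> is
  the length of \<open>w\<close>, have summable expectations. Once they are bounded, an \<open>n\<close> whose \<open>2\<^sup>n\<close> exceeds the bound
  gives a lower bound for all words.\<close>

lemma AE_oscillation:
  assumes q: "1 < q"
  shows "AE x in \<Omega>. \<exists>c>0. \<forall>w\<in>words b. \<exists>v\<in>words b.
    c / q ^ length w \<le> norm (path_weight (subtree w x) v * total_lim b (subtree (w @ v) x))"
proof -
  obtain k where k: "2 \<le> k" "real b < q ^ k" using exists_power_gt[OF q] by blast
  obtain D where D: "0 \<le> D" "\<And>t. 0 < t \<Longrightarrow> prob_increments_le t \<le> ennreal (D * t ^ k)"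
    using prob_increments_le_power by blast
  let ?t = "\<lambda>m n. 1 / (q ^ m * 2 ^ n)"
  have "AE x in \<Omega>. \<exists>K>0. \<forall>w\<in>words b. \<forall>n.
      (\<lambda>w n x. (2::real) ^ n * indicator {x. increments_le (?t (length w) n) x} (subtree w x)) w n x \<le> K"
  proof (rule AE_bounded_family[where C = D and \<alpha> = "b / q ^ k" and \<gamma> = "1 / 2"])
    show "(\<lambda>x. 2 ^ n * indicator {x. increments_le (?t (length w) n) x} (subtree w x) :: real) \<in> borel_measurable \<Omega>"
      if w: "w \<in> words b" for w n
    proof -
      have [measurable]: "subtree w \<in> \<Omega> \<rightarrow>\<^sub>M \<Omega>" using w by simp
      show ?thesis unfolding indicator_def by measurable
    qed
    fix m n
    have t: "0 < ?t m n" using q by simp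
    have "(\<Sum>w\<in>level b m. \<integral>\<^sup>+x. ennreal (2 ^ n * indicator {x. increments_le (?t (length w) n) x} (subtree w x)) \<partial>\<Omega>)
        = (\<Sum>w\<in>level b m. ennreal (2 ^ n) * prob_increments_le (?t m n))"
    proof (rule sum.cong[OF refl])
      fix w assume w: "w \<in> level b m"
      then have [measurable]: "subtree w \<in> \<Omega> \<rightarrow>\<^sub>M \<Omega>" by (simp add: level_def)
      have "(\<integral>\<^sup>+x. ennreal (2 ^ n * indicator {x. increments_le (?t m n) x} (subtree w x)) \<partial>\<Omega>)
          = ennreal (2 ^ n) * (\<integral>\<^sup>+x. ennreal (indicator {x. increments_le (?t m n) x} (subtree w x)) \<partial>\<Omega>)"
        by (rule nn_integral_ennreal_cmult) (auto simp: indicator_def)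
      also have "(\<integral>\<^sup>+x. ennreal (indicator {x. increments_le (?t m n) x} (subtree w x)) \<partial>\<Omega>)
          = (\<integral>\<^sup>+x. ennreal (indicator {x. increments_le (?t m n) x} x) \<partial>\<Omega>)"
        by (rule nn_integral_subtree[where f = "\<lambda>x. ennreal (indicator {x. increments_le (?t m n) x} x)"])
          (use w in \<open>auto simp: indicator_def level_def\<close>)
      also have "\<dots> = prob_increments_le (?t m n)"
        unfolding prob_increments_le_nn_integral by (simp add: ennreal_indicator)
      finally show "(\<integral>\<^sup>+x. ennreal (2 ^ n * indicator {x. increments_le (?t (length w) n) x} (subtree w x)) \<partial>\<Omega>)
          = ennreal (2 ^ n) * prob_increments_le (?t m n)" using w by (simp add: level_def)
    qed
    also have "\<dots> = ennreal (real (b ^ m)) * (ennreal (2 ^ n) * prob_increments_le (?t m n))"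
      by (simp add: card_level ennreal_of_nat_eq_real_of_nat)
    also have "\<dots> \<le> ennreal (real (b ^ m)) * (ennreal (2 ^ n) * ennreal (D * ?t m n ^ k))"
      by (intro mult_left_mono D(2) t) auto
    also have "\<dots> = ennreal (real (b ^ m) * (2 ^ n * (D * ?t m n ^ k)))"
    proof -
      have "0 \<le> D * ?t m n ^ k" using D t by simp
      then show ?thesis by (simp only: ennreal_mult mult_nonneg_nonneg zero_le_power zero_le_numeral of_nat_0_le_iff)
    qed
    also have "\<dots> \<le> ennreal (D * (b / q ^ k) ^ m * (1 / 2) ^ n)"
    proof (rule ennreal_leI)
      \<comment> \<open>the factor \<open>2 ^ n\<close> is absorbed because \<open>k \<ge> 2\<close>\<close>
      have "(1 / 2 :: real) ^ (n * k) \<le> (1 / 2) ^ (n * 2)" using k by (intro power_decreasing) auto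
      then have "2 ^ n * (1 / 2 :: real) ^ (n * k) \<le> 2 ^ n * (1 / 2) ^ (n * 2)" by (intro mult_left_mono) auto
      also have "2 ^ n * (1 / 2 :: real) ^ (n * 2) = (1 / 2) ^ n"
        by (simp add: power_mult power2_eq_square power_divide)
      finally have two: "2 ^ n * (1 / 2 :: real) ^ (n * k) \<le> (1 / 2) ^ n" .
      have "?t m n ^ k = 1 / (q ^ k) ^ m * (1 / 2) ^ (n * k)"
        by (simp add: power_divide power_mult_distrib mult.commute[of k] flip: power_mult)
      then have "real (b ^ m) * (2 ^ n * (D * ?t m n ^ k)) = D * (b / q ^ k) ^ m * (2 ^ n * (1 / 2) ^ (n * k))"
        by (simp add: power_divide)
      also have "\<dots> \<le> D * (b / q ^ k) ^ m * (1 / 2) ^ n"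
        using D(1) q by (intro mult_left_mono[OF two]) auto
      finally show "real (b ^ m) * (2 ^ n * (D * ?t m n ^ k)) \<le> D * (b / q ^ k) ^ m * (1 / 2) ^ n" .
    qed
    finally show "(\<Sum>w\<in>level b m. \<integral>\<^sup>+x. ennreal (2 ^ n * indicator {x. increments_le (?t (length w) n) x} (subtree w x)) \<partial>\<Omega>)
        \<le> ennreal (D * (b / q ^ k) ^ m * (1 / 2) ^ n)" .
  qed (use D q k in auto)
  then show ?thesis
  proof eventually_elim
    case (elim x)
    then obtain K where K: "\<And>w n. w \<in> words b \<Longrightarrow>
        (2::real) ^ n * indicator {x. increments_le (?t (length w) n) x} (subtree w x) \<le> K" by blast
    obtain n where n: "K < 2 ^ n" using real_arch_pow[of 2 K] by auto
    have "\<exists>v\<in>words b. 1 / 2 ^ n / q ^ length w \<le> norm (path_weight (subtree w x) v * total_lim b (subtree (w @ v) x))"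
      if w: "w \<in> words b" for w
    proof -
      have "\<not> increments_le (?t (length w) n) (subtree w x)"
      proof
        assume "increments_le (?t (length w) n) (subtree w x)"
        then show False using K[OF w, of n] n by simp
      qed
      then obtain v where "v \<in> words b"
          "?t (length w) n < norm (path_weight (subtree w x) v * total_lim b (subtree v (subtree w x)))"
        unfolding increments_le_def by (auto simp: not_le)
      then show ?thesis by (intro bexI[of _ v]) (auto simp: mult.commute intro: less_imp_le)
    qed
    then show ?case by (intro exI[of _ "1 / 2 ^ n"]) auto
  qed
qed

theorem AE_regular_family: "AE x in \<Omega>. regular_family b x"
proof -
  let ?q = "\<lambda>j::nat. 1 + 1 / real (Suc j)"
  have q: "1 < ?q j" for j by simp
  have "AE x in \<Omega>. \<forall>j. \<exists>C \<rho>. 0 < \<rho> \<and> \<rho> < 1 \<and>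
      (\<forall>w\<in>words b. \<forall>n. norm (mass_step b n (subtree w x)) \<le> C * ?q j ^ length w * \<rho> ^ n)"
    unfolding AE_all_countable by (intro allI AE_steps q)
  moreover have "AE x in \<Omega>. \<forall>j. \<exists>c>0. \<forall>w\<in>words b. \<exists>v\<in>words b.
      c / ?q j ^ length w \<le> norm (path_weight (subtree w x) v * total_lim b (subtree (w @ v) x))"
    unfolding AE_all_countable by (intro allI AE_oscillation q)
  moreover have "AE x in \<Omega>. \<forall>j. \<exists>c>0. \<forall>w\<in>words b. \<forall>i<b. c / ?q j ^ length w \<le> norm (x w i)"
    unfolding AE_all_countable by (intro allI AE_entries q)
  ultimately show ?thesis
    using AE_weights_decay by eventually_elim (rule regular_familyI; blast)
qed

end

section \<open>The critical exponent\<close>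

text \<open>The conditions on the law of a weight vector, expressed by a random vector with this law.\<close>

lemma (in prob_space) cascade_law_distr:
  fixes U :: "'a \<Rightarrow> nat \<Rightarrow> complex"
  assumes b: "2 \<le> b" and U: "U \<in> M \<rightarrow>\<^sub>M vec_space b"
    and bounded: "AE \<omega> in M. \<forall>i<b. norm (U \<omega> i) \<le> 1"
    and nonzero: "AE \<omega> in M. \<forall>i<b. U \<omega> i \<noteq> 0"
    and inverse_moment: "\<And>i k::nat. i < b \<Longrightarrow> (\<integral>\<^sup>+\<omega>. ennreal (1 / norm (U \<omega> i) ^ k) \<partial>M) < \<infinity>"
    and mean: "(\<integral>\<omega>. (\<Sum>i<b. U \<omega> i) \<partial>M) = 1"
    and subcritical: "(\<forall>k\<ge>2. (\<integral>\<^sup>+\<omega>. (\<Sum>i<b. ennreal (norm (U \<omega> i) ^ k)) \<partial>M) < 1) \<or>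
      (AE \<omega> in M. (\<Sum>i<b. U \<omega> i) = 1) \<and>
      (\<exists>k\<ge>1. (\<integral>\<^sup>+\<omega>. (\<Sum>i<b. ennreal (norm (U \<omega> i) ^ k)) \<partial>M) < 1)"
  shows "cascade_law (distr M (vec_space b) U) b"
proof -
  interpret N: prob_space "distr M (vec_space b) U" by (rule prob_space_distr[OF U])
  have entry [measurable]: "(\<lambda>a. a i :: complex) \<in> borel_measurable (vec_space b)" if "i < b" for i
    unfolding vec_space_def by (rule measurable_component_singleton) (use that in simp)
  have AE_distr: "(AE a in distr M (vec_space b) U. P a) \<longleftrightarrow> (AE \<omega> in M. P (U \<omega>))"
    if "Measurable.pred (vec_space b) P" for P
    using that by (intro AE_distr_iff[OF U]) (simp add: pred_def)
  have all: "Measurable.pred (vec_space b) (\<lambda>a. \<forall>i<b. Q (a i))"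
    if "Measurable.pred borel Q" for Q :: "complex \<Rightarrow> bool"
  proof -
    have "Measurable.pred (vec_space b) (\<lambda>a. Q (a i))" if "i \<in> {..<b}" for i
      using measurable_compose[OF entry \<open>Measurable.pred borel Q\<close>] that by simp
    then have "Measurable.pred (vec_space b) (\<lambda>a. \<forall>i\<in>{..<b}. Q (a i))"
      by (rule pred_intros_countable_bounded(3))
    then show ?thesis unfolding Ball_def lessThan_iff .
  qed
  have nn: "(\<integral>\<^sup>+a. f a \<partial>distr M (vec_space b) U) = (\<integral>\<^sup>+\<omega>. f (U \<omega>) \<partial>M)"
    if "f \<in> borel_measurable (vec_space b)" for f
    by (rule nn_integral_distr[OF U]) (use that in simp)
  have moment: "(\<integral>\<^sup>+a. (\<Sum>i<b. ennreal (norm (a i) ^ k)) \<partial>distr M (vec_space b) U)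
      = (\<integral>\<^sup>+\<omega>. (\<Sum>i<b. ennreal (norm (U \<omega> i) ^ k)) \<partial>M)" for k
    by (rule nn) (auto intro!: borel_measurable_sum)
  have sum1: "(AE a in distr M (vec_space b) U. (\<Sum>i<b. a i) = 1) \<longleftrightarrow> (AE \<omega> in M. (\<Sum>i<b. U \<omega> i) = 1)"
    by (rule AE_distr) (intro pred_eq_const1[OF borel_measurable_sum], auto)
  show ?thesis
  proof
    show "AE a in distr M (vec_space b) U. \<forall>i<b. norm (a i) \<le> 1"
      by (subst AE_distr[OF all]) (use bounded in auto)
    show "AE a in distr M (vec_space b) U. \<forall>i<b. a i \<noteq> 0"
      by (subst AE_distr[OF all]) (use nonzero in auto)
    show "(\<integral>\<^sup>+a. ennreal (1 / norm (a i) ^ k) \<partial>distr M (vec_space b) U) < \<infinity>" if "i < b" for i k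
      by (subst nn) (use that inverse_moment[OF that, of k] in auto)
    show "(\<integral>a. (\<Sum>i<b. a i) \<partial>distr M (vec_space b) U) = 1"
      using mean by (subst integral_distr[OF U]) auto
    show "(\<forall>k\<ge>2. (\<integral>\<^sup>+a. (\<Sum>i<b. ennreal (norm (a i) ^ k)) \<partial>distr M (vec_space b) U) < 1) \<or>
        (AE a in distr M (vec_space b) U. (\<Sum>i<b. a i) = 1) \<and>
        (\<exists>k\<ge>1. (\<integral>\<^sup>+a. (\<Sum>i<b. ennreal (norm (a i) ^ k)) \<partial>distr M (vec_space b) U) < 1)"
      unfolding moment sum1 by (rule subcritical)
  qed (use b in auto)
qed

lemma (in prob_space) AE_regular_copies:
  fixes U :: "'a \<Rightarrow> nat \<Rightarrow> complex"
  assumes law: "cascade_law (distr M (vec_space b) U) b"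
    and ind: "indep_vars (\<lambda>_. vec_space b) Us (words b)"
    and copies: "\<And>w. w \<in> words b \<Longrightarrow> distr M (vec_space b) (Us w) = distr M (vec_space b) U"
  shows "AE \<omega> in M. regular_family b (\<lambda>w\<in>words b. Us w \<omega>)"
proof -
  interpret cascade_law "distr M (vec_space b) U" b by (rule law)
  have rv: "Us w \<in> M \<rightarrow>\<^sub>M vec_space b" if "w \<in> words b" for w
    using ind that unfolding indep_vars_def by blast
  have "distr M (PiM (words b) (\<lambda>_. vec_space b)) (\<lambda>\<omega>. \<lambda>w\<in>words b. Us w \<omega>)
      = PiM (words b) (\<lambda>w. distr M (vec_space b) (Us w))"
    using ind by (subst (asm) indep_vars_iff_distr_eq_PiM') (use rv in \<open>auto intro: Nil_in_words\<close>)
  also have "\<dots> = \<Omega>" unfolding \<Omega>_def by (rule PiM_cong) (auto simp: copies)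
  finally have D: "distr M (PiM (words b) (\<lambda>_. vec_space b)) (\<lambda>\<omega>. \<lambda>w\<in>words b. Us w \<omega>) = \<Omega>" .
  have meas: "(\<lambda>\<omega>. \<lambda>w\<in>words b. Us w \<omega>) \<in> M \<rightarrow>\<^sub>M PiM (words b) (\<lambda>_. vec_space b)"
    by (rule measurable_restrict) (rule rv)
  show ?thesis
    by (rule AE_distrD[OF meas], subst D, rule AE_regular_family)
qed

text \<open>A real family inherits regularity from its complexification.\<close>

lemma regular_family_of_real:
  fixes x :: "nat list \<Rightarrow> nat \<Rightarrow> complex" and y :: "nat list \<Rightarrow> nat \<Rightarrow> real"
  assumes x: "regular_family b x" and b: "1 \<le> b"
    and xy: "\<And>w i. w \<in> words b \<Longrightarrow> i < b \<Longrightarrow> x w i = of_real (y w i)"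
  shows "regular_family b y"
proof -
  have weight: "path_weight (subtree u x) w = of_real (path_weight (subtree u y) w)"
    if "u \<in> words b" "w \<in> words b" for u w
    using that by (induction w arbitrary: u) (auto simp: xy)
  have mass: "total_mass b n (subtree u x) = of_real (total_mass b n (subtree u y))"
    if "u \<in> words b" for u n
    using that by (induction n arbitrary: u) (auto simp: xy)
  have step: "mass_step b n (subtree u x) = of_real (mass_step b n (subtree u y))"
    if "u \<in> words b" for u n
    using that by (simp add: mass_step_def mass del: total_mass.simps)
  obtain C r \<rho> where "contracting_family b x C r \<rho>" using regular_family_contracting[OF x b] .
  then interpret contracting_family b x C r \<rho> .
  have lim: "total_lim b (subtree u x) = of_real (total_lim b (subtree u y))" if "u \<in> words b" for u
  proof -
    have lim_x: "(\<lambda>n. complex_of_real (total_mass b n (subtree u y))) \<longlonglongrightarrow> total_lim b (subtree u x)"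
      using cell_cascade_tendsto[OF that, of 1] by (simp add: cell_cascade_1 cell_cascade_lim_def total_lim_def mass that)
    then have lim_y: "(\<lambda>n. total_mass b n (subtree u y)) \<longlonglongrightarrow> Re (total_lim b (subtree u x))"
      using tendsto_Re by fastforce
    then have "total_lim b (subtree u y) = Re (total_lim b (subtree u x))"
      unfolding total_lim_def[of b "subtree u y"] by (rule limI)
    moreover have "total_lim b (subtree u x) = of_real (Re (total_lim b (subtree u x)))"
      using LIMSEQ_unique[OF lim_x tendsto_of_real[OF lim_y]] .
    ultimately show ?thesis by simp
  qed
  show ?thesis
    unfolding regular_family_def
  proof (intro conjI allI impI)
    show "\<exists>C r. 0 < r \<and> r < 1 \<and> (\<forall>w\<in>words b. norm (path_weight y w) \<le> C * r ^ length w)"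
      using regular_family_weights[OF x] weight[of "[]"] by (metis Nil_in_words norm_of_real real_norm_def subtree_Nil)
  next
    fix q :: real assume q: "1 < q"
    show "\<exists>C \<rho>. 0 < \<rho> \<and> \<rho> < 1 \<and>
        (\<forall>w\<in>words b. \<forall>n. norm (mass_step b n (subtree w y)) \<le> C * q ^ length w * \<rho> ^ n)"
      by (rule regular_family_steps[OF x q]) (use step in \<open>auto intro!: exI\<close>)
    show "\<exists>c>0. \<forall>w\<in>words b. \<exists>v\<in>words b. c / q ^ length w
        \<le> norm (path_weight (subtree w y) v * total_lim b (subtree (w @ v) y))"
    proof (rule regular_family_oscillation[OF x q])
      fix c :: real assume c: "0 < c" "\<And>w. w \<in> words b \<Longrightarrow> \<exists>v\<in>words b.
        c / q ^ length w \<le> norm (path_weight (subtree w x) v * total_lim b (subtree (w @ v) x))"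
      have eq: "norm (path_weight (subtree w x) v * total_lim b (subtree (w @ v) x))
          = norm (path_weight (subtree w y) v * total_lim b (subtree (w @ v) y))"
        if "w \<in> words b" "v \<in> words b" for w v
        using that by (simp add: weight lim norm_mult abs_mult)
      show ?thesis using c eq by (intro exI[of _ c]) (metis (no_types, lifting))
    qed
    show "\<exists>c>0. \<forall>w\<in>words b. \<forall>i<b. c / q ^ length w \<le> norm (y w i)"
      by (rule regular_family_entries[OF x q]) (use xy in \<open>auto intro!: exI\<close>)
  qed
qed

lemma epowr_nonneg: "0 \<le> p \<Longrightarrow> epowr x p = ennreal (x powr p)"
  by (simp add: epowr_def)

lemma measurable_epowr [measurable]:
  assumes [measurable]: "f \<in> borel_measurable K"
  shows "(\<lambda>x. epowr (f x) p) \<in> borel_measurable K"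
  unfolding epowr_def by (cases "p < 0") simp_all

locale critical_vector = prob_space M for M :: "'a measure" +
  fixes b :: nat and W :: "'a \<Rightarrow> nat \<Rightarrow> complex" and \<beta> :: real
  assumes b: "2 \<le> b"
    and W [measurable]: "W \<in> M \<rightarrow>\<^sub>M vec_space b"
    and W_integrable: "\<forall>i<b. integrable M (\<lambda>\<omega>. W \<omega> i)"
    and W_mean: "(LINT \<omega>|M. (\<Sum>i<b. W \<omega> i)) = 1"
    and not_nonneg: "\<P>(\<omega> in M. \<not> (\<forall>i<b. W \<omega> i \<in> \<real>\<^sub>\<ge>\<^sub>0)) > 0"
    and moments: "\<forall>p::real. (\<Sum>i<b. \<integral>\<^sup>+\<omega>. epowr (norm (W \<omega> i)) p \<partial>M) < \<infinity>"
    and convergence_cases: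
      "(\<P>(\<omega> in M. (\<Sum>i<b. W \<omega> i) \<noteq> 1) > 0 \<and>
          (\<exists>p>1. phi M b W p > 0 \<and> (p \<in> {1<..2} \<or> phi M b W 2 > 0))) \<or>
       (\<P>(\<omega> in M. (\<Sum>i<b. W \<omega> i) = 1) = 1 \<and> (\<exists>p>1. phi M b W p > 0))"
    and \<beta>_zero: "\<beta> \<ge> 0" "phi M b W \<beta> = 0"
    and \<beta>_pos: "\<forall>p>\<beta>. phi M b W p > 0"
begin

lemma measurable_W [measurable]: "i < b \<Longrightarrow> (\<lambda>\<omega>. W \<omega> i) \<in> borel_measurable M"
  using measurable_compose[OF W, of "\<lambda>a. a i" borel] measurable_component_singleton[of i "{..<b}" "\<lambda>_. borel"]
  by (simp add: vec_space_def)

lemma entry_moment: "i < b \<Longrightarrow> (\<integral>\<^sup>+\<omega>. epowr (norm (W \<omega> i)) p \<partial>M) < \<infinity>"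
  using moments by (auto simp: less_top[symmetric] ennreal_sum_less_top)

lemma moment_sum_eq: "moment_sum M b W p = (\<Sum>i<b. \<integral>\<^sup>+\<omega>. epowr (norm (W \<omega> i)) p \<partial>M)"
  unfolding moment_sum_def by (rule nn_integral_sum) simp

lemma phi_pos_iff: "phi M b W p > 0 \<longleftrightarrow> moment_sum M b W p < 1"
proof -
  have "moment_sum M b W p < \<infinity>" using moments by (simp add: moment_sum_eq)
  then obtain m where m: "moment_sum M b W p = ennreal m" "0 \<le> m"
    by (cases "moment_sum M b W p") auto
  show ?thesis
  proof (cases "m = 0")
    case False
    then have "phi M b W p > 0 \<longleftrightarrow> log (real b) m < 0" using m by (simp add: phi_def)
    also have "\<dots> \<longleftrightarrow> m < 1" using False m b by (subst log_less_zero_cancel_iff) auto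
    finally show ?thesis using m by (simp add: ennreal_less_one_iff)
  qed (use m in \<open>simp add: phi_def\<close>)
qed

lemma phi_zero_iff: "phi M b W p = 0 \<longleftrightarrow> moment_sum M b W p = 1"
proof -
  have "moment_sum M b W p < \<infinity>" using moments by (simp add: moment_sum_eq)
  then obtain m where m: "moment_sum M b W p = ennreal m" "0 \<le> m"
    by (cases "moment_sum M b W p") auto
  show ?thesis
  proof (cases "m = 0")
    case False
    then have "phi M b W p = 0 \<longleftrightarrow> log (real b) m = 0" using m by (simp add: phi_def zero_ereal_def)
    also have "\<dots> \<longleftrightarrow> m = 1" using False m b by (simp add: log_def)
    finally show ?thesis using m by simp
  qed (use m in \<open>simp add: phi_def\<close>)
qed

text \<open>Equality in \<open>E \<Sum> |W\<^sub>i| \<ge> E \<Sum> Re W\<^sub>i = 1\<close> would force the components to be nonnegative reals.\<close>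

lemma moment_sum_1: "\<not> moment_sum M b W 1 \<le> 1"
proof
  assume le: "moment_sum M b W 1 \<le> 1"
  let ?g = "\<lambda>\<omega>. \<Sum>i<b. norm (W \<omega> i) - Re (W \<omega> i)"
  have int: "integrable M (\<lambda>\<omega>. norm (W \<omega> i))" "integrable M (\<lambda>\<omega>. Re (W \<omega> i))" if "i < b" for i
    using W_integrable that by auto
  have "moment_sum M b W 1 = (\<integral>\<^sup>+\<omega>. ennreal (\<Sum>i<b. norm (W \<omega> i)) \<partial>M)"
    unfolding moment_sum_def by (simp add: epowr_nonneg sum_ennreal)
  also have "\<dots> = ennreal (\<integral>\<omega>. (\<Sum>i<b. norm (W \<omega> i)) \<partial>M)"
    using int by (intro nn_integral_eq_integral) (auto intro!: sum_nonneg)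
  finally have "(\<integral>\<omega>. (\<Sum>i<b. norm (W \<omega> i)) \<partial>M) \<le> 1" using le by simp
  moreover have "(\<integral>\<omega>. (\<Sum>i<b. Re (W \<omega> i)) \<partial>M) = 1"
  proof -
    have "(\<integral>\<omega>. Re (\<Sum>i<b. W \<omega> i) \<partial>M) = Re (\<integral>\<omega>. (\<Sum>i<b. W \<omega> i) \<partial>M)"
      using W_integrable by (intro integral_Re) auto
    then show ?thesis using W_mean by (simp add: Re_sum)
  qed
  moreover have "(\<integral>\<omega>. ?g \<omega> \<partial>M) = (\<integral>\<omega>. (\<Sum>i<b. norm (W \<omega> i)) \<partial>M) - (\<integral>\<omega>. (\<Sum>i<b. Re (W \<omega> i)) \<partial>M)"
    unfolding sum_subtractf using int by (intro Bochner_Integration.integral_diff) auto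
  moreover have nonneg: "0 \<le> norm z - Re z" for z :: complex by (simp add: complex_Re_le_cmod)
  then have "0 \<le> (\<integral>\<omega>. ?g \<omega> \<partial>M)" by (intro integral_nonneg_AE) (auto intro!: sum_nonneg)
  ultimately have "(\<integral>\<omega>. ?g \<omega> \<partial>M) = 0" by linarith
  then have "AE \<omega> in M. ?g \<omega> = 0"
    using int nonneg by (subst (asm) integral_nonneg_eq_0_iff_AE) (auto intro!: sum_nonneg)
  then have "AE \<omega> in M. \<forall>i<b. W \<omega> i \<in> \<real>\<^sub>\<ge>\<^sub>0"
  proof eventually_elim
    case (elim \<omega>)
    then have "\<forall>i\<in>{..<b}. norm (W \<omega> i) - Re (W \<omega> i) = 0"
      using nonneg by (subst (asm) sum_nonneg_eq_0_iff) auto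
    then have *: "norm (W \<omega> i) = Re (W \<omega> i)" if "i < b" for i using that by simp
    show ?case
    proof (intro allI impI)
      fix i assume "i < b"
      then have "Im (W \<omega> i) = 0" "0 \<le> Re (W \<omega> i)"
        using *[of i] cmod_power2[of "W \<omega> i"] norm_ge_zero[of "W \<omega> i"] by auto
      then show "W \<omega> i \<in> \<real>\<^sub>\<ge>\<^sub>0" by (simp add: complex_nonneg_Reals_iff)
    qed
  qed
  then have "\<P>(\<omega> in M. \<not> (\<forall>i<b. W \<omega> i \<in> \<real>\<^sub>\<ge>\<^sub>0)) = 0"
    using prob_eq_0[of "{\<omega> \<in> space M. \<not> (\<forall>i<b. W \<omega> i \<in> \<real>\<^sub>\<ge>\<^sub>0)}"] measure_notin_sets
    by (metis (mono_tags, lifting) AE_mp AE_I2 mem_Collect_eq)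
  then show False using not_nonneg by simp
qed

lemma \<beta>_gt_1: "1 < \<beta>"
proof (rule ccontr)
  assume "\<not> 1 < \<beta>"
  then consider "\<beta> = 1" | "\<beta> < 1" by linarith
  then have "moment_sum M b W 1 \<le> 1"
  proof cases
    case 1 then show ?thesis using \<beta>_zero(2) phi_zero_iff by simp
  next
    case 2
    then show ?thesis using \<beta>_pos phi_pos_iff[of 1] by (simp add: less_imp_le)
  qed
  then show False using moment_sum_1 by simp
qed

lemma moment_sum_\<beta>: "moment_sum M b W \<beta> = 1"
  using \<beta>_zero(2) phi_zero_iff by simp

lemma moment_sum_less_1: "\<beta> < p \<Longrightarrow> moment_sum M b W p < 1"
  using \<beta>_pos phi_pos_iff by blast

lemma AE_nonzero: "AE \<omega> in M. \<forall>i<b. W \<omega> i \<noteq> 0"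
proof -
  have "AE \<omega> in M. W \<omega> i \<noteq> 0" if i: "i < b" for i
  proof -
    have "AE \<omega> in M. epowr (norm (W \<omega> i)) (-1) \<noteq> \<infinity>"
      using entry_moment[OF i, of "-1"] i by (intro nn_integral_PInf_AE) auto
    then show ?thesis by eventually_elim (auto simp: epowr_def)
  qed
  then have "AE \<omega> in M. \<forall>i\<in>{..<b}. W \<omega> i \<noteq> 0" by (intro AE_finite_allI) auto
  then show ?thesis by (simp add: Ball_def)
qed

text \<open>Since all moments of order greater than \<open>\<beta>\<close> are less than one, no component exceeds one.\<close>

lemma AE_bounded: "AE \<omega> in M. \<forall>i<b. norm (W \<omega> i) \<le> 1"
proof -
  have "AE \<omega> in M. norm (W \<omega> i) \<le> 1" if i: "i < b" for i
  proof -
    have "AE \<omega> in M. \<not> 1 + 1 / real (Suc n) \<le> norm (W \<omega> i)" for n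
    proof -
      define c where "c = 1 + 1 / real (Suc n)"
      have c: "1 < c" by (simp add: c_def)
      let ?A = "{\<omega> \<in> space M. c \<le> norm (W \<omega> i)}"
      have A: "?A \<in> sets M" using i by measurable
      have bound: "prob ?A \<le> (1 / c) ^ k" if k: "\<beta> < real k" for k
      proof -
        have "ennreal (c ^ k) * emeasure M ?A = (\<integral>\<^sup>+\<omega>. ennreal (c ^ k) * indicator ?A \<omega> \<partial>M)"
          using A by (simp add: nn_integral_cmult_indicator)
        also have "\<dots> \<le> (\<integral>\<^sup>+\<omega>. epowr (norm (W \<omega> i)) (real k) \<partial>M)"
        proof (rule nn_integral_mono)
          fix \<omega>
          have "c ^ k = c powr real k" using c by (simp add: powr_realpow)
          then show "ennreal (c ^ k) * indicator ?A \<omega> \<le> epowr (norm (W \<omega> i)) (real k)"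
            using c by (auto simp: epowr_nonneg indicator_def intro!: ennreal_leI powr_mono2)
        qed
        also have "\<dots> \<le> moment_sum M b W (real k)"
          unfolding moment_sum_eq using i by (intro member_le_sum) auto
        also have "\<dots> \<le> 1" using moment_sum_less_1[OF k] by simp
        finally have "ennreal (c ^ k * prob ?A) \<le> 1"
          using c by (simp add: emeasure_eq_measure ennreal_mult)
        then have "c ^ k * prob ?A \<le> 1" by simp
        then show ?thesis using c by (simp add: power_divide field_simps)
      qed
      have "prob ?A \<le> 0"
      proof (rule LIMSEQ_le_const)
        show "(\<lambda>k. (1 / c) ^ k) \<longlonglongrightarrow> 0" using c by (intro LIMSEQ_power_zero) auto
        obtain k0 :: nat where "\<beta> < real k0" using reals_Archimedean2 by blast
        then show "\<exists>N. \<forall>k\<ge>N. prob ?A \<le> (1 / c) ^ k"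
          by (intro exI[of _ k0] allI impI bound) (simp add: less_le_trans)
      qed
      then have "prob ?A = 0" using measure_nonneg[of M ?A] by linarith
      then show ?thesis using A by (auto simp: prob_eq_0 c_def)
    qed
    then have "AE \<omega> in M. \<forall>n. \<not> 1 + 1 / real (Suc n) \<le> norm (W \<omega> i)"
      unfolding AE_all_countable by blast
    then show ?thesis
    proof eventually_elim
      case (elim \<omega>)
      show ?case
      proof (rule ccontr)
        assume "\<not> norm (W \<omega> i) \<le> 1"
        then obtain n where "inverse (real (Suc n)) < norm (W \<omega> i) - 1"
          using reals_Archimedean[of "norm (W \<omega> i) - 1"] by auto
        then show False using elim by (auto simp: inverse_eq_divide dest!: spec[of _ n])
      qed
    qed
  qed
  then have "AE \<omega> in M. \<forall>i\<in>{..<b}. norm (W \<omega> i) \<le> 1" by (intro AE_finite_allI) auto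
  then show ?thesis by (simp add: Ball_def)
qed

lemma moment_sum_antimono:
  assumes "0 \<le> p" "p \<le> p'"
  shows "moment_sum M b W p' \<le> moment_sum M b W p"
  unfolding moment_sum_def
proof (rule nn_integral_mono_AE)
  show "AE \<omega> in M. (\<Sum>i<b. epowr (norm (W \<omega> i)) p') \<le> (\<Sum>i<b. epowr (norm (W \<omega> i)) p)"
    using AE_bounded
  proof eventually_elim
    case (elim \<omega>)
    show ?case
    proof (rule sum_mono)
      fix i assume "i \<in> {..<b}"
      then have "norm (W \<omega> i) powr p' \<le> norm (W \<omega> i) powr p"
        using elim assms by (cases "W \<omega> i = 0") (auto intro!: powr_mono')
      then show "epowr (norm (W \<omega> i)) p' \<le> epowr (norm (W \<omega> i)) p"
        using assms by (simp add: epowr_nonneg ennreal_leI)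
    qed
  qed
qed

lemma moment_sum_nat: "1 \<le> k \<Longrightarrow> (\<integral>\<^sup>+\<omega>. (\<Sum>i<b. ennreal (norm (W \<omega> i) ^ k)) \<partial>M) = moment_sum M b W (real k)"
  unfolding moment_sum_def by (intro nn_integral_cong sum.cong) (auto simp: epowr_nonneg powr_realpow')

lemma inverse_moment:
  assumes i: "i < b" and e: "0 < e"
  shows "(\<integral>\<^sup>+\<omega>. ennreal (1 / (norm (W \<omega> i) powr e) ^ k) \<partial>M) < \<infinity>"
proof -
  have "(\<integral>\<^sup>+\<omega>. ennreal (1 / (norm (W \<omega> i) powr e) ^ k) \<partial>M) \<le> (\<integral>\<^sup>+\<omega>. epowr (norm (W \<omega> i)) (- (e * real k)) \<partial>M)"
  proof (rule nn_integral_mono_AE)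
    show "AE \<omega> in M. ennreal (1 / (norm (W \<omega> i) powr e) ^ k) \<le> epowr (norm (W \<omega> i)) (- (e * real k))"
      using AE_nonzero
    proof eventually_elim
      case (elim \<omega>)
      then have "0 < norm (W \<omega> i)" using i by simp
      then have "1 / (norm (W \<omega> i) powr e) ^ k = norm (W \<omega> i) powr (- (e * real k))"
        by (simp add: powr_minus_divide powr_powr flip: powr_realpow)
      then show ?case using \<open>0 < norm (W \<omega> i)\<close> by (simp add: epowr_def)
    qed
  qed
  also have "\<dots> < \<infinity>" by (rule entry_moment[OF i])
  finally show ?thesis .
qed

text \<open>In the first case there is a \<open>q\<close> in \<open>(1, 2]\<close> with \<open>\<phi>\<^sub>W(q) > 0\<close>. Since moments decrease in their
  order, \<open>\<beta> < q\<close>, so that all moments of order at least two are less than one.\<close>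

lemma cascade_law_W: "cascade_law (distr M (vec_space b) W) b"
proof (rule cascade_law_distr[OF b W AE_bounded AE_nonzero])
  show "(\<integral>\<^sup>+\<omega>. ennreal (1 / norm (W \<omega> i) ^ k) \<partial>M) < \<infinity>" if "i < b" for i k
    using inverse_moment[OF that, of 1 k] by simp
  show "(\<integral>\<omega>. (\<Sum>i<b. W \<omega> i) \<partial>M) = 1" by (rule W_mean)
  show "(\<forall>k\<ge>2. (\<integral>\<^sup>+\<omega>. (\<Sum>i<b. ennreal (norm (W \<omega> i) ^ k)) \<partial>M) < 1) \<or>
      (AE \<omega> in M. (\<Sum>i<b. W \<omega> i) = 1) \<and>
      (\<exists>k\<ge>1. (\<integral>\<^sup>+\<omega>. (\<Sum>i<b. ennreal (norm (W \<omega> i) ^ k)) \<partial>M) < 1)"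
    using convergence_cases
  proof
    assume "\<P>(\<omega> in M. (\<Sum>i<b. W \<omega> i) \<noteq> 1) > 0 \<and>
      (\<exists>p>1. phi M b W p > 0 \<and> (p \<in> {1<..2} \<or> phi M b W 2 > 0))"
    then obtain p where p: "1 < p" "phi M b W p > 0" "p \<in> {1<..2} \<or> phi M b W 2 > 0" by blast
    then obtain q where q: "1 < q" "q \<le> 2" "moment_sum M b W q < 1"
    proof (cases "p \<le> 2")
      case True then show thesis using that[of p] p by (simp add: phi_pos_iff)
    next
      case False then show thesis using that[of 2] p by (simp add: phi_pos_iff)
    qed
    have "\<beta> < q"
    proof (rule ccontr)
      assume "\<not> \<beta> < q"
      then have "moment_sum M b W \<beta> \<le> moment_sum M b W q" using q by (intro moment_sum_antimono) auto
      then show False using q(3) moment_sum_\<beta> by simp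
    qed
    then have "moment_sum M b W (real k) < 1" if "2 \<le> k" for k :: nat
      using q(2) that by (intro moment_sum_less_1) linarith
    then show ?thesis using moment_sum_nat by auto
  next
    assume "\<P>(\<omega> in M. (\<Sum>i<b. W \<omega> i) = 1) = 1 \<and> (\<exists>p>1. phi M b W p > 0)"
    then have "\<P>(\<omega> in M. (\<Sum>i<b. W \<omega> i) = 1) = 1" ..
    then have "AE \<omega> in M. (\<Sum>i<b. W \<omega> i) = 1"
      by (subst (asm) prob_Collect_eq_1) auto
    moreover obtain k :: nat where "\<beta> < real k" using reals_Archimedean2 by blast
    then have "(\<integral>\<^sup>+\<omega>. (\<Sum>i<b. ennreal (norm (W \<omega> i) ^ k)) \<partial>M) < 1" "1 \<le> k"
      using moment_sum_nat[of k] moment_sum_less_1[of "real k"] \<beta>_gt_1 by auto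
    ultimately show ?thesis by blast
  qed
qed

definition power_map :: "(nat \<Rightarrow> complex) \<Rightarrow> nat \<Rightarrow> complex" where
  "power_map a = (\<lambda>i\<in>{..<b}. of_real (norm (a i) powr \<beta>))"

lemma measurable_power_map: "power_map \<in> vec_space b \<rightarrow>\<^sub>M vec_space b"
  unfolding power_map_def vec_space_def
proof (rule measurable_restrict)
  fix i assume "i \<in> {..<b}"
  then have [measurable]: "(\<lambda>a. a i) \<in> borel_measurable (PiM {..<b} (\<lambda>_. borel :: complex measure))"
    by (rule measurable_component_singleton)
  show "(\<lambda>a. complex_of_real (norm (a i) powr \<beta>)) \<in> borel_measurable (PiM {..<b} (\<lambda>_. borel :: complex measure))"
    by measurable
qed

text \<open>The vector of the powers \<open>|W\<^sub>i|\<^sup>\<beta>\<close> always belongs to the first case: its moment of order one is the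
  moment of order \<open>\<beta>\<close> of \<open>W\<close>, and its higher moments are moments of \<open>W\<close> of order greater than \<open>\<beta>\<close>.\<close>

lemma cascade_law_power: "cascade_law (distr M (vec_space b) (\<lambda>\<omega>. power_map (W \<omega>))) b"
proof (rule cascade_law_distr[OF b measurable_compose[OF W measurable_power_map]])
  show "AE \<omega> in M. \<forall>i<b. norm (power_map (W \<omega>) i) \<le> 1"
    using AE_bounded by eventually_elim (use \<beta>_gt_1 in \<open>auto simp: power_map_def powr_le1\<close>)
  show "AE \<omega> in M. \<forall>i<b. power_map (W \<omega>) i \<noteq> 0"
    using AE_nonzero by eventually_elim (auto simp: power_map_def)
  show "(\<integral>\<^sup>+\<omega>. ennreal (1 / norm (power_map (W \<omega>) i) ^ k) \<partial>M) < \<infinity>" if "i < b" for i k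
    using inverse_moment[OF that, of \<beta> k] \<beta>_gt_1 that by (simp add: power_map_def)
  have "(\<integral>\<^sup>+\<omega>. ennreal (\<Sum>i<b. norm (W \<omega> i) powr \<beta>) \<partial>M) = ennreal 1"
    using moment_sum_\<beta> \<beta>_gt_1 by (simp add: moment_sum_def epowr_nonneg sum_ennreal)
  then have "(\<integral>\<omega>. (\<Sum>i<b. norm (W \<omega> i) powr \<beta>) \<partial>M) = 1"
    by (subst (asm) nn_integral_eq_integrable) (auto intro!: sum_nonneg)
  moreover have "(\<integral>\<omega>. (\<Sum>i<b. power_map (W \<omega>) i) \<partial>M) = of_real (\<integral>\<omega>. (\<Sum>i<b. norm (W \<omega> i) powr \<beta>) \<partial>M)"
    by (simp add: power_map_def flip: integral_complex_of_real)
  ultimately show "(\<integral>\<omega>. (\<Sum>i<b. power_map (W \<omega>) i) \<partial>M) = 1" by simp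
  have "(\<integral>\<^sup>+\<omega>. (\<Sum>i<b. ennreal (norm (power_map (W \<omega>) i) ^ k)) \<partial>M) < 1" if k: "2 \<le> k" for k
  proof -
    have "\<beta> * 1 < \<beta> * real k" using k \<beta>_gt_1 by (intro mult_strict_left_mono) auto
    then have "moment_sum M b W (\<beta> * real k) < 1" using moment_sum_less_1 by simp
    also have "moment_sum M b W (\<beta> * real k) = (\<integral>\<^sup>+\<omega>. (\<Sum>i<b. ennreal (norm (power_map (W \<omega>) i) ^ k)) \<partial>M)"
      unfolding moment_sum_def using \<beta>_gt_1 k
      by (intro nn_integral_cong sum.cong)
        (auto simp: epowr_nonneg power_map_def powr_powr[symmetric] powr_realpow')
    finally show ?thesis .
  qed
  then show "(\<forall>k\<ge>2. (\<integral>\<^sup>+\<omega>. (\<Sum>i<b. ennreal (norm (power_map (W \<omega>) i) ^ k)) \<partial>M) < 1) \<or>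
      (AE \<omega> in M. (\<Sum>i<b. power_map (W \<omega>) i) = 1) \<and>
      (\<exists>k\<ge>1. (\<integral>\<^sup>+\<omega>. (\<Sum>i<b. ennreal (norm (power_map (W \<omega>) i) ^ k)) \<partial>M) < 1)" by blast
qed

end

section \<open>Monofractality\<close>

theorem theorem2p3:
  fixes M :: "'a measure"
    and b :: nat
    and W :: "'a \<Rightarrow> nat \<Rightarrow> complex"
    and Ws :: "nat list \<Rightarrow> 'a \<Rightarrow> nat \<Rightarrow> complex"
    and \<beta> :: real
  defines "W\<beta> \<equiv> power_family M b W \<beta> Ws"
  defines "L \<equiv> \<lambda>\<omega>. cascade_limit b W\<beta> \<omega> 1"
  defines "B \<equiv> \<lambda>\<omega>. cascade_limit b Ws \<omega> \<circ> the_inv_into {0..1} (cascade_limit b W\<beta> \<omega>)"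
  assumes prob: "prob_space M"
    and b: "b \<ge> 2"
    and W_measurable: "W \<in> M \<rightarrow>\<^sub>M vec_space b"
    and W_integrable: "\<forall>i<b. integrable M (\<lambda>\<omega>. W \<omega> i)"
    and W_mean: "(LINT \<omega>|M. (\<Sum>i<b. W \<omega> i)) = 1"
    and Ws_indep: "prob_space.indep_vars M (\<lambda>_. vec_space b) Ws (words b)"
    and Ws_copies: "\<forall>w\<in>words b. distr M (vec_space b) (Ws w) = distr M (vec_space b) W"
    and not_nonneg: "\<P>(\<omega> in M. \<not> (\<forall>i<b. W \<omega> i \<in> \<real>\<^sub>\<ge>\<^sub>0)) > 0"
    and moments: "\<forall>p::real. (\<Sum>i<b. \<integral>\<^sup>+\<omega>. epowr (norm (W \<omega> i)) p \<partial>M) < \<infinity>"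
    and cases:
      "(\<P>(\<omega> in M. (\<Sum>i<b. W \<omega> i) \<noteq> 1) > 0 \<and>
          (\<exists>p>1. phi M b W p > 0 \<and> (p \<in> {1<..2} \<or> phi M b W 2 > 0))) \<or>
       (\<P>(\<omega> in M. (\<Sum>i<b. W \<omega> i) = 1) = 1 \<and> (\<exists>p>1. phi M b W p > 0))"
    and \<beta>_zero: "\<beta> \<ge> 0" "phi M b W \<beta> = 0"
    and \<beta>_least: "\<forall>p\<ge>0. phi M b W p = 0 \<longrightarrow> \<beta> \<le> p"
    and \<beta>_pos: "\<forall>p>\<beta>. phi M b W p > 0"
  shows "\<beta> > 1
    \<and> phi M b (W\<beta> []) 1 = 0
    \<and> (\<forall>p>1. phi M b (W\<beta> []) p > 0)
    \<and> (AE \<omega> in M. strongly_monofractal {0..L \<omega>} (B \<omega>)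
          \<and> (\<forall>t\<in>{0..L \<omega>}. has_local_exponent {0..L \<omega>} (B \<omega>) (1 / \<beta>) t))"
proof -
  interpret critical_vector M b W \<beta>
    by (intro critical_vector.intro critical_vector_axioms.intro) fact+
  have b1: "1 \<le> b" using b by simp
  have W\<beta>: "W\<beta> w \<omega> i = norm (Ws w \<omega> i) powr \<beta>" if "i < b" for w \<omega> i
    unfolding W\<beta>_def power_family_def using that \<beta>_zero(2) b by (simp add: zero_ereal_def[symmetric])
  have Ws_rv: "Ws w \<in> M \<rightarrow>\<^sub>M vec_space b" if "w \<in> words b" for w
    using Ws_indep that unfolding indep_vars_def by blast
  have moment_W\<beta>: "moment_sum M b (W\<beta> []) p = moment_sum M b W (\<beta> * p)" if p: "0 < p" for p
  proof -
    have entry: "(\<lambda>a. a i :: complex) \<in> borel_measurable (vec_space b)" if "i < b" for i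
      unfolding vec_space_def by (rule measurable_component_singleton) (use that in simp)
    let ?f = "\<lambda>a. \<Sum>i<b. epowr (norm (a i :: complex)) (\<beta> * p)"
    have f: "?f \<in> borel_measurable (vec_space b)"
      by (intro borel_measurable_sum measurable_epowr measurable_compose[OF entry borel_measurable_norm]) auto
    have "moment_sum M b (W\<beta> []) p = (\<integral>\<^sup>+\<omega>. ?f (Ws [] \<omega>) \<partial>M)"
      unfolding moment_sum_def using p \<beta>_gt_1
      by (intro nn_integral_cong sum.cong) (auto simp: W\<beta> epowr_nonneg powr_powr)
    also have "\<dots> = (\<integral>\<^sup>+a. ?f a \<partial>distr M (vec_space b) (Ws []))"
      using Ws_rv[of "[]"] f by (subst nn_integral_distr) auto
    also have "\<dots> = (\<integral>\<^sup>+a. ?f a \<partial>distr M (vec_space b) W)" using Ws_copies by simp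
    also have "\<dots> = moment_sum M b W (\<beta> * p)"
      unfolding moment_sum_def using f by (subst nn_integral_distr[OF W_measurable]) auto
    finally show ?thesis .
  qed
  have phi_W\<beta>: "phi M b (W\<beta> []) p = phi M b W (\<beta> * p)" if "0 < p" for p
    unfolding phi_def moment_W\<beta>[OF that] ..
  have "phi M b (W\<beta> []) 1 = 0" using phi_W\<beta>[of 1] \<beta>_zero(2) by simp
  moreover have "phi M b (W\<beta> []) p > 0" if p: "1 < p" for p
  proof -
    have "\<beta> * 1 < \<beta> * p" using p \<beta>_gt_1 by (intro mult_strict_left_mono) auto
    then show ?thesis using phi_W\<beta>[of p] \<beta>_pos p by simp
  qed
  moreover have "AE \<omega> in M. strongly_monofractal {0..L \<omega>} (B \<omega>)
      \<and> (\<forall>t\<in>{0..L \<omega>}. has_local_exponent {0..L \<omega>} (B \<omega>) (1 / \<beta>) t)"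
  proof -
    have "AE \<omega> in M. regular_family b (\<lambda>w\<in>words b. Ws w \<omega>)"
      by (rule AE_regular_copies[OF cascade_law_W Ws_indep]) (use Ws_copies in blast)
    moreover have "AE \<omega> in M. regular_family b (\<lambda>w\<in>words b. power_map (Ws w \<omega>))"
    proof (rule AE_regular_copies[OF cascade_law_power])
      show "indep_vars (\<lambda>_. vec_space b) (\<lambda>w \<omega>. power_map (Ws w \<omega>)) (words b)"
        by (rule indep_vars_compose2[OF Ws_indep]) (rule measurable_power_map)
      fix w assume w: "w \<in> words b"
      have "distr M (vec_space b) (\<lambda>\<omega>. power_map (U \<omega>)) = distr (distr M (vec_space b) U) (vec_space b) power_map"
        if "U \<in> M \<rightarrow>\<^sub>M vec_space b" for U
        by (subst distr_distr[OF measurable_power_map that]) (simp add: comp_def)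
      then show "distr M (vec_space b) (\<lambda>\<omega>. power_map (Ws w \<omega>)) = distr M (vec_space b) (\<lambda>\<omega>. power_map (W \<omega>))"
        using Ws_rv[OF w] W_measurable Ws_copies w by simp
    qed
    ultimately show ?thesis
    proof eventually_elim
      case (elim \<omega>)
      let ?x = "\<lambda>w\<in>words b. Ws w \<omega>" and ?y = "\<lambda>w\<in>words b. W\<beta> w \<omega>"
      have y: "regular_family b ?y"
        by (rule regular_family_of_real[OF elim(2) b1]) (simp add: power_map_def W\<beta>)
      obtain Cx rx \<rho>x where "contracting_family b ?x Cx rx \<rho>x"
        using regular_family_contracting[OF elim(1) b1] .
      moreover obtain Cy ry \<rho>y where "contracting_family b ?y Cy ry \<rho>y"
        using regular_family_contracting[OF y b1] .
      ultimately have coupled: "coupled_families b ?x Cx rx \<rho>x ?y Cy ry \<rho>y \<beta>"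
        using b \<beta>_gt_1 elim(1) y
        by (intro coupled_families.intro coupled_families_axioms.intro) (auto simp: W\<beta>)
      have "has_local_exponent {0..L \<omega>} (B \<omega>) (1 / \<beta>) t" if "t \<in> {0..L \<omega>}" for t
        unfolding L_def B_def
      proof (rule coupled_families.time_changed_exponent[OF coupled])
        show "cascade_limit b Ws \<omega> s = cell_cascade_lim b ?x s" if "s \<in> {0..1}" for s
          unfolding cascade_limit_def cell_cascade_lim_def cascade_eq_cell_cascade[OF b1 that] ..
        show "cascade_limit b W\<beta> \<omega> s = cell_cascade_lim b ?y s" if "s \<in> {0..1}" for s
          unfolding cascade_limit_def cell_cascade_lim_def cascade_eq_cell_cascade[OF b1 that] ..
        show "t \<in> {0..cascade_limit b W\<beta> \<omega> 1}" using that by (simp add: L_def)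
      qed
      then show ?case unfolding strongly_monofractal_def by blast
    qed
  qed
  ultimately show ?thesis using \<beta>_gt_1 by blast
qed

end
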